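(* For every Lebesgue measurable set $E\subseteq\mathbb{R}$ there exists a $G_\delta$ set $\widetilde{E}\subseteq\mathbb{R}$ which is a $\operatorname{Lip} 1$ set and satisfies $|E\,\triangle\,\widetilde{E}|=0$.
   Context: $|A|$ denotes the Lebesgue measure of $A\subseteq\mathbb{R}$. For a continuous $f:\mathbb{R}\to\mathbb{R}$, $x\in\mathbb{R}$ and $r>0$ let $M_f(x,r)=\frac{\sup\{|f(x)-f(y)| : |x-y|\le r\}}{r}$ and $\operatorname{Lip} f(x)=\limsup_{r\to 0^+}M_f(x,r)$. A set $E\subseteq\mathbb{R}$ is called a $\operatorname{Lip} 1$ set if there exists a continuous function $f:\mathbb{R}\to\mathbb{R}$ with $\operatorname{Lip} f=\mathbf{1}_E$ (the indicator function of $E$) on all of $\mathbb{R}$. *)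

theory Defs
  imports "HOL-Analysis.Analysis"
begin

definition Mf :: "(real \<Rightarrow> real) \<Rightarrow> real \<Rightarrow> real \<Rightarrow> ereal" where
  "Mf f x r = (SUP y\<in>{y. \<bar>x - y\<bar> \<le> r}. ereal \<bar>f x - f y\<bar>) / ereal r"

definition Lip :: "(real \<Rightarrow> real) \<Rightarrow> real \<Rightarrow> ereal" where
  "Lip f x = Limsup (at_right 0) (Mf f x)"

definition Lip1_set :: "real set \<Rightarrow> bool" where
  "Lip1_set E \<longleftrightarrow> (\<exists>f. continuous_on UNIV f \<and> (\<forall>x. Lip f x = ereal (indicator E x)))"

end

theory Submission
  imports Defs
begin

text \<open>
  The function is a limit of zigzag functions \<open>f\<^sub>k\<close>. At stage \<open>k\<close> there is an open set \<open>U\<^sub>k\<close>, which differs from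
  \<open>E\<close> by a set of measure at most \<open>2\<^sup>-\<^sup>k\<close> (up to an index shift), tiled by short intervals in which \<open>E\<close> has density close to 1 and
  on which \<open>f\<^sub>k\<close> has slope \<open>\<plusminus>c\<^sub>k\<close>, where \<open>c\<^sub>k\<close> increases to 1; off \<open>U\<^sub>k\<close> the derivative of \<open>f\<^sub>k\<close> is 0.
  This is possible because the components of \<open>U\<^sub>k\<close> can be chosen with density points of \<open>E\<close> as endpoints:
  the tiles may then shrink faster than their distance to the endpoints and still be almost filled by \<open>E\<close>.
  Passing to stage \<open>k + 1\<close>, the values of \<open>f\<^sub>k\<close> at the endpoints of all tiles are kept. Since a tile is
  almost filled by \<open>E\<close>, its rise can be carried by \<open>U\<^bsub>k+1\<^esub>\<close> at the slightly larger slope \<open>c\<^bsub>k+1\<^esub>\<close>.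

  The set sought is \<open>limsup U\<^sub>k\<close>, which is \<open>G\<^sub>\<delta>\<close> and, by Borel--Cantelli, equal to \<open>E\<close> almost everywhere. A point
  lying in infinitely many \<open>U\<^sub>k\<close> lies in arbitrarily short intervals over which the limit function has slope
  \<open>\<plusminus>c\<^sub>k\<close>. If \<open>x\<close> lies in no \<open>U\<^sub>j\<close> with \<open>j \<ge> m\<close>, the tiles are so small compared to their distance to \<open>x\<close> that the
  limit function differs from \<open>f\<^sub>m\<close> at \<open>y\<close> by at most \<open>6 \<cdot> 2\<^sup>-\<^sup>m \<bar>y - x\<bar>\<close>.
\<close>

section \<open>Density points\<close>

text \<open>\<open>Lip\<close> has to be 0 or 1 at every single point, so estimates that hold almost
  everywhere do not suffice; null sets can be absorbed only in the difference between
  \<open>E\<close> and the final set. The growth of the slopes is the budget of the construction.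
  The gap between \<open>c k\<close> and \<open>c (Suc k)\<close> is spent three times: on the part
  of a tile missed by the blocks of the next stage, on margins at both ends of a block over which
  there is no net rise (otherwise the derivative could not vanish at the ends), and on keeping the
  two legs of each tent comparable in length, so that both inherit a small defect from the interval
  that they divide. The sets \<open>U k\<close> are not nested: a part of \<open>E\<close> missed at
  one stage is picked up later because the inactive pieces are refined as well, by zigzags without
  net rise. Their height is small relative to the distance from every point outside the new open
  set, so no derivative arises at points that stay outside. The upper bound
  \<open>Lip \<le> 1\<close> needs no care, since all approximants are 1-Lipschitz.\<close>

lemma negligible_nondensity_points:
  fixes E :: "real set"
  assumes E: "E \<in> sets lebesgue" and e: "e > 0"
  shows "negligible {x\<in>E. \<forall>r>0. \<exists>t. 0 < t \<and> t \<le> r \<and> measure lebesgue ({x-t..x+t} - E) > e * t}"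
    (is "negligible ?N")
proof -
  \<comment> \<open>A bounded window keeps all measures finite.\<close>
  have "negligible (?N \<inter> {-R<..<R})" for R :: real
    unfolding negligible_outer_le
  proof (intro allI impI)
    fix \<epsilon> :: real assume "\<epsilon> > 0"
    define I where "I = {-R<..<R}"
    have EI: "E \<inter> I \<in> lmeasurable"
      unfolding I_def by (rule fmeasurable_Int_fmeasurable[OF _ E, simplified Int_commute]) auto
    \<comment> \<open>The factor \<open>e / 2\<close> cancels the ratio \<open>2 / e\<close> of
      length to defect of the balls selected below.\<close>
    obtain O' where O': "open O'" "E \<inter> I \<subseteq> O'" "O' - E \<inter> I \<in> lmeasurable"
        "emeasure lebesgue (O' - E \<inter> I) < ennreal (\<epsilon> * e / 2)"
      using sets_lebesgue_outer_open[of "E \<inter> I" "\<epsilon> * e / 2"] EI \<open>\<epsilon> > 0\<close> e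
      by (metis fmeasurableD mult_pos_pos half_gt_zero)
    have mO: "measure lebesgue (O' - E \<inter> I) < \<epsilon> * e / 2"
      using O'(3,4) by (metis emeasure_eq_measure2 ennreal_less_iff measure_nonneg)
    define G where "G = O' \<inter> I"
    have "open G" unfolding G_def I_def using O' by auto
    have Glm: "G \<in> lmeasurable" unfolding G_def I_def using O'(1)
      fmeasurable_Int_fmeasurable[OF lmeasurable_interval(2)[of "-R" R], of O'] by (simp add: Int_commute)
    have GE: "G - E \<in> lmeasurable" using Glm E by (simp add: fmeasurable.Diff fmeasurable_Diff)
    have mGE: "measure lebesgue (G - E) \<le> \<epsilon> * e / 2"
    proof -
      have "measure lebesgue (G - E) \<le> measure lebesgue (O' - E \<inter> I)"
        by (rule measure_mono_fmeasurable) (use O'(3) GE in \<open>auto simp: G_def intro: fmeasurable_Diff\<close>)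
      then show ?thesis using mO by simp
    qed
    \<comment> \<open>Each such ball has length \<open>2 * t\<close> and defect more than
      \<open>e * t\<close>. Disjoint balls have disjoint defects, all inside \<open>G - E\<close>,
      so a Vitali subfamily has total length at most \<open>2 / e\<close> times the measure of
      \<open>G - E\<close>.\<close>
    define K where "K = {(x,t). 0 < t \<and> {x-t..x+t} \<subseteq> G \<and> measure lebesgue ({x-t..x+t} - E) > e * t}"
    obtain C where C: "countable C" "C \<subseteq> K"
      "pairwise (\<lambda>i j. disjnt (cball (fst i) (snd i)) (cball (fst j) (snd j))) C"
      "negligible (?N \<inter> I - (\<Union>i\<in>C. cball (fst i) (snd i)))"
    proof (rule Vitali_covering_theorem_cballs[of K snd "?N \<inter> I" fst])
      show "\<And>i. i \<in> K \<Longrightarrow> 0 < snd i" by (auto simp: K_def)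
      fix x d :: real assume x: "x \<in> ?N \<inter> I" and "0 < d"
      then have "x \<in> G" using O' by (auto simp: G_def)
      then obtain k where k: "k > 0" "cball x k \<subseteq> G" using \<open>open G\<close> open_contains_cball by blast
      define r where "r = min k (d/2)"
      have "r > 0" using k \<open>0 < d\<close> by (simp add: r_def)
      then obtain t where t: "0 < t" "t \<le> r" "measure lebesgue ({x-t..x+t} - E) > e * t"
        using x by auto
      have "{x-t..x+t} \<subseteq> G" using k t(2) by (auto simp: r_def cball_eq_atLeastAtMost)
      then have "(x,t) \<in> K" using t by (simp add: K_def)
      then show "\<exists>i. i \<in> K \<and> x \<in> cball (fst i) (snd i) \<and> snd i < d"
        using t \<open>0 < d\<close> by (intro exI[of _ "(x,t)"]) (auto simp: r_def)
    qed blast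
    let ?B = "\<lambda>i. cball (fst i) (snd i) :: real set"
    have Bd: "?B i = {fst i - snd i..fst i + snd i}" for i :: "real \<times> real" by (simp add: cball_eq_atLeastAtMost)
    have fin: "measure lebesgue (\<Union>i\<in>F. ?B i) \<le> \<epsilon>" if F: "F \<subseteq> C" "finite F" for F
    proof -
      have Ki: "0 < snd i" "?B i \<subseteq> G" "measure lebesgue (?B i - E) > e * snd i" if "i \<in> F" for i
      proof -
        have "i \<in> K" using that F C(2) by blast
        then show "0 < snd i" "?B i \<subseteq> G" "measure lebesgue (?B i - E) > e * snd i"
          unfolding Bd K_def by (simp_all add: case_prod_beta)
      qed
      have "measure lebesgue (\<Union>i\<in>F. ?B i) \<le> (\<Sum>i\<in>F. measure lebesgue (?B i))"
        by (rule measure_UNION_le) (use F in auto)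
      also have "\<dots> \<le> (\<Sum>i\<in>F. 2 / e * measure lebesgue (?B i - E))"
      proof (rule sum_mono)
        fix i assume i: "i \<in> F"
        have "measure lebesgue (?B i) = 2 * snd i" using Ki(1)[OF i] by (simp add: Bd)
        then show "measure lebesgue (?B i) \<le> 2 / e * measure lebesgue (?B i - E)"
          using Ki(3)[OF i] e by (simp add: field_simps)
      qed
      also have "\<dots> = 2 / e * (\<Sum>i\<in>F. measure lebesgue (?B i - E))" by (simp add: sum_distrib_left)
      also have "(\<Sum>i\<in>F. measure lebesgue (?B i - E)) = measure lebesgue (\<Union>i\<in>F. ?B i - E)"
      proof (rule measure_UNION'[symmetric])
        show "finite F" by fact
        show "\<And>i. i \<in> F \<Longrightarrow> ?B i - E \<in> lmeasurable" using E by (auto intro: fmeasurable_Diff)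
        show "pairwise (\<lambda>i j. disjnt (?B i - E) (?B j - E)) F"
          using pairwise_subset[OF C(3) F(1)] by (rule pairwise_mono) (auto simp: disjnt_def)
      qed
      also have "\<dots> \<le> measure lebesgue (G - E)"
        by (rule measure_mono_fmeasurable) (use Ki(2) GE F E in \<open>auto intro!: sets.finite_UN sets.Diff\<close>)
      also have "2 / e * measure lebesgue (G - E) \<le> \<epsilon>"
        using mGE e by (simp add: field_simps)
      finally show ?thesis using e by (simp add: divide_right_mono)
    qed
    have U: "(\<Union>i\<in>C. ?B i) \<in> lmeasurable" "measure lebesgue (\<Union>i\<in>C. ?B i) \<le> \<epsilon>"
      using fmeasurable_UN_bound[of C ?B lebesgue \<epsilon>] measure_UN_bound[of C ?B lebesgue \<epsilon>] C(1) fin by auto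
    let ?T = "(\<Union>i\<in>C. ?B i) \<union> (?N \<inter> I - (\<Union>i\<in>C. ?B i))"
    show "\<exists>T. ?N \<inter> {-R<..<R} \<subseteq> T \<and> T \<in> lmeasurable \<and> measure lebesgue T \<le> \<epsilon>"
    proof (intro exI[of _ ?T] conjI)
      have "?N \<inter> I - (\<Union>i\<in>C. ?B i) \<in> null_sets lebesgue" using C(4) by (simp add: negligible_iff_null_sets)
      note null = this
      show "measure lebesgue ?T \<le> \<epsilon>"
        unfolding measure_Un_null_set[OF fmeasurableD[OF U(1)] null] by (rule U(2))
      show "?T \<in> lmeasurable"
        by (rule fmeasurable.Un[OF U(1) fmeasurableI_null_sets[OF null]])
    qed (auto simp: I_def)
  qed
  then have "negligible (\<Union>n::nat. ?N \<inter> {-real n<..<real n})" by (intro negligible_countable_Union) auto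
  moreover have "?N \<subseteq> (\<Union>n::nat. ?N \<inter> {-real n<..<real n})"
  proof
    fix x assume x: "x \<in> ?N"
    obtain n :: nat where "\<bar>x\<bar> < real n" using reals_Archimedean2 by blast
    then show "x \<in> (\<Union>n::nat. ?N \<inter> {-real n<..<real n})" using x by (auto intro!: exI[of _ n])
  qed
  ultimately show ?thesis by (rule negligible_subset)
qed


text \<open>For fixed t the defect is a 2-Lipschitz function of the centre: shifting the window by s
  uncovers at most a strip of length s at either end. The set is thus an intersection of closed
  sublevel sets. This gives the measurability needed in the Egorov-type argument that
  follows.\<close>

lemma closed_density_set:
  fixes E :: "real set"
  assumes E: "E \<in> sets lebesgue"
  shows "closed {x. \<forall>t. 0 < t \<and> t \<le> r \<longrightarrow> measure lebesgue ({x-t..x+t} - E) \<le> \<theta> * t}"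
proof -
  have lm: "{u..v} - E \<in> lmeasurable" for u v using E by (simp add: fmeasurable_Diff)
  have "closed {x. measure lebesgue ({x-t..x+t} - E) \<le> \<theta> * t}" for t
  proof -
    let ?m = "\<lambda>x. measure lebesgue ({x-t..x+t} - E)"
    have le: "?m x \<le> ?m y + 2 * \<bar>x - y\<bar>" for x y
    proof -
      define A B where "A = {x-t..x-t+\<bar>x-y\<bar>}" and "B = {x+t-\<bar>x-y\<bar>..x+t}"
      have "?m x \<le> measure lebesgue (({y-t..y+t} - E) \<union> (A \<union> B))"
        by (rule measure_mono_fmeasurable) (auto simp: A_def B_def lm fmeasurableD intro!: fmeasurable.Un)
      also have "\<dots> \<le> ?m y + measure lebesgue (A \<union> B)"
        by (rule measure_Un_le) (auto simp: A_def B_def lm fmeasurableD)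
      also have "measure lebesgue (A \<union> B) \<le> measure lebesgue A + measure lebesgue B"
        by (rule measure_Un_le) (auto simp: A_def B_def)
      also have "measure lebesgue A + measure lebesgue B = 2 * \<bar>x - y\<bar>" by (simp add: A_def B_def)
      finally show ?thesis by simp
    qed
    have "2-lipschitz_on UNIV ?m"
    proof (rule lipschitz_onI)
      show "dist (?m x) (?m y) \<le> 2 * dist x y" for x y
        using le[of x y] le[of y x] by (auto simp: dist_real_def abs_minus_commute)
    qed auto
    then show ?thesis
      by (intro closed_Collect_le lipschitz_on_continuous_on continuous_on_const) 
  qed
  then have "closed (\<Inter>t\<in>{t. 0 < t \<and> t \<le> r}. {x. measure lebesgue ({x-t..x+t} - E) \<le> \<theta> * t})"
    by blast
  moreover have "(\<Inter>t\<in>{t. 0 < t \<and> t \<le> r}. {x. measure lebesgue ({x-t..x+t} - E) \<le> \<theta> * t})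
    = {x. \<forall>t. 0 < t \<and> t \<le> r \<longrightarrow> measure lebesgue ({x-t..x+t} - E) \<le> \<theta> * t}" by auto
  ultimately show ?thesis by simp
qed

text \<open>Egorov-type argument: the closed sets \<open>Z n\<close>, on which one radius works for
  \<theta>, exhaust almost all of E in the window, and inner regularity makes the set compact.
  Uniformity is wanted only for the one ratio \<theta> fixed in advance, which controls blocks of a
  definite length. For arbitrary e the radius may depend on the point, which is enough for the
  derivative at a block endpoint.\<close>

lemma uniform_density_compact:
  fixes E :: "real set"
  assumes E: "E \<in> sets lebesgue" and \<theta>: "\<theta> > 0" and \<epsilon>: "\<epsilon> > 0"
  obtains C r where "compact C" "C \<subseteq> E \<inter> {p..q}" "r > 0"
    "\<And>x t. x \<in> C \<Longrightarrow> 0 < t \<Longrightarrow> t \<le> r \<Longrightarrow> measure lebesgue ({x-t..x+t} - E) \<le> \<theta> * t"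
    "\<And>x e. x \<in> C \<Longrightarrow> 0 < e \<Longrightarrow>
       \<exists>r>0. \<forall>t. 0 < t \<and> t \<le> r \<longrightarrow> measure lebesgue ({x-t..x+t} - E) \<le> e * t"
    "measure lebesgue (E \<inter> {p..q} - C) \<le> \<epsilon>"
proof -
  define N where "N e = {x\<in>E. \<forall>r>0. \<exists>t. 0 < t \<and> t \<le> r \<and> measure lebesgue ({x-t..x+t} - E) > e * t}" for e
  define M where "M = (\<Union>n. N (inverse (Suc n)))"
  have M: "negligible M" unfolding M_def N_def
    using negligible_nondensity_points[OF E] by (intro negligible_countable_Union) (auto simp del: of_nat_Suc)
  have dens: "\<exists>r>0. \<forall>t. 0 < t \<and> t \<le> r \<longrightarrow> measure lebesgue ({x-t..x+t} - E) \<le> e * t"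
    if "x \<in> E - M" "e > 0" for x e
  proof -
    obtain n where n: "inverse (Suc n) < e" using \<open>e > 0\<close> reals_Archimedean by blast
    have "x \<notin> N (inverse (Suc n))" using that by (auto simp: M_def)
    then have "\<not> (\<forall>r>0. \<exists>t. 0 < t \<and> t \<le> r \<and> measure lebesgue ({x-t..x+t} - E) > inverse (Suc n) * t)"
      using that(1) unfolding N_def by blast
    then obtain r where r: "r > 0" "\<And>t. 0 < t \<Longrightarrow> t \<le> r \<Longrightarrow> measure lebesgue ({x-t..x+t} - E) \<le> inverse (Suc n) * t"
      by (meson not_less)
    have "measure lebesgue ({x-t..x+t} - E) \<le> e * t" if "0 < t" "t \<le> r" for t
      using r(2)[OF that] n that mult_right_mono[of "inverse (Suc n)" e t] by linarith
    then show ?thesis using r by blast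
  qed
  define D where "D = E \<inter> {p..q} - M"
  have Mnull: "M \<in> null_sets lebesgue" using M by (simp add: negligible_iff_null_sets)
  have Epq: "E \<inter> {p..q} \<in> lmeasurable"
    using fmeasurable_Int_fmeasurable[OF lmeasurable_interval(1)[of p q] E] by (simp add: Int_commute)
  have D: "D \<in> lmeasurable" unfolding D_def by (intro fmeasurable_Diff Epq null_setsD2[OF Mnull])
  define Z where "Z n = {x. \<forall>t. 0 < t \<and> t \<le> inverse (Suc n) \<longrightarrow> measure lebesgue ({x-t..x+t} - E) \<le> \<theta> * t}" for n
  have Zc: "closed (Z n)" for n unfolding Z_def by (rule closed_density_set[OF E])
  have DZ: "D \<inter> Z n \<in> lmeasurable" for n
    using D Zc[of n] by (intro fmeasurable_Int_fmeasurable) auto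
  have "incseq (\<lambda>n. D \<inter> Z n)"
  proof (rule incseq_SucI)
    fix n
    have "inverse (Suc (Suc n)) \<le> inverse (real (Suc n))" by (simp add: field_simps)
    then have "t \<le> inverse (real (Suc n))" if "t \<le> inverse (real (Suc (Suc n)))" for t
      using that by linarith
    then show "D \<inter> Z n \<subseteq> D \<inter> Z (Suc n)" unfolding Z_def by blast
  qed
  moreover have "(\<Union>n. D \<inter> Z n) = D"
  proof
    show "D \<subseteq> (\<Union>n. D \<inter> Z n)"
    proof
      fix x assume x: "x \<in> D"
      then obtain r where r: "r > 0" "\<And>t. 0 < t \<Longrightarrow> t \<le> r \<Longrightarrow> measure lebesgue ({x-t..x+t} - E) \<le> \<theta> * t"
        using dens[of x \<theta>] \<theta> by (auto simp: D_def)
      obtain n where n: "inverse (Suc n) < r" using \<open>r > 0\<close> reals_Archimedean by blast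
      have "x \<in> Z n" unfolding Z_def using r(2) n by auto
      then show "x \<in> (\<Union>n. D \<inter> Z n)" using x by auto
    qed
  qed auto
  ultimately have "(\<lambda>n. measure lebesgue (D \<inter> Z n)) \<longlonglongrightarrow> measure lebesgue D"
    using Lim_measure_incseq[of "\<lambda>n. D \<inter> Z n" lebesgue] fmeasurableD[OF DZ] fmeasurableD2[OF D]
    by (simp add: image_subset_iff)
  then have "\<forall>\<^sub>F n in sequentially. measure lebesgue (D \<inter> Z n) > measure lebesgue D - \<epsilon> / 2"
    using \<epsilon> by (intro order_tendstoD) auto
  then obtain n where n: "measure lebesgue (D \<inter> Z n) > measure lebesgue D - \<epsilon> / 2"
    by (meson eventually_happens' sequentially_bot)
  obtain C where C: "closed C" "C \<subseteq> D \<inter> Z n" "D \<inter> Z n - C \<in> lmeasurable" "emeasure lebesgue (D \<inter> Z n - C) < ennreal (\<epsilon> / 2)"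
    by (rule sets_lebesgue_inner_closed[OF fmeasurableD[OF DZ[of n]], of "\<epsilon>/2"]) (use \<epsilon> in auto)
  have mC: "measure lebesgue (D \<inter> Z n - C) < \<epsilon> / 2"
    using C(3,4) by (metis emeasure_eq_measure2 ennreal_less_iff measure_nonneg)
  have "measure lebesgue (E \<inter> {p..q} - C) \<le> measure lebesgue ((D - D \<inter> Z n) \<union> (D \<inter> Z n - C) \<union> M)"
  proof (rule measure_mono_fmeasurable)
    show "(D - D \<inter> Z n) \<union> (D \<inter> Z n - C) \<union> M \<in> lmeasurable"
      by (intro fmeasurable.Un fmeasurable_Diff[OF D] C(3) fmeasurableI_null_sets[OF Mnull] fmeasurableD[OF DZ])
    show "E \<inter> {p..q} - C \<in> sets lebesgue" 
      by (rule sets.Diff[OF fmeasurableD[OF Epq]]) (use C(1) in auto)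
  qed (auto simp: D_def)
  also have "\<dots> = measure lebesgue ((D - D \<inter> Z n) \<union> (D \<inter> Z n - C))"
    by (intro measure_Un_null_set Mnull sets.Un sets.Diff fmeasurableD[OF D] fmeasurableD[OF DZ] fmeasurableD[OF C(3)])
  also have "\<dots> \<le> measure lebesgue (D - D \<inter> Z n) + measure lebesgue (D \<inter> Z n - C)"
    by (intro measure_Un_le sets.Diff fmeasurableD[OF D] fmeasurableD[OF DZ] fmeasurableD[OF C(3)])
  also have "measure lebesgue (D - D \<inter> Z n) = measure lebesgue D - measure lebesgue (D \<inter> Z n)"
    by (intro measurable_measure_Diff D fmeasurableD[OF DZ] Int_lower1)
  finally have meas: "measure lebesgue (E \<inter> {p..q} - C) \<le> \<epsilon>" using n mC by linarith
  show thesis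
  proof (rule that[of C "inverse (Suc n)"])
    have "C \<subseteq> {p..q}" using C by (auto simp: D_def)
    then show "compact C" using C(1) by (metis bounded_closed_interval bounded_subset compact_eq_bounded_closed)
    show "C \<subseteq> E \<inter> {p..q}" using C by (auto simp: D_def)
    show "measure lebesgue ({x-t..x+t} - E) \<le> \<theta> * t" if "x \<in> C" "0 < t" "t \<le> inverse (Suc n)" for x t
      using that C(2) unfolding Z_def by blast
    show "\<exists>r>0. \<forall>t. 0 < t \<and> t \<le> r \<longrightarrow> measure lebesgue ({x-t..x+t} - E) \<le> e * t" if "x \<in> C" "0 < e" for x e
      using dens[of x e] that C(2) unfolding D_def by blast
  qed (use meas in auto)
qed

section \<open>Fine partitions\<close>

text \<open>
  A compact interval is represented by the pair of its endpoints. The last clause says that, seen from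
  any point outside of them, nearby pieces are small compared to their distance.
\<close>

definition fine_partition :: "real set \<Rightarrow> (real \<times> real) set \<Rightarrow> bool" where
  "fine_partition S P \<longleftrightarrow>
     (\<forall>(u,v)\<in>P. u < v \<and> {u..v} \<subseteq> S) \<and>
     (\<forall>(u,v)\<in>P. \<forall>(u',v')\<in>P. (u,v) \<noteq> (u',v') \<longrightarrow> v \<le> u' \<or> v' \<le> u) \<and>
     countable (S - (\<Union>(u,v)\<in>P. {u<..<v})) \<and>
     (\<forall>x. \<forall>e>0. \<exists>r>0. \<forall>(u,v)\<in>P.
        (x < u \<and> u < x + r \<longrightarrow> v - u \<le> e * (u - x)) \<and>
        (v < x \<and> x - r < v \<longrightarrow> v - u \<le> e * (x - v)))"

lemma fine_partitionI:
  assumes "\<And>u v. (u,v) \<in> P \<Longrightarrow> u < v" "\<And>u v. (u,v) \<in> P \<Longrightarrow> {u..v} \<subseteq> S"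
    and "\<And>u v u' v'. (u,v) \<in> P \<Longrightarrow> (u',v') \<in> P \<Longrightarrow> (u,v) \<noteq> (u',v') \<Longrightarrow> v \<le> u' \<or> v' \<le> u"
    and "countable (S - (\<Union>(u,v)\<in>P. {u<..<v}))"
    and "\<And>x e. e > 0 \<Longrightarrow> \<exists>r>0. \<forall>u v. (u,v) \<in> P \<longrightarrow> x < u \<longrightarrow> u < x + r \<longrightarrow> v - u \<le> e * (u - x)"
    and "\<And>x e. e > 0 \<Longrightarrow> \<exists>r>0. \<forall>u v. (u,v) \<in> P \<longrightarrow> v < x \<longrightarrow> x - r < v \<longrightarrow> v - u \<le> e * (x - v)"
  shows "fine_partition S P"
proof -
  have "\<exists>r>0. \<forall>(u,v)\<in>P.
        (x < u \<and> u < x + r \<longrightarrow> v - u \<le> e * (u - x)) \<and>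
        (v < x \<and> x - r < v \<longrightarrow> v - u \<le> e * (x - v))" if "e > 0" for x e
  proof -
    obtain r1 r2 where "r1 > 0" "r2 > 0"
      "\<And>u v. (u,v) \<in> P \<Longrightarrow> x < u \<Longrightarrow> u < x + r1 \<Longrightarrow> v - u \<le> e * (u - x)"
      "\<And>u v. (u,v) \<in> P \<Longrightarrow> v < x \<Longrightarrow> x - r2 < v \<Longrightarrow> v - u \<le> e * (x - v)"
      using assms(5,6)[OF \<open>e > 0\<close>] by meson
    then show ?thesis by (intro exI[of _ "min r1 r2"]) auto
  qed
  then show ?thesis unfolding fine_partition_def using assms(1-4) by blast
qed

lemma fine_partitionD:
  assumes "fine_partition S P"
  shows "\<And>u v. (u,v) \<in> P \<Longrightarrow> u < v" "\<And>u v. (u,v) \<in> P \<Longrightarrow> {u..v} \<subseteq> S"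
    "\<And>u v u' v'. (u,v) \<in> P \<Longrightarrow> (u',v') \<in> P \<Longrightarrow> (u,v) \<noteq> (u',v') \<Longrightarrow> v \<le> u' \<or> v' \<le> u"
    "countable (S - (\<Union>(u,v)\<in>P. {u<..<v}))"
  using assms unfolding fine_partition_def by blast+

lemma fine_partition_near:
  assumes "fine_partition S P" "e > 0"
  obtains r where "r > 0"
    "\<And>u v. (u,v) \<in> P \<Longrightarrow> x < u \<Longrightarrow> u < x + r \<Longrightarrow> v - u \<le> e * (u - x)"
    "\<And>u v. (u,v) \<in> P \<Longrightarrow> v < x \<Longrightarrow> x - r < v \<Longrightarrow> v - u \<le> e * (x - v)"
proof -
  obtain r where "r > 0" "\<forall>(u,v)\<in>P. (x < u \<and> u < x + r \<longrightarrow> v - u \<le> e * (u - x)) \<and>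
        (v < x \<and> x - r < v \<longrightarrow> v - u \<le> e * (x - v))"
    using assms unfolding fine_partition_def by blast
  then show thesis by (intro that[of r]) auto
qed

lemma fine_partition_countable:
  assumes "fine_partition S P"
  shows "countable P"
proof -
  note D = fine_partitionD[OF assms]
  have "\<forall>J\<in>P. \<exists>q\<in>\<rat>. fst J < q \<and> q < snd J"
    using D(1) Rats_dense_in_real by fastforce
  then obtain q where q: "\<And>J. J \<in> P \<Longrightarrow> q J \<in> \<rat> \<and> fst J < q J \<and> q J < snd J" by metis
  have "inj_on q P"
  proof (rule inj_onI, rule ccontr)
    fix J K assume JK: "J \<in> P" "K \<in> P" "q J = q K" "J \<noteq> K"
    then have "snd J \<le> fst K \<or> snd K \<le> fst J" using D(3)[of "fst J" "snd J" "fst K" "snd K"] by simp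
    then show False using q[OF JK(1)] q[OF JK(2)] JK(3) by linarith
  qed
  moreover have "countable (q ` P)" using q countable_rat by (metis countable_subset image_subsetI)
  ultimately show ?thesis by (rule countable_image_inj_on[rotated])
qed

text \<open>Near any point no endpoint other than the point itself occurs, so the smallness clauses
  become vacuous for small radii.\<close>

lemma fine_partition_finite:
  assumes "finite P" "\<And>u v. (u,v) \<in> P \<Longrightarrow> u < v" "\<And>u v. (u,v) \<in> P \<Longrightarrow> {u..v} \<subseteq> S"
    and "\<And>u v u' v'. (u,v) \<in> P \<Longrightarrow> (u',v') \<in> P \<Longrightarrow> (u,v) \<noteq> (u',v') \<Longrightarrow> v \<le> u' \<or> v' \<le> u"
    and "S \<subseteq> (\<Union>(u,v)\<in>P. {u..v})"
  shows "fine_partition S P"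
proof (rule fine_partitionI)
  have "S - (\<Union>(u,v)\<in>P. {u<..<v}) \<subseteq> fst ` P \<union> snd ` P" using assms(5) by force
  then show "countable (S - (\<Union>(u,v)\<in>P. {u<..<v}))"
    by (rule countable_subset) (use assms(1) in \<open>simp add: countable_finite\<close>)
  fix x e :: real assume "e > 0"
  obtain d1 where d1: "d1 > 0" "\<forall>u\<in>fst ` P. u \<noteq> x \<longrightarrow> d1 \<le> dist x u"
    using finite_set_avoid[of "fst ` P" x] assms(1) by auto
  obtain d2 where d2: "d2 > 0" "\<forall>u\<in>snd ` P. u \<noteq> x \<longrightarrow> d2 \<le> dist x u"
    using finite_set_avoid[of "snd ` P" x] assms(1) by auto
  show "\<exists>r>0. \<forall>u v. (u,v) \<in> P \<longrightarrow> x < u \<longrightarrow> u < x + r \<longrightarrow> v - u \<le> e * (u - x)"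
    using d1 by (intro exI[of _ d1]) (force simp: dist_real_def)
  show "\<exists>r>0. \<forall>u v. (u,v) \<in> P \<longrightarrow> v < x \<longrightarrow> x - r < v \<longrightarrow> v - u \<le> e * (x - v)"
    using d2 by (intro exI[of _ d2]) (force simp: dist_real_def)
qed (use assms in auto)

text \<open>On a given side of x, a nearby small piece lies either in the coarse piece that extends
  from x to that side, where the fineness of its own partition applies, or in a coarse piece lying
  wholly on that side, whose length already is small compared with a distance that is no
  larger.\<close>

lemma fine_partition_refine:
  assumes P: "fine_partition S P"
    and Q: "\<And>u v. (u,v) \<in> P \<Longrightarrow> fine_partition {u..v} (Q (u,v))"
  shows "fine_partition S (\<Union>J\<in>P. Q J)"
proof (rule fine_partitionI)
  note PD = fine_partitionD[OF P] and QD = fine_partitionD[OF Q]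
  have sub: "u \<le> u' \<and> u' < v' \<and> v' \<le> v" if "(u,v) \<in> P" "(u',v') \<in> Q (u,v)" for u v u' v'
    using QD(1,2)[OF that] by auto
  fix u v assume uv: "(u,v) \<in> (\<Union>J\<in>P. Q J)"
  then obtain a b where ab: "(a,b) \<in> P" "(u,v) \<in> Q (a,b)" by auto
  show "u < v" "{u..v} \<subseteq> S" using sub[OF ab] PD(2)[OF ab(1)] by auto
  fix u' v' assume uv': "(u',v') \<in> (\<Union>J\<in>P. Q J)" "(u,v) \<noteq> (u',v')"
  then obtain a' b' where ab': "(a',b') \<in> P" "(u',v') \<in> Q (a',b')" by auto
  show "v \<le> u' \<or> v' \<le> u"
  proof (cases "(a,b) = (a',b')")
    case True
    then show ?thesis using QD(3)[OF ab(1) ab(2)] ab' uv' by auto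
  next
    case False
    then show ?thesis using PD(3)[OF ab(1) ab'(1)] sub[OF ab] sub[OF ab'] by linarith
  qed
next
  note PD = fine_partitionD[OF P] and QD = fine_partitionD[OF Q]
  have sub: "u \<le> u' \<and> u' < v' \<and> v' \<le> v" if "(u,v) \<in> P" "(u',v') \<in> Q (u,v)" for u v u' v'
    using QD(1,2)[OF that] by auto
  note cP = fine_partition_countable[OF P]
  have c1: "S - (\<Union>(u,v)\<in>(\<Union>J\<in>P. Q J). {u<..<v}) \<subseteq>
     (S - (\<Union>(u,v)\<in>P. {u<..<v})) \<union> (\<Union>J\<in>P. {fst J..snd J} - (\<Union>(u,v)\<in>Q J. {u<..<v}))"
    by force
  have c2: "countable (\<Union>J\<in>P. {fst J..snd J} - (\<Union>(u,v)\<in>Q J. {u<..<v}))"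
    using cP QD(4) by (intro countable_UN) auto
  show "countable (S - (\<Union>(u,v)\<in>(\<Union>J\<in>P. Q J). {u<..<v}))"
    by (rule countable_subset[OF c1 countable_Un[OF PD(4) c2]])
  fix x e :: real assume "e > 0"
  obtain r where r: "r > 0"
    "\<And>u v. (u,v) \<in> P \<Longrightarrow> x < u \<Longrightarrow> u < x + r \<Longrightarrow> v - u \<le> e * (u - x)"
    "\<And>u v. (u,v) \<in> P \<Longrightarrow> v < x \<Longrightarrow> x - r < v \<Longrightarrow> v - u \<le> e * (x - v)"
    using fine_partition_near[OF P \<open>e > 0\<close>, of x] by blast
  show "\<exists>r>0. \<forall>u v. (u,v) \<in> (\<Union>J\<in>P. Q J) \<longrightarrow> x < u \<longrightarrow> u < x + r \<longrightarrow> v - u \<le> e * (u - x)"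
  proof -
    \<comment> \<open>The half-open condition is met by at most one coarse piece, so a single radius
      serves.\<close>
    obtain r' where r': "r' > 0" "\<And>a b u v. (a,b) \<in> P \<Longrightarrow> a \<le> x \<Longrightarrow> x < b \<Longrightarrow> (u,v) \<in> Q (a,b) \<Longrightarrow> x < u \<Longrightarrow> u < x + r' \<Longrightarrow> v - u \<le> e * (u - x)"
    proof (cases "\<exists>a b. (a,b) \<in> P \<and> a \<le> x \<and> x < b")
      case True
      then obtain a b where ab: "(a,b) \<in> P" "a \<le> x" "x < b" by blast
      obtain r' where "r' > 0" "\<And>u v. (u,v) \<in> Q (a,b) \<Longrightarrow> x < u \<Longrightarrow> u < x + r' \<Longrightarrow> v - u \<le> e * (u - x)"
        using fine_partition_near[OF Q[OF ab(1)] \<open>e > 0\<close>, of x] by metis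
      moreover have "(a',b') = (a,b)" if "(a',b') \<in> P" "a' \<le> x" "x < b'" for a' b'
        using PD(3)[OF ab(1) that(1)] ab that by force
      ultimately show thesis using that[of r'] by (metis prod.inject)
    next
      case False
      then show thesis by (intro that[of 1]) auto
    qed
    have "v - u \<le> e * (u - x)" if uv: "(a,b) \<in> P" "(u,v) \<in> Q (a,b)" "x < u" "u < x + min r r'" for a b u v
    proof (cases "a \<le> x")
      case True
      then show ?thesis using r'(2)[OF uv(1) True _ uv(2)] sub[OF uv(1,2)] uv by auto
    next
      case False
      then have "b - a \<le> e * (a - x)" using r(2)[OF uv(1)] sub[OF uv(1,2)] uv by auto
      moreover have "e * (a - x) \<le> e * (u - x)" using sub[OF uv(1,2)] \<open>e > 0\<close> by simp
      ultimately show ?thesis using sub[OF uv(1,2)] by linarith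
    qed
    then show ?thesis using r(1) r'(1) by (intro exI[of _ "min r r'"]) (auto simp del: min_less_iff_conj)
  qed
  show "\<exists>r>0. \<forall>u v. (u,v) \<in> (\<Union>J\<in>P. Q J) \<longrightarrow> v < x \<longrightarrow> x - r < v \<longrightarrow> v - u \<le> e * (x - v)"
  proof -
    obtain r' where r': "r' > 0" "\<And>a b u v. (a,b) \<in> P \<Longrightarrow> a < x \<Longrightarrow> x \<le> b \<Longrightarrow> (u,v) \<in> Q (a,b) \<Longrightarrow> v < x \<Longrightarrow> x - r' < v \<Longrightarrow> v - u \<le> e * (x - v)"
    proof (cases "\<exists>a b. (a,b) \<in> P \<and> a < x \<and> x \<le> b")
      case True
      then obtain a b where ab: "(a,b) \<in> P" "a < x" "x \<le> b" by blast
      obtain r' where "r' > 0" "\<And>u v. (u,v) \<in> Q (a,b) \<Longrightarrow> v < x \<Longrightarrow> x - r' < v \<Longrightarrow> v - u \<le> e * (x - v)"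
        using fine_partition_near[OF Q[OF ab(1)] \<open>e > 0\<close>, of x] by metis
      moreover have "(a',b') = (a,b)" if "(a',b') \<in> P" "a' < x" "x \<le> b'" for a' b'
        using PD(3)[OF ab(1) that(1)] ab that by force
      ultimately show thesis using that[of r'] by (metis prod.inject)
    next
      case False
      then show thesis by (intro that[of 1]) auto
    qed
    have "v - u \<le> e * (x - v)" if uv: "(a,b) \<in> P" "(u,v) \<in> Q (a,b)" "v < x" "x - min r r' < v" for a b u v
    proof (cases "x \<le> b")
      case True
      then show ?thesis using r'(2)[OF uv(1) _ True uv(2)] sub[OF uv(1,2)] uv by auto
    next
      case False
      then have "b - a \<le> e * (x - b)" using r(3)[OF uv(1)] sub[OF uv(1,2)] uv by auto
      moreover have "e * (x - b) \<le> e * (x - v)" using sub[OF uv(1,2)] \<open>e > 0\<close> by simp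
      ultimately show ?thesis using sub[OF uv(1,2)] by linarith
    qed
    then show ?thesis using r(1) r'(1) by (intro exI[of _ "min r r'"]) auto
  qed
qed

section \<open>Stages and chains\<close>

definition cover :: "(real \<times> real) set \<Rightarrow> real set" where
  "cover A = (\<Union>(u,v)\<in>A. {u..v})"

text \<open>
  \<open>A\<close> are the active pieces, on which \<open>f\<close> has slope \<open>c\<close> or \<open>-c\<close>, and \<open>B\<close> the inactive ones, on which
  \<open>f\<close> is constant. The fifth clause makes \<open>cover A\<close> open; it also forbids an endpoint of an active
  piece from being an accumulation point of pieces, where the derivative of a refinement of \<open>f\<close> could not
  be controlled.
\<close>

definition stage ::
  "real set \<Rightarrow> real set \<Rightarrow> real \<Rightarrow> real \<Rightarrow> real \<Rightarrow> (real \<Rightarrow> real) \<Rightarrow> (real \<times> real) set \<Rightarrow> (real \<times> real) set \<Rightarrow> bool"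
  where "stage S E c \<delta> \<eta> f A B \<longleftrightarrow>
    fine_partition S (A \<union> B) \<and>
    (\<forall>x\<in>S. \<forall>y\<in>S. \<bar>f x - f y\<bar> \<le> c * \<bar>x - y\<bar>) \<and>
    (\<forall>(u,v)\<in>B. \<forall>y\<in>{u..v}. f y = f u) \<and>
    (\<forall>(u,v)\<in>A. \<bar>f v - f u\<bar> = c * (v - u) \<and> measure lebesgue ({u..v} - E) \<le> \<delta> * (v - u) \<and> v - u \<le> \<eta>) \<and>
    (\<forall>x\<in>cover A. \<exists>r>0. \<forall>y. \<bar>y - x\<bar> < r \<longrightarrow> (\<exists>(u,v)\<in>A. x \<in> {u..v} \<and> y \<in> {u..v})) \<and>
    (\<forall>x\<in>S - cover A. \<forall>e>0. \<exists>r>0. \<forall>y\<in>S. \<bar>y - x\<bar> < r \<longrightarrow> \<bar>f y - f x\<bar> \<le> e * \<bar>y - x\<bar>) \<and>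
    (\<forall>x\<in>S - cover A. \<forall>(u,v)\<in>A. (x < u \<longrightarrow> v - u \<le> \<eta> * (u - x)) \<and> (v < x \<longrightarrow> v - u \<le> \<eta> * (x - v)))"

text \<open>In the application \<open>\<phi> t\<close> is the measure of the part of
  \<open>{a..a+t}\<close> outside E, for a density point a, and \<open>d i\<close> is the distance
  from a to successive tile endpoints. A gap must be long enough to make \<open>\<phi> (d i)\<close>
  a small fraction of it, yet of order o(\<open>d i\<close>); as \<open>\<phi> t\<close> is o(t),
  both are possible. The factor 2 in \<open>2 * \<eta>\<close> arises because gaps are compared with
  their nearer end, which is at least half as far away as the other.\<close>

lemma shrinking_sequence:
  fixes \<phi> :: "real \<Rightarrow> real"
  assumes D: "D > 0" and \<epsilon>: "\<epsilon> > 0" and \<eta>: "0 < \<eta>" "\<eta> \<le> 1/2"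
    and \<phi>: "\<And>t. 0 < t \<Longrightarrow> t \<le> D \<Longrightarrow> \<phi> t \<le> \<epsilon> * \<eta> * t"
    and \<phi>0: "\<And>e. e > 0 \<Longrightarrow> \<exists>r>0. \<forall>t. 0 < t \<and> t \<le> r \<longrightarrow> \<phi> t \<le> e * t"
  obtains d :: "nat \<Rightarrow> real" where "d 0 = D" "\<And>i. 0 < d i" "\<And>i. d (Suc i) < d i"
    "\<And>i. \<phi> (d i) \<le> \<epsilon> * (d i - d (Suc i))" "\<And>i. d i - d (Suc i) \<le> 2 * \<eta> * d (Suc i)" "d \<longlonglongrightarrow> 0"
    "\<And>e. e > 0 \<Longrightarrow> \<exists>r>0. \<forall>i. d (Suc i) < r \<longrightarrow> d i - d (Suc i) \<le> e * d (Suc i)"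
proof -
  \<comment> \<open>The first term makes the gap from \<open>t\<close> to \<open>t - \<tau> t * t\<close> long enough to be almost filled; the
    second keeps \<open>\<tau>\<close> away from 0, which forces the sequence to reach 0.\<close>
  define \<tau> where "\<tau> t = max (\<phi> t / (\<epsilon> * t)) (min \<eta> t)" for t
  have \<tau>: "min \<eta> t \<le> \<tau> t" "0 < \<tau> t" "\<tau> t \<le> \<eta>" "\<phi> t \<le> \<epsilon> * (\<tau> t * t)" if t: "0 < t" "t \<le> D" for t
  proof -
    show "min \<eta> t \<le> \<tau> t" by (simp add: \<tau>_def)
    then show "0 < \<tau> t" using t \<eta> by linarith
    have "\<phi> t / (\<epsilon> * t) \<le> \<eta>" using \<phi>[OF t] t \<epsilon> by (simp add: field_simps)
    then show "\<tau> t \<le> \<eta>" by (simp add: \<tau>_def)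
    have "\<phi> t / (\<epsilon> * t) \<le> \<tau> t" by (simp add: \<tau>_def)
    then show "\<phi> t \<le> \<epsilon> * (\<tau> t * t)" using t \<epsilon> by (simp add: field_simps)
  qed
  define d where "d = rec_nat D (\<lambda>_ x. x - \<tau> x * x)"
  have d0: "d 0 = D" and dS: "d (Suc i) = d i - \<tau> (d i) * d i" for i by (auto simp: d_def)
  have dp: "0 < d i \<and> d i \<le> D" for i
  proof (induction i)
    case (Suc i)
    have "\<tau> (d i) * d i \<le> 1/2 * d i" "0 < \<tau> (d i) * d i"
      using \<tau>[of "d i"] \<eta> Suc by (auto intro: mult_right_mono)
    then show ?case using Suc dS[of i] by linarith
  qed (use D d0 in auto)
  have dp1: "0 < d i" and dp2: "d i \<le> D" for i using dp by auto
  note \<tau>d = \<tau>[OF dp1 dp2]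
  have lt: "d (Suc i) < d i" for i using \<tau>d(2)[of i] dp1[of i] by (simp add: dS)
  have half: "d i \<le> 2 * d (Suc i)" for i
    using mult_right_mono[of "\<tau> (d i)" "1/2" "d i"] \<tau>d(3)[of i] dp1[of i] \<eta> by (simp add: dS)
  have "decseq d" using lt by (simp add: decseq_Suc_iff less_imp_le)
  then obtain L where L: "d \<longlonglongrightarrow> L" "\<And>i. L \<le> d i"
    using decseq_convergent[of d 0] dp1 less_imp_le by metis
  have "L = 0"
  proof (rule ccontr)
    assume "L \<noteq> 0"
    moreover have "0 \<le> L" using L(1) dp1 by (meson LIMSEQ_le_const less_imp_le)
    ultimately have "L > 0" by simp
    define m where "m = min \<eta> L * L"
    have "m > 0" using \<open>L > 0\<close> \<eta> by (simp add: m_def)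
    have "m \<le> d i - d (Suc i)" for i
    proof -
      have "min \<eta> L \<le> \<tau> (d i)" using \<tau>d(1)[of i] L(2)[of i] by linarith
      then have "min \<eta> L * L \<le> \<tau> (d i) * d i" using L(2)[of i] \<open>L > 0\<close> \<eta> \<tau>d(2)[of i] by (intro mult_mono) auto
      then show ?thesis by (simp add: m_def dS)
    qed
    moreover have "(\<lambda>i. d i - d (Suc i)) \<longlonglongrightarrow> L - L" using L(1) LIMSEQ_Suc by (intro tendsto_diff) auto
    ultimately have "m \<le> L - L" by (meson LIMSEQ_le_const)
    then show False using \<open>m > 0\<close> by simp
  qed
  show thesis
  proof (rule that[of d, OF d0 dp1 lt])
    show "\<phi> (d i) \<le> \<epsilon> * (d i - d (Suc i))" for i using \<tau>d(4)[of i] by (simp add: dS)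
    show "d i - d (Suc i) \<le> 2 * \<eta> * d (Suc i)" for i
    proof -
      have "\<tau> (d i) * d i \<le> \<eta> * (2 * d (Suc i))"
        using \<tau>d(2,3)[of i] half[of i] dp1[of i] \<eta> by (intro mult_mono) auto
      moreover have "d i - d (Suc i) = \<tau> (d i) * d i" by (simp add: dS)
      ultimately show ?thesis by (simp add: mult.assoc mult.left_commute)
    qed
    show "d \<longlonglongrightarrow> 0" using L \<open>L = 0\<close> by simp
    fix e :: real assume e: "e > 0"
    obtain r where r: "r > 0" "\<And>t. 0 < t \<Longrightarrow> t \<le> r \<Longrightarrow> \<phi> t \<le> \<epsilon> * e / 2 * t"
      using \<phi>0[of "\<epsilon> * e / 2"] e \<epsilon> by auto
    \<comment> \<open>The outer halving turns a bound on \<open>d (Suc i)\<close> into one on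
      \<open>d i\<close>; the inner \<open>e / 2\<close> makes up for the same factor when
      \<open>\<tau> (d i) * d i\<close> is compared with \<open>d (Suc i)\<close>.\<close>
    have "d i - d (Suc i) \<le> e * d (Suc i)" if "d (Suc i) < min r (e/2) / 2" for i
    proof -
      have t: "d i \<le> min r (e/2)" using half[of i] that by linarith
      have "\<phi> (d i) \<le> \<epsilon> * e / 2 * d i" using r(2)[OF dp1] t by simp
      then have "\<phi> (d i) / (\<epsilon> * d i) \<le> e / 2" using dp1[of i] \<epsilon> by (simp add: field_simps)
      moreover have "min \<eta> (d i) \<le> e / 2" using t by linarith
      ultimately have "\<tau> (d i) \<le> e / 2" by (simp add: \<tau>_def)
      then have "\<tau> (d i) * d i \<le> e / 2 * (2 * d (Suc i))"
        using half[of i] dp1[of i] e by (intro mult_mono) auto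
      moreover have "d i - d (Suc i) = \<tau> (d i) * d i" by (simp add: dS)
      ultimately show ?thesis by simp
    qed
    then show "\<exists>r>0. \<forall>i. d (Suc i) < r \<longrightarrow> d i - d (Suc i) \<le> e * d (Suc i)"
      using r(1) e by (intro exI[of _ "min r (e/2) / 2"]) auto
  qed
qed

section \<open>Two-sided sequences of tile endpoints in an open interval\<close>

lemma int_seq_mono:
  fixes X :: "int \<Rightarrow> real"
  assumes "\<And>n. X n < X (n + 1)" "j \<le> k"
  shows "X j \<le> X k"
proof -
  have "X j \<le> X (j + int n)" for n
  proof (induction n)
    case (Suc n)
    then show ?case using assms(1)[of "j + int n"] by (simp add: algebra_simps)
  qed simp
  from this[of "nat (k - j)"] show ?thesis using assms(2) by simp
qed

lemma int_seq_locate: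
  fixes X :: "int \<Rightarrow> real"
  assumes X: "\<And>n. X n < X (n + 1)" and "X j \<le> y" "y < X k"
  obtains n where "X n \<le> y" "y < X (n + 1)"
proof -
  define F where "F = {n\<in>{j..k}. X n \<le> y}"
  have "j \<le> k" using int_seq_mono[of X k j, OF X] assms by (cases "j \<le> k") auto
  have "finite F" unfolding F_def by (rule finite_subset[of _ "{j..k}"]) auto
  have "j \<in> F" using assms(2) \<open>j \<le> k\<close> by (simp add: F_def)
  define n where "n = Max F"
  have n: "n \<in> F" using \<open>finite F\<close> \<open>j \<in> F\<close> by (auto simp: n_def intro: Max_in)
  have "n \<noteq> k" using n assms by (auto simp: F_def)
  then have "n + 1 \<in> {j..k}" using n by (auto simp: F_def)
  moreover have "n + 1 \<notin> F" using Max_ge[OF \<open>finite F\<close>, of "n+1"] by (auto simp: n_def)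
  ultimately show thesis using n by (intro that[of n]) (auto simp: F_def)
qed

text \<open>The index set is the integers because the points accumulate at both a and b. The bounds
  with \<eta> hold throughout and feed the error estimates between stages; those with arbitrary e
  hold only near the ends and yield derivative 0 there.\<close>

definition chain :: "real \<Rightarrow> real \<Rightarrow> real set \<Rightarrow> real \<Rightarrow> real \<Rightarrow> (int \<Rightarrow> real) \<Rightarrow> bool" where
  "chain a b E \<delta> \<eta> X \<longleftrightarrow>
     (\<forall>n. X n < X (n + 1)) \<and> (\<forall>n. a < X n \<and> X n < b) \<and>
     (\<forall>n. measure lebesgue ({X n..X (n+1)} - E) \<le> \<delta> * (X (n+1) - X n)) \<and>
     (\<forall>n. X (n+1) - X n \<le> \<eta> * (X n - a) \<and> X (n+1) - X n \<le> \<eta> * (b - X (n+1))) \<and>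
     (\<forall>e>0. \<exists>r>0. \<forall>n. X n < a + r \<longrightarrow> X (n+1) - X n \<le> e * (X n - a)) \<and>
     (\<forall>e>0. \<exists>r>0. \<forall>n. b - r < X (n+1) \<longrightarrow> X (n+1) - X n \<le> e * (b - X (n+1))) \<and>
     (\<forall>y. a < y \<and> y < b \<longrightarrow> (\<exists>n. X n \<le> y \<and> y < X (n+1)))"

lemma chainD:
  assumes "chain a b E \<delta> \<eta> X"
  shows "X n < X (n + 1)" "a < X n" "X n < b"
    "measure lebesgue ({X n..X (n+1)} - E) \<le> \<delta> * (X (n+1) - X n)"
    "X (n+1) - X n \<le> \<eta> * (X n - a)" "X (n+1) - X n \<le> \<eta> * (b - X (n+1))"
    "e > 0 \<Longrightarrow> \<exists>r>0. \<forall>n. X n < a + r \<longrightarrow> X (n+1) - X n \<le> e * (X n - a)"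
    "e > 0 \<Longrightarrow> \<exists>r>0. \<forall>n. b - r < X (n+1) \<longrightarrow> X (n+1) - X n \<le> e * (b - X (n+1))"
    "a < y \<Longrightarrow> y < b \<Longrightarrow> \<exists>n. X n \<le> y \<and> y < X (n+1)"
  using assms unfolding chain_def by blast+

text \<open>Two shrinking sequences, one of distances to a and one of distances to b, start at the
  midpoint. The defect of a tile is bounded by that of the whole interval from its far end to the
  endpoint approached.\<close>

lemma chain_exists:
  fixes E :: "real set"
  assumes E: "E \<in> sets lebesgue" and ab: "a < b" and \<delta>: "\<delta> > 0" and \<eta>: "0 < \<eta>" "\<eta> \<le> 1"
    and a: "\<And>t. 0 < t \<Longrightarrow> t \<le> b - a \<Longrightarrow> measure lebesgue ({a..a+t} - E) \<le> \<delta> * \<eta> / 2 * t"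
    and b: "\<And>t. 0 < t \<Longrightarrow> t \<le> b - a \<Longrightarrow> measure lebesgue ({b-t..b} - E) \<le> \<delta> * \<eta> / 2 * t"
    and a0: "\<And>e. e > 0 \<Longrightarrow> \<exists>r>0. \<forall>t. 0 < t \<and> t \<le> r \<longrightarrow> measure lebesgue ({a..a+t} - E) \<le> e * t"
    and b0: "\<And>e. e > 0 \<Longrightarrow> \<exists>r>0. \<forall>t. 0 < t \<and> t \<le> r \<longrightarrow> measure lebesgue ({b-t..b} - E) \<le> e * t"
  obtains X where "chain a b E \<delta> \<eta> X"
proof -
  define D where "D = (b - a) / 2"
  have D: "D > 0" "D \<le> b - a" using ab by (auto simp: D_def)
  have lm: "{u..v} - E \<in> lmeasurable" for u v using E by (simp add: fmeasurable_Diff)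
  \<comment> \<open>Half of \<eta>, because \<open>shrinking_sequence\<close> returns gaps bounded
    with twice its parameter.\<close>
  have h: "0 < \<eta>/2" "\<eta>/2 \<le> 1/2" using \<eta> by auto
  have ca: "measure lebesgue ({a..a+t} - E) \<le> \<delta> * (\<eta>/2) * t"
    and cb: "measure lebesgue ({b-t..b} - E) \<le> \<delta> * (\<eta>/2) * t" if "0 < t" "t \<le> D" for t
    using a[of t] b[of t] that D(2) by auto
  obtain p where p: "p 0 = D" "\<And>i. 0 < p i" "\<And>i. p (Suc i) < p i"
    "\<And>i. measure lebesgue ({a..a+p i} - E) \<le> \<delta> * (p i - p (Suc i))"
    "\<And>i. p i - p (Suc i) \<le> 2 * (\<eta>/2) * p (Suc i)" "p \<longlonglongrightarrow> 0"
    "\<And>e. e > 0 \<Longrightarrow> \<exists>r>0. \<forall>i. p (Suc i) < r \<longrightarrow> p i - p (Suc i) \<le> e * p (Suc i)"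
    using shrinking_sequence[OF D(1) \<delta> h ca a0] by blast
  obtain q where q: "q 0 = D" "\<And>i. 0 < q i" "\<And>i. q (Suc i) < q i"
    "\<And>i. measure lebesgue ({b-q i..b} - E) \<le> \<delta> * (q i - q (Suc i))"
    "\<And>i. q i - q (Suc i) \<le> 2 * (\<eta>/2) * q (Suc i)" "q \<longlonglongrightarrow> 0"
    "\<And>e. e > 0 \<Longrightarrow> \<exists>r>0. \<forall>i. q (Suc i) < r \<longrightarrow> q i - q (Suc i) \<le> e * q (Suc i)"
    using shrinking_sequence[OF D(1) \<delta> h cb b0] by blast
  have pD: "p i \<le> D" for i using lift_Suc_antimono_le[of p 0 i] p(1,3) by (simp add: less_imp_le)
  have qD: "q i \<le> D" for i using lift_Suc_antimono_le[of q 0 i] q(1,3) by (simp add: less_imp_le)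
  \<comment> \<open>Both distances start at D, so the two branches agree at index 0, the
    midpoint.\<close>
  define X where "X n = (if n \<ge> 0 then b - q (nat n) else a + p (nat (- n)))" for n :: int
  have Xp: "X (int i) = b - q i" for i by (simp add: X_def)
  have Xn: "X (- int i) = a + p i" for i
  proof (cases i)
    case 0
    then show ?thesis using p(1) q(1) by (simp add: X_def D_def field_simps)
  next
    case (Suc j)
    then show ?thesis by (simp add: X_def nat_add_distrib)
  qed
  have cases: "(\<exists>i. X n = b - q i \<and> X (n+1) = b - q (Suc i)) \<or> (\<exists>i. X n = a + p (Suc i) \<and> X (n+1) = a + p i)" for n
  proof (cases "n \<ge> 0")
    case True
    then show ?thesis using Xp[of "nat n"] Xp[of "Suc (nat n)"] by (intro disjI1 exI[of _ "nat n"]) (simp add: algebra_simps)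
  next
    case False
    define i where "i = nat (- n - 1)"
    have i: "n = - int (Suc i)" using False by (simp add: i_def)
    then show ?thesis using Xn[of "Suc i"] Xn[of i] by (intro disjI2 exI[of _ i]) simp
  qed
  have X1: "X n < X (n+1)" for n using cases[of n] p(3) q(3) by fastforce
  have X2: "a < X n" "X n < b" for n
  proof -
    have D2: "2 * D = b - a" by (simp add: D_def)
    show "a < X n" "X n < b"
      using cases[of n] p(2) q(2) pD qD D2 D(1) by (smt (verit))+
  qed
  have X3: "measure lebesgue ({X n..X (n+1)} - E) \<le> \<delta> * (X (n+1) - X n)" for n
    using cases[of n]
  proof (elim disjE exE conjE)
    fix i assume i: "X n = b - q i" "X (n+1) = b - q (Suc i)"
    have "measure lebesgue ({X n..X (n+1)} - E) \<le> measure lebesgue ({b-q i..b} - E)"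
      using q(2)[of "Suc i"] lm by (intro measure_mono_fmeasurable) (auto simp: i fmeasurableD)
    then show ?thesis using q(4)[of i] by (simp add: i)
  next
    fix i assume i: "X n = a + p (Suc i)" "X (n+1) = a + p i"
    have "measure lebesgue ({X n..X (n+1)} - E) \<le> measure lebesgue ({a..a+p i} - E)"
      using p(2)[of "Suc i"] lm by (intro measure_mono_fmeasurable) (auto simp: i fmeasurableD)
    then show ?thesis using p(4)[of i] by (simp add: i)
  qed
  have X4: "X (n+1) - X n \<le> \<eta> * (X n - a) \<and> X (n+1) - X n \<le> \<eta> * (b - X (n+1))" for n
    using cases[of n]
  proof (elim disjE exE conjE)
    fix i assume i: "X n = b - q i" "X (n+1) = b - q (Suc i)"
    have "q i - q (Suc i) \<le> \<eta> * q (Suc i)" using q(5)[of i] by simp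
    \<comment> \<open>The opposite endpoint is at least D away, hence no closer than the one
      approached.\<close>
    moreover have "\<eta> * q (Suc i) \<le> \<eta> * (b - q i - a)"
      using qD[of i] qD[of "Suc i"] \<eta> by (intro mult_left_mono) (auto simp: D_def field_simps)
    ultimately show ?thesis by (simp add: i)
  next
    fix i assume i: "X n = a + p (Suc i)" "X (n+1) = a + p i"
    have "p i - p (Suc i) \<le> \<eta> * p (Suc i)" using p(5)[of i] by simp
    moreover have "\<eta> * p (Suc i) \<le> \<eta> * (b - (a + p i))"
      using pD[of i] pD[of "Suc i"] \<eta> by (intro mult_left_mono) (auto simp: D_def field_simps)
    ultimately show ?thesis by (simp add: i)
  qed
  have X5: "\<exists>r>0. \<forall>n. X n < a + r \<longrightarrow> X (n+1) - X n \<le> e * (X n - a)" if e: "e > 0" for e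
  proof -
    obtain r where r: "r > 0" "\<And>i. p (Suc i) < r \<Longrightarrow> p i - p (Suc i) \<le> e * p (Suc i)" using p(7)[OF e] by blast
    have "X (n+1) - X n \<le> e * (X n - a)" if n: "X n < a + min r D" for n
      using cases[of n]
    proof (elim disjE exE conjE)
      fix i assume i: "X n = b - q i"
      have "2 * D = b - a" "min r D \<le> D" by (simp add: D_def, simp)
      then have False using n qD[of i] unfolding i by linarith
      then show ?thesis ..
    next
      fix i assume i: "X n = a + p (Suc i)" "X (n+1) = a + p i"
      then show ?thesis using r(2)[of i] n by simp
    qed
    then show ?thesis using r(1) D by (intro exI[of _ "min r D"]) auto
  qed
  have X6: "\<exists>r>0. \<forall>n. b - r < X (n+1) \<longrightarrow> X (n+1) - X n \<le> e * (b - X (n+1))" if e: "e > 0" for e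
  proof -
    obtain r where r: "r > 0" "\<And>i. q (Suc i) < r \<Longrightarrow> q i - q (Suc i) \<le> e * q (Suc i)" using q(7)[OF e] by blast
    have "X (n+1) - X n \<le> e * (b - X (n+1))" if n: "b - min r D < X (n+1)" for n
      using cases[of n]
    proof (elim disjE exE conjE)
      fix i assume i: "X (n+1) = a + p i"
      have "2 * D = b - a" "min r D \<le> D" by (simp add: D_def, simp)
      then have False using n pD[of i] unfolding i by linarith
      then show ?thesis ..
    next
      fix i assume i: "X n = b - q i" "X (n+1) = b - q (Suc i)"
      then show ?thesis using r(2)[of i] n by simp
    qed
    then show ?thesis using r(1) D by (intro exI[of _ "min r D"]) auto
  qed
  have X7: "\<exists>n. X n \<le> y \<and> y < X (n+1)" if y: "a < y" "y < b" for y
  proof -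
    have "\<forall>\<^sub>F i in sequentially. p i < y - a" "\<forall>\<^sub>F i in sequentially. q i < b - y"
      using p(6) q(6) y by (auto intro: order_tendstoD)
    then obtain i j where "p i < y - a" "q j < b - y" by (metis eventually_sequentially order_refl)
    then have "X (- int i) \<le> y" "y < X (int j)" by (auto simp: Xp Xn)
    then show ?thesis using int_seq_locate[of X, OF X1] by metis
  qed
  show thesis by (rule that[of X]) (unfold chain_def, use X1 X2 X3 X4 X5 X6 X7 in blast)
qed

text \<open>The infimum of cones is the largest c-Lipschitz extension. The third conclusion
  expresses this maximality: a value below all cones is below g. Between consecutive points of N the
  largest extension is a tent of slopes c and -c, which is why it is preferred to other
  extensions.\<close>

lemma mcshane_extension:
  fixes h :: "real \<Rightarrow> real"
  assumes N: "N \<noteq> {}" and h: "\<And>x y. x \<in> N \<Longrightarrow> y \<in> N \<Longrightarrow> \<bar>h x - h y\<bar> \<le> c * \<bar>x - y\<bar>" and c: "c \<ge> 0"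
  obtains g where "\<And>x y. \<bar>g x - g y\<bar> \<le> c * \<bar>x - y\<bar>" "\<And>x. x \<in> N \<Longrightarrow> g x = h x"
    "\<And>y l. (\<And>z. z \<in> N \<Longrightarrow> l \<le> h z + c * \<bar>y - z\<bar>) \<Longrightarrow> l \<le> g y"
proof -
  define g where "g y = (INF z\<in>N. h z + c * \<bar>y - z\<bar>)" for y
  obtain z0 where z0: "z0 \<in> N" using N by blast
  have lb: "h z0 - c * \<bar>y - z0\<bar> \<le> h z + c * \<bar>y - z\<bar>" if "z \<in> N" for y z
  proof -
    have "c * \<bar>z0 - z\<bar> \<le> c * (\<bar>y - z0\<bar> + \<bar>y - z\<bar>)" using c by (intro mult_left_mono) auto
    then show ?thesis using h[OF z0 that] by (simp add: algebra_simps abs_le_iff)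
  qed
  have bdd: "bdd_below ((\<lambda>z. h z + c * \<bar>y - z\<bar>) ` N)" for y
    using lb by (intro bdd_belowI2) auto
  have le: "g y \<le> h z + c * \<bar>y - z\<bar>" if "z \<in> N" for y z
    unfolding g_def by (rule cINF_lower[OF bdd that])
  have ge: "l \<le> g y" if "\<And>z. z \<in> N \<Longrightarrow> l \<le> h z + c * \<bar>y - z\<bar>" for l y
    unfolding g_def by (rule cINF_greatest[OF N]) (use that in auto)
  have lip: "g x - c * \<bar>x - y\<bar> \<le> g y" for x y
  proof (rule ge)
    fix z assume z: "z \<in> N"
    have "c * \<bar>x - z\<bar> \<le> c * (\<bar>x - y\<bar> + \<bar>y - z\<bar>)" using c by (intro mult_left_mono) auto
    then show "g x - c * \<bar>x - y\<bar> \<le> h z + c * \<bar>y - z\<bar>" using le[OF z, of x] by (simp add: algebra_simps)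
  qed
  show thesis
  proof (rule that[of g])
    show "\<bar>g x - g y\<bar> \<le> c * \<bar>x - y\<bar>" for x y
      using lip[of x y] lip[of y x] by (simp add: abs_le_iff abs_minus_commute)
    show "g x = h x" if "x \<in> N" for x
    proof (rule antisym)
      show "g x \<le> h x" using le[OF that, of x] by simp
      show "h x \<le> g x" using h[OF that] by (intro ge) (simp add: abs_le_iff algebra_simps)
    qed
  qed (use ge in blast)
qed

section \<open>From a chain to a stage with only active pieces\<close>

lemma chain_locate_left:
  assumes "chain a b E \<delta> \<eta> X" "a < y" "y < b"
  obtains n where "X n < y" "y \<le> X (n+1)"
proof -
  obtain n where n: "X n \<le> y" "y < X (n+1)" using chainD(9)[OF assms] by blast
  show thesis
  proof (cases "X n = y")
    case True
    then show thesis using that[of "n - 1"] chainD(1)[OF assms(1), of "n-1"] by simp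
  qed (use n that[of n] in auto)
qed

lemma chain_less:
  assumes "chain a b E \<delta> \<eta> X" "X n < X k"
  shows "n + 1 \<le> k"
  using int_seq_mono[of X k n, OF chainD(1)[OF assms(1)]] assms(2) by linarith

text \<open>Only the two points a and b of \<open>{a..b}\<close> are uncovered. The clauses of
  \<open>stage\<close> about uncovered points therefore reduce to the chain bounds at the ends and
  to the two flatness hypotheses on g.\<close>

lemma stage_chain:
  assumes X: "chain a b E \<delta> \<eta> X" and ab: "a < b" "b - a \<le> 1" and \<eta>: "0 < \<eta>"
    and lip: "\<And>x y. \<bar>g x - g y\<bar> \<le> c * \<bar>x - y\<bar>"
    and slope: "\<And>n. \<bar>g (X (n+1)) - g (X n)\<bar> = c * (X (n+1) - X n)"
    and a: "\<And>e. e > 0 \<Longrightarrow> \<exists>r>0. \<forall>y\<in>{a..b}. y < a + r \<longrightarrow> \<bar>g y - g a\<bar> \<le> e * (y - a)"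
    and b: "\<And>e. e > 0 \<Longrightarrow> \<exists>r>0. \<forall>y\<in>{a..b}. b - r < y \<longrightarrow> \<bar>g y - g b\<bar> \<le> e * (b - y)"
  defines "A \<equiv> range (\<lambda>n. (X n, X (n+1)))"
  shows "stage {a..b} E c \<delta> \<eta> g A {}" "cover A = {a<..<b}"
proof -
  note XD = chainD[OF X]
  have mem: "(u,v) \<in> A \<longleftrightarrow> (\<exists>n. u = X n \<and> v = X (n+1))" for u v by (auto simp: A_def)
  show cov: "cover A = {a<..<b}"
  proof
    show "cover A \<subseteq> {a<..<b}"
      using XD(2,3) unfolding cover_def A_def by (force intro: less_le_trans le_less_trans)
    show "{a<..<b} \<subseteq> cover A"
    proof
      fix y assume "y \<in> {a<..<b}"
      then obtain n where "X n \<le> y" "y < X (n+1)" using XD(9)[of y] by auto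
      then show "y \<in> cover A" unfolding cover_def A_def by (auto intro!: exI[of _ n])
    qed
  qed
  have mono: "j \<le> k \<Longrightarrow> X j \<le> X k" for j k using int_seq_mono[of X j k, OF XD(1)] .
  have "fine_partition {a..b} A"
  proof (rule fine_partitionI)
    show "u < v" "{u..v} \<subseteq> {a..b}" if uv: "(u,v) \<in> A" for u v
    proof -
      obtain n where "u = X n" "v = X (n+1)" using uv unfolding mem by blast
      then show "u < v" "{u..v} \<subseteq> {a..b}" using XD(1,2)[of n] XD(3)[of "n+1"] by auto
    qed
    show "v \<le> u' \<or> v' \<le> u" if uv: "(u,v) \<in> A" "(u',v') \<in> A" "(u,v) \<noteq> (u',v')" for u v u' v'
    proof -
      obtain n k where nk: "u = X n" "v = X (n+1)" "u' = X k" "v' = X (k+1)" using uv by (auto simp: mem)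
      then have "n \<noteq> k" using uv by auto
      then have "n + 1 \<le> k \<or> k + 1 \<le> n" by linarith
      then show ?thesis using mono nk by auto
    qed
    have "{a..b} - (\<Union>(u,v)\<in>A. {u<..<v}) \<subseteq> insert a (insert b (range X))"
    proof
      fix y assume y: "y \<in> {a..b} - (\<Union>(u,v)\<in>A. {u<..<v})"
      show "y \<in> insert a (insert b (range X))"
      proof (rule ccontr)
        assume n: "\<not> ?thesis"
        then obtain n where "X n \<le> y" "y < X (n+1)" using XD(9)[of y] y by auto
        moreover have "X n \<noteq> y" using n by auto
        ultimately have "y \<in> (\<Union>(u,v)\<in>A. {u<..<v})" by (auto simp: A_def intro!: exI[of _ n])
        then show False using y by blast
      qed
    qed
    then show "countable ({a..b} - (\<Union>(u,v)\<in>A. {u<..<v}))" by (rule countable_subset) auto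
    fix x e :: real assume e: "e > 0"
    show "\<exists>r>0. \<forall>u v. (u,v) \<in> A \<longrightarrow> x < u \<longrightarrow> u < x + r \<longrightarrow> v - u \<le> e * (u - x)"
    proof -
      consider "x < a" | "x = a" | "a < x" "x < b" | "b \<le> x" by linarith
      then show ?thesis
      proof cases
        case 1
        have "\<not> X n < x + (a - x)" for n using XD(2)[of n] by simp
        then show ?thesis using 1 by (intro exI[of _ "a - x"]) (auto simp: mem)
      next
        case 2
        then show ?thesis using XD(7)[OF e] by (auto simp: mem)
      next
        case 3
        obtain n where n: "X n \<le> x" "x < X (n+1)" using XD(9)[OF 3] by blast
        have "\<not> X k < x + (X (n+1) - x)" if "x < X k" for k
          using chain_less[OF X, of n k] that n mono[of "n+1" k] by auto
        then show ?thesis using n by (intro exI[of _ "X (n+1) - x"]) (auto simp: mem)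
      next
        case 4
        then show ?thesis using XD(3) by (intro exI[of _ 1]) (auto simp: mem, smt (verit))
      qed
    qed
    show "\<exists>r>0. \<forall>u v. (u,v) \<in> A \<longrightarrow> v < x \<longrightarrow> x - r < v \<longrightarrow> v - u \<le> e * (x - v)"
    proof -
      consider "b < x" | "x = b" | "a < x" "x < b" | "x \<le> a" by linarith
      then show ?thesis
      proof cases
        case 1
        have "\<not> x - (x - b) < X n" for n using XD(3)[of n] by simp
        then show ?thesis using 1 by (intro exI[of _ "x - b"]) (auto simp: mem)
      next
        case 2
        then show ?thesis using XD(8)[OF e] by (auto simp: mem)
      next
        case 3
        obtain n where n: "X n < x" "x \<le> X (n+1)" using chain_locate_left[OF X 3] by blast
        have "\<not> x - (x - X n) < X k" if "X k < x" for k
          using chain_less[OF X, of k "n+1"] that n mono[of k n] by auto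
        then show ?thesis using n by (intro exI[of _ "x - X n"]) (auto simp: mem)
      next
        case 4
        then show ?thesis using XD(2) by (intro exI[of _ 1]) (auto simp: mem, smt (verit))
      qed
    qed
  qed
  moreover have "\<exists>r>0. \<forall>y. \<bar>y - x\<bar> < r \<longrightarrow> (\<exists>(u,v)\<in>A. x \<in> {u..v} \<and> y \<in> {u..v})" if x: "x \<in> cover A" for x
  proof -
    have x': "a < x" "x < b" using x unfolding cov by auto
    \<comment> \<open>If x is a chain point, the tiles on its two sides differ, so each side is
      located separately.\<close>
    obtain n where n: "X n \<le> x" "x < X (n+1)" using XD(9)[OF x'] by blast
    obtain k where k: "X k < x" "x \<le> X (k+1)" using chain_locate_left[OF X x'] by blast
    have "\<exists>(u,v)\<in>A. x \<in> {u..v} \<and> y \<in> {u..v}" if "\<bar>y - x\<bar> < min (X (n+1) - x) (x - X k)" for y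
    proof (cases "x \<le> y")
      case True
      then show ?thesis using n that by (intro bexI[of _ "(X n, X (n+1))"]) (auto simp: mem)
    next
      case False
      then show ?thesis using k that by (intro bexI[of _ "(X k, X (k+1))"]) (auto simp: mem)
    qed
    then show ?thesis using n k by (intro exI[of _ "min (X (n+1) - x) (x - X k)"]) auto
  qed
  moreover have "v - u \<le> \<eta>" if uv: "(u,v) \<in> A" for u v
  proof -
    obtain n where n: "u = X n" "v = X (n+1)" using uv unfolding mem by blast
    \<comment> \<open>Here \<open>b - a \<le> 1\<close> turns the relative bound on tiles into the
      absolute bound \<eta>.\<close>
    have "\<eta> * (X n - a) \<le> \<eta> * 1" using \<eta> ab XD(3)[of n] by (intro mult_left_mono) auto
    then show ?thesis using XD(5)[of n] by (simp add: n)
  qed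
  moreover have "\<exists>r>0. \<forall>y\<in>{a..b}. \<bar>y - x\<bar> < r \<longrightarrow> \<bar>g y - g x\<bar> \<le> e * \<bar>y - x\<bar>"
    if x: "x \<in> {a..b} - cover A" and e: "e > 0" for x e
  proof -
    have "x = a \<or> x = b" using x unfolding cov by auto
    then show ?thesis
    proof
      assume [simp]: "x = a"
      obtain r where "r > 0" "\<forall>y\<in>{a..b}. y < a + r \<longrightarrow> \<bar>g y - g a\<bar> \<le> e * (y - a)" using a[OF e] by blast
      then show ?thesis by (intro exI[of _ r]) auto
    next
      assume [simp]: "x = b"
      obtain r where "r > 0" "\<forall>y\<in>{a..b}. b - r < y \<longrightarrow> \<bar>g y - g b\<bar> \<le> e * (b - y)" using b[OF e] by blast
      then show ?thesis by (intro exI[of _ r]) (auto simp: abs_minus_commute)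
    qed
  qed
  moreover have "(x < u \<longrightarrow> v - u \<le> \<eta> * (u - x)) \<and> (v < x \<longrightarrow> v - u \<le> \<eta> * (x - v))"
    if x: "x \<in> {a..b} - cover A" and uv: "(u,v) \<in> A" for x u v
  proof -
    have "x = a \<or> x = b" using x unfolding cov by auto
    obtain n where n: "u = X n" "v = X (n+1)" using uv unfolding mem by blast
    from \<open>x = a \<or> x = b\<close> show ?thesis unfolding n using XD(5,6)[of n] XD(2)[of "n+1"] XD(3)[of n] by auto
  qed
  moreover have "\<bar>g v - g u\<bar> = c * (v - u)" "measure lebesgue ({u..v} - E) \<le> \<delta> * (v - u)" if "(u,v) \<in> A" for u v
    using that slope XD(4) by (auto simp: mem)
  ultimately show "stage {a..b} E c \<delta> \<eta> g A {}"
    unfolding stage_def using lip by auto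
qed

text \<open>A subdivision point at relative distance at least l from both ends leaves two pieces
  that each have at least the fraction l of the length. A defect ratio \<open>\<delta> * l\<close>
  of the tile thus becomes at most \<delta> on each piece.\<close>

lemma chain_interleave:
  assumes X: "chain a b E (\<delta> * l) \<eta> X" and l: "0 < l" and \<delta>: "0 < \<delta>" and \<eta>: "0 < \<eta>"
    and w: "\<And>n. X n + l * (X (n+1) - X n) \<le> w n" "\<And>n. w n \<le> X (n+1) - l * (X (n+1) - X n)"
    and E: "E \<in> sets lebesgue"
  defines "Y \<equiv> \<lambda>k::int. if even k then X (k div 2) else w (k div 2)"
  shows "chain a b E \<delta> \<eta> Y"
proof -
  note XD = chainD[OF X]
  have pos: "0 < l * (X (n+1) - X n)" for n using l XD(1)[of n] by simp
  have w1: "X n < w n" "w n < X (n+1)" for n using w[of n] pos[of n] by auto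
  have cases: "(\<exists>n. Y k = X n \<and> Y (k+1) = w n) \<or> (\<exists>n. Y k = w n \<and> Y (k+1) = X (n+1))" for k
  proof (cases "even k")
    case True
    then show ?thesis by (intro disjI1 exI[of _ "k div 2"]) (auto simp: Y_def)
  next
    case False
    then have "(k + 1) div 2 = k div 2 + 1" by presburger
    then show ?thesis using False by (intro disjI2 exI[of _ "k div 2"]) (auto simp: Y_def)
  qed
  have sub: "\<exists>n. X n \<le> Y k \<and> Y k < Y (k+1) \<and> Y (k+1) \<le> X (n+1) \<and> l * (X (n+1) - X n) \<le> Y (k+1) - Y k" for k
    using cases[of k]
  proof (elim disjE exE conjE)
    fix n assume "Y k = X n" "Y (k+1) = w n"
    then show ?thesis using w1[of n] w[of n] by (intro exI[of _ n]) auto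
  next
    fix n assume "Y k = w n" "Y (k+1) = X (n+1)"
    then show ?thesis using w1[of n] w[of n] by (intro exI[of _ n]) auto
  qed
  have step: "Y k < Y (k+1)" for k using sub[of k] by auto
  have bds: "a < Y k \<and> Y k < b" for k
    using sub[of k] XD(2,3) by (meson less_le_trans le_less_trans less_trans)
  have lm: "{u..v} - E \<in> lmeasurable" for u v using E by (simp add: fmeasurable_Diff)
  have meas: "measure lebesgue ({Y k..Y (k+1)} - E) \<le> \<delta> * (Y (k+1) - Y k)" for k
  proof -
    obtain n where n: "X n \<le> Y k" "Y (k+1) \<le> X (n+1)" "l * (X (n+1) - X n) \<le> Y (k+1) - Y k" using sub[of k] by blast
    have "measure lebesgue ({Y k..Y (k+1)} - E) \<le> measure lebesgue ({X n..X (n+1)} - E)"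
      using n lm by (intro measure_mono_fmeasurable) (auto simp: fmeasurableD)
    also have "\<dots> \<le> \<delta> * (l * (X (n+1) - X n))" using XD(4)[of n] by (simp add: mult.assoc)
    also have "\<dots> \<le> \<delta> * (Y (k+1) - Y k)" using n \<delta> by (intro mult_left_mono) auto
    finally show ?thesis .
  qed
  have small: "Y (k+1) - Y k \<le> e * (Y k - a)" if "X n \<le> Y k" "Y (k+1) \<le> X (n+1)" "X (n+1) - X n \<le> e * (X n - a)" "e > 0" for k n e
    using that mult_left_mono[of "X n - a" "Y k - a" e] by linarith
  have small': "Y (k+1) - Y k \<le> e * (b - Y (k+1))" if "X n \<le> Y k" "Y (k+1) \<le> X (n+1)" "X (n+1) - X n \<le> e * (b - X (n+1))" "e > 0" for k n e
    using that mult_left_mono[of "b - X (n+1)" "b - Y (k+1)" e] by linarith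
  have eta: "Y (k+1) - Y k \<le> \<eta> * (Y k - a) \<and> Y (k+1) - Y k \<le> \<eta> * (b - Y (k+1))" for k
    using sub[of k] XD(5,6) small small' \<eta> by metis
  have ea: "\<exists>r>0. \<forall>k. Y k < a + r \<longrightarrow> Y (k+1) - Y k \<le> e * (Y k - a)" if e: "e > 0" for e
  proof -
    obtain r where r: "r > 0" "\<And>n. X n < a + r \<Longrightarrow> X (n+1) - X n \<le> e * (X n - a)" using XD(7)[OF e] by blast
    have "Y (k+1) - Y k \<le> e * (Y k - a)" if "Y k < a + r" for k
    proof -
      obtain n where n: "X n \<le> Y k" "Y (k+1) \<le> X (n+1)" using sub[of k] by blast
      then show ?thesis using small[OF n r(2) e] that by simp
    qed
    then show ?thesis using r by blast
  qed
  have eb: "\<exists>r>0. \<forall>k. b - r < Y (k+1) \<longrightarrow> Y (k+1) - Y k \<le> e * (b - Y (k+1))" if e: "e > 0" for e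
  proof -
    obtain r where r: "r > 0" "\<And>n. b - r < X (n+1) \<Longrightarrow> X (n+1) - X n \<le> e * (b - X (n+1))" using XD(8)[OF e] by blast
    have "Y (k+1) - Y k \<le> e * (b - Y (k+1))" if "b - r < Y (k+1)" for k
    proof -
      obtain n where n: "X n \<le> Y k" "Y (k+1) \<le> X (n+1)" using sub[of k] by blast
      then show ?thesis using small'[OF n r(2) e] that by simp
    qed
    then show ?thesis using r by blast
  qed
  have loc: "\<exists>k. Y k \<le> y \<and> y < Y (k+1)" if y: "a < y" "y < b" for y
  proof -
    obtain n where n: "X n \<le> y" "y < X (n+1)" using XD(9)[OF y] by blast
    have Y: "Y (2*n) = X n" "Y (2*n+1) = w n" "Y (2*n+1+1) = X (n+1)" by (auto simp: Y_def add.commute)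
    show ?thesis
    proof (cases "y < w n")
      case True
      then show ?thesis using n Y by (intro exI[of _ "2*n"]) simp
    next
      case False
      then show ?thesis using n Y by (intro exI[of _ "2*n+1"]) simp
    qed
  qed
  show ?thesis unfolding chain_def using step bds meas eta ea eb loc by blast
qed

section \<open>Zigzags on one block\<close>

lemma stageD:
  assumes "stage S E c \<delta> \<eta> f A B"
  shows "fine_partition S (A \<union> B)"
    "\<And>x y. x \<in> S \<Longrightarrow> y \<in> S \<Longrightarrow> \<bar>f x - f y\<bar> \<le> c * \<bar>x - y\<bar>"
    "\<And>u v y. (u,v) \<in> B \<Longrightarrow> y \<in> {u..v} \<Longrightarrow> f y = f u"
    "\<And>u v. (u,v) \<in> A \<Longrightarrow> \<bar>f v - f u\<bar> = c * (v - u)"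
    "\<And>u v. (u,v) \<in> A \<Longrightarrow> measure lebesgue ({u..v} - E) \<le> \<delta> * (v - u)"
    "\<And>u v. (u,v) \<in> A \<Longrightarrow> v - u \<le> \<eta>"
    "\<And>x. x \<in> cover A \<Longrightarrow> \<exists>r>0. \<forall>y. \<bar>y - x\<bar> < r \<longrightarrow> (\<exists>(u,v)\<in>A. x \<in> {u..v} \<and> y \<in> {u..v})"
    "\<And>x e. x \<in> S \<Longrightarrow> x \<notin> cover A \<Longrightarrow> e > 0 \<Longrightarrow> \<exists>r>0. \<forall>y\<in>S. \<bar>y - x\<bar> < r \<longrightarrow> \<bar>f y - f x\<bar> \<le> e * \<bar>y - x\<bar>"
    "\<And>x u v. x \<in> S \<Longrightarrow> x \<notin> cover A \<Longrightarrow> (u,v) \<in> A \<Longrightarrow> x < u \<Longrightarrow> v - u \<le> \<eta> * (u - x)"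
    "\<And>x u v. x \<in> S \<Longrightarrow> x \<notin> cover A \<Longrightarrow> (u,v) \<in> A \<Longrightarrow> v < x \<Longrightarrow> v - u \<le> \<eta> * (x - v)"
  using assms unfolding stage_def by blast+

lemma stageI:
  assumes "fine_partition S (A \<union> B)"
    "\<And>x y. x \<in> S \<Longrightarrow> y \<in> S \<Longrightarrow> \<bar>f x - f y\<bar> \<le> c * \<bar>x - y\<bar>"
    "\<And>u v y. (u,v) \<in> B \<Longrightarrow> y \<in> {u..v} \<Longrightarrow> f y = f u"
    "\<And>u v. (u,v) \<in> A \<Longrightarrow> \<bar>f v - f u\<bar> = c * (v - u)"
    "\<And>u v. (u,v) \<in> A \<Longrightarrow> measure lebesgue ({u..v} - E) \<le> \<delta> * (v - u)"
    "\<And>u v. (u,v) \<in> A \<Longrightarrow> v - u \<le> \<eta>"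
    "\<And>x. x \<in> cover A \<Longrightarrow> \<exists>r>0. \<forall>y. \<bar>y - x\<bar> < r \<longrightarrow> (\<exists>(u,v)\<in>A. x \<in> {u..v} \<and> y \<in> {u..v})"
    "\<And>x e. x \<in> S \<Longrightarrow> x \<notin> cover A \<Longrightarrow> e > 0 \<Longrightarrow> \<exists>r>0. \<forall>y\<in>S. \<bar>y - x\<bar> < r \<longrightarrow> \<bar>f y - f x\<bar> \<le> e * \<bar>y - x\<bar>"
    "\<And>x u v. x \<in> S \<Longrightarrow> x \<notin> cover A \<Longrightarrow> (u,v) \<in> A \<Longrightarrow> x < u \<Longrightarrow> v - u \<le> \<eta> * (u - x)"
    "\<And>x u v. x \<in> S \<Longrightarrow> x \<notin> cover A \<Longrightarrow> (u,v) \<in> A \<Longrightarrow> v < x \<Longrightarrow> v - u \<le> \<eta> * (x - v)"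
  shows "stage S E c \<delta> \<eta> f A B"
proof -
  have "\<forall>(u,v)\<in>A. \<bar>f v - f u\<bar> = c * (v - u) \<and> measure lebesgue ({u..v} - E) \<le> \<delta> * (v - u) \<and> v - u \<le> \<eta>"
    using assms(4-6) by blast
  moreover have "\<forall>x\<in>S - cover A. \<forall>(u,v)\<in>A. (x < u \<longrightarrow> v - u \<le> \<eta> * (u - x)) \<and> (v < x \<longrightarrow> v - u \<le> \<eta> * (x - v))"
    using assms(9,10) by blast
  moreover have "\<forall>x\<in>S - cover A. \<forall>e>0. \<exists>r>0. \<forall>y\<in>S. \<bar>y - x\<bar> < r \<longrightarrow> \<bar>f y - f x\<bar> \<le> e * \<bar>y - x\<bar>"
    using assms(8) by blast
  moreover have "\<forall>(u,v)\<in>B. \<forall>y\<in>{u..v}. f y = f u" using assms(3) by blast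
  ultimately show ?thesis unfolding stage_def using assms(1,2,7) by simp
qed

text \<open>The mean slope \<rho> has modulus at most c0, strictly below c. Half of the slack, from
  c0 to c1, compresses the rise away from the ends; the other half, from c1 to c, bounds the legs of
  the tents from below. The factors in \<theta> are those demanded by
  \<open>chain_interleave\<close> and \<open>chain_exists\<close>. For \<rho> = 0 the tents stand on
  a constant function, and the tile bounds limit their height.\<close>

lemma stage_block:
  fixes E :: "real set"
  assumes E: "E \<in> sets lebesgue" and ab: "a < b" "b - a \<le> 1"
    and c: "0 \<le> c0" "c0 < c" "c \<le> 1" and \<rho>: "\<bar>\<rho>\<bar> \<le> c0" and \<delta>: "\<delta> > 0" and \<eta>: "0 < \<eta>" "\<eta> \<le> 1"
    and \<theta>: "\<theta> = \<delta> * ((c - c0) / (4 * c)) * \<eta> / 2"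
    and a: "\<And>t. 0 < t \<Longrightarrow> t \<le> b - a \<Longrightarrow> measure lebesgue ({a..a+t} - E) \<le> \<theta> * t"
    and b: "\<And>t. 0 < t \<Longrightarrow> t \<le> b - a \<Longrightarrow> measure lebesgue ({b-t..b} - E) \<le> \<theta> * t"
    and a0: "\<And>e. e > 0 \<Longrightarrow> \<exists>r>0. \<forall>t. 0 < t \<and> t \<le> r \<longrightarrow> measure lebesgue ({a..a+t} - E) \<le> e * t"
    and b0: "\<And>e. e > 0 \<Longrightarrow> \<exists>r>0. \<forall>t. 0 < t \<and> t \<le> r \<longrightarrow> measure lebesgue ({b-t..b} - E) \<le> e * t"
  obtains g A where "stage {a..b} E c \<delta> \<eta> g A {}" "cover A = {a<..<b}"
    "g a = \<alpha>" "g b = \<alpha> + \<rho> * (b - a)"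
    "\<And>y. \<rho> = 0 \<Longrightarrow> y \<in> {a..b} \<Longrightarrow> \<bar>g y - \<alpha>\<bar> \<le> \<eta> * (y - a)"
    "\<And>y. \<rho> = 0 \<Longrightarrow> y \<in> {a..b} \<Longrightarrow> \<bar>g y - \<alpha>\<bar> \<le> \<eta> * (b - y)"
proof -
  have c_pos: "0 < c" using c by simp
  \<comment> \<open>With c1 halfway between c0 and c, \<open>1 - c1 / c = 2 * l\<close>. A tent over
    length D with difference of base values at most \<open>c1 * D\<close> then has its apex at
    distance at least \<open>l * D\<close> from both ends.\<close>
  define l where "l = (c - c0) / (4 * c)"
  have l: "0 < l" using c by (simp add: l_def)
  obtain X where X: "chain a b E (\<delta> * l) \<eta> X"
  proof (rule chain_exists[OF E ab(1) _ \<eta>, of "\<delta> * l"])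
    have "\<theta> = \<delta> * l * \<eta> / 2" by (simp add: \<theta> l_def)
    then show "\<And>t. 0 < t \<Longrightarrow> t \<le> b - a \<Longrightarrow> measure lebesgue ({a..a+t} - E) \<le> \<delta> * l * \<eta> / 2 * t"
      "\<And>t. 0 < t \<Longrightarrow> t \<le> b - a \<Longrightarrow> measure lebesgue ({b-t..b} - E) \<le> \<delta> * l * \<eta> / 2 * t"
      using a b by metis+
  qed (use \<delta> l a0 b0 in auto)
  note XD = chainD[OF X]
  define c1 where "c1 = (c0 + c) / 2"
  have c1: "c0 < c1" "c1 < c" "0 < c1" using c by (auto simp: c1_def)
  \<comment> \<open>Omitting margins of width s on both sides still gives
    \<open>c1 * (b - a - 2 * s) = (b - a) * (c1 + c0) / 2\<close>, which is at least the rise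
    required and is positive even if c0 = 0.\<close>
  define s where "s = (b - a) * (c1 - c0) / (4 * c1)"
  have s: "0 < s" "s < b - a" "4 * c1 * s = (b - a) * (c1 - c0)"
  proof -
    show "0 < s" using ab c1 by (simp add: s_def)
    show eq: "4 * c1 * s = (b - a) * (c1 - c0)" using c1 by (simp add: s_def)
    have "(b - a) * (c1 - c0) < 4 * c1 * (b - a)" 
      unfolding mult.commute[of "4 * c1"] using c1 c ab by (intro mult_strict_left_mono) auto
    then have "4 * c1 * s < 4 * c1 * (b - a)" unfolding eq .
    then show "s < b - a" using c1 by simp
  qed
  obtain j where j: "X j \<le> a + s" using XD(9)[of "a + s"] s by auto
  obtain k where k: "b - s < X (k+1)" using XD(9)[of "b - s"] s by auto
  define xl xr where "xl = X j" and "xr = X (k+1)"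
  have xlr: "a < xl" "xl < b" "a < xr" "xr < b" using XD(2,3) by (auto simp: xl_def xr_def)
  have gap: "c1 * (xr - xl) \<ge> c0 * (b - a)" "xl < xr"
  proof -
    have d: "b - a - 2 * s \<le> xr - xl" using j k by (simp add: xl_def xr_def)
    have "c1 * (b - a - 2 * s) = c1 * (b - a) - (b - a) * (c1 - c0) / 2"
      using s(3) by (simp add: algebra_simps)
    also have "\<dots> = (b - a) * ((c1 + c0) / 2)" by (simp add: field_simps)
    finally have eq: "c1 * (b - a - 2 * s) = (b - a) * ((c1 + c0) / 2)" .
    have "c1 * (b - a - 2 * s) \<le> c1 * (xr - xl)" using d c1 by simp
    moreover have "(b - a) * c0 \<le> (b - a) * ((c1 + c0) / 2)" using ab c1 by (intro mult_left_mono) auto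
    ultimately show "c1 * (xr - xl) \<ge> c0 * (b - a)" using eq by (simp add: mult.commute)
    have "0 < c1 * (b - a - 2 * s)" unfolding eq using ab c1 c by simp
    then have "0 < b - a - 2 * s" using c1 zero_less_mult_pos by blast
    then show "xl < xr" using d by linarith
  qed
  define \<sigma> where "\<sigma> = \<rho> * (b - a) / (xr - xl)"
  have \<sigma>: "\<bar>\<sigma>\<bar> \<le> c1"
  proof -
    have "\<bar>\<rho>\<bar> * (b - a) \<le> c0 * (b - a)" using \<rho> ab by (intro mult_right_mono) auto
    then have "\<bar>\<rho>\<bar> * (b - a) \<le> c1 * (xr - xl)" using gap by linarith
    then show ?thesis using gap ab by (simp add: \<sigma>_def abs_mult abs_divide pos_divide_le_eq)
  qed
  \<comment> \<open>The whole rise happens between \<open>xl\<close> and \<open>xr\<close>, so that the tents below flatten out at \<open>a\<close> and \<open>b\<close>.\<close>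
  define h where "h y = \<alpha> + \<sigma> * (max xl (min y xr) - xl)" for y
  have h_lip: "\<bar>h x - h y\<bar> \<le> c1 * \<bar>x - y\<bar>" for x y
  proof -
    have "\<bar>h x - h y\<bar> = \<bar>\<sigma>\<bar> * \<bar>max xl (min x xr) - max xl (min y xr)\<bar>"
      by (simp add: h_def algebra_simps flip: abs_mult)
    also have "\<dots> \<le> c1 * \<bar>x - y\<bar>" using \<sigma> c1 by (intro mult_mono) auto
    finally show ?thesis .
  qed
  have h_left: "h y = \<alpha>" if "y \<le> xl" for y using that gap by (simp add: h_def)
  have h_right: "h y = \<alpha> + \<rho> * (b - a)" if "xr \<le> y" for y using that gap by (simp add: h_def \<sigma>_def)
  define N where "N = insert a (insert b (range X))"
  have h_lip': "\<bar>h x - h y\<bar> \<le> c * \<bar>x - y\<bar>" for x y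
    using h_lip[of x y] c1 mult_right_mono[of c1 c "\<bar>x - y\<bar>"] by linarith
  obtain g where g: "\<And>x y. \<bar>g x - g y\<bar> \<le> c * \<bar>x - y\<bar>" "\<And>x. x \<in> N \<Longrightarrow> g x = h x"
    "\<And>y l. (\<And>z. z \<in> N \<Longrightarrow> l \<le> h z + c * \<bar>y - z\<bar>) \<Longrightarrow> l \<le> g y"
    using mcshane_extension[of N h c] h_lip' c_pos by (metis N_def insert_not_empty less_imp_le)
  have gX: "g (X n) = h (X n)" "g a = h a" "g b = h b" for n using g(2) by (auto simp: N_def)
  \<comment> \<open>Apex of the tent of slopes \<open>c\<close> and \<open>-c\<close> that joins the values of \<open>h\<close> at consecutive chain points.\<close>
  define w where "w n = ((h (X (n+1)) - h (X n)) / c + X n + X (n+1)) / 2" for n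
  have w_eq: "h (X n) + c * (w n - X n) = h (X (n+1)) + c * (X (n+1) - w n)" for n
    using c_pos by (simp add: w_def field_simps)
  have w_bounds: "X n + l * (X (n+1) - X n) \<le> w n" "w n \<le> X (n+1) - l * (X (n+1) - X n)" for n
  proof -
    let ?D = "X (n+1) - X n"
    have "\<bar>(h (X (n+1)) - h (X n)) / c\<bar> \<le> c1 * ?D / c"
      using h_lip[of "X (n+1)" "X n"] c_pos XD(1)[of n] by (simp add: abs_divide divide_right_mono)
    moreover have "c1 * ?D / c = ?D - 2 * (l * ?D)" using c_pos by (simp add: l_def c1_def field_simps)
    ultimately have "\<bar>(h (X (n+1)) - h (X n)) / c\<bar> \<le> ?D - 2 * (l * ?D)" by simp
    then show "X n + l * ?D \<le> w n" "w n \<le> X (n+1) - l * ?D"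
      unfolding w_def abs_le_iff by (simp_all add: field_simps) 
  qed
  have w_btw: "X n < w n" "w n < X (n+1)" for n
    using w_bounds[of n] XD(1)[of n] l by (smt (verit) mult_pos_pos)+
  have mono: "i \<le> m \<Longrightarrow> X i \<le> X m" for i m using int_seq_mono[of X i m, OF XD(1)] .
  have gw: "g (w n) = h (X n) + c * (w n - X n)" for n
  proof (rule antisym)
    show "g (w n) \<le> h (X n) + c * (w n - X n)"
      using g(1)[of "w n" "X n"] gX(1)[of n] w_btw[of n] by (simp add: abs_le_iff)
    show "h (X n) + c * (w n - X n) \<le> g (w n)"
    proof (rule g(3))
      fix z assume z: "z \<in> N"
      have "z \<le> X n \<or> X (n+1) \<le> z"
      proof -
        have "X m \<le> X n \<or> X (n+1) \<le> X m" for m using mono[of m n] mono[of "n+1" m] by linarith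
        then show ?thesis using z XD(2)[of n] XD(3)[of "n+1"] by (auto simp: N_def)
      qed
      then show "h (X n) + c * (w n - X n) \<le> h z + c * \<bar>w n - z\<bar>"
      proof
        assume "z \<le> X n"
        then show ?thesis using h_lip'[of "X n" z] w_btw[of n] by (simp add: abs_le_iff algebra_simps)
      next
        assume "X (n+1) \<le> z"
        then show ?thesis unfolding w_eq using h_lip'[of "X (n+1)" z] w_btw[of n] by (simp add: abs_le_iff algebra_simps)
      qed
    qed
  qed
  define Y where "Y = (\<lambda>k::int. if even k then X (k div 2) else w (k div 2))"
  have Y: "chain a b E \<delta> \<eta> Y"
    unfolding Y_def by (rule chain_interleave[OF X l \<delta> \<eta>(1) w_bounds E])
  have slope: "\<bar>g (Y (k+1)) - g (Y k)\<bar> = c * (Y (k+1) - Y k)" for k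
  proof (cases "even k")
    case True
    define n where "n = k div 2"
    have "Y k = X n" "Y (k+1) = w n" using True by (auto simp: Y_def n_def)
    then show ?thesis using gw[of n] gX(1)[of n] w_btw[of n] c_pos by (simp add: abs_mult)
  next
    case False
    define n where "n = k div 2"
    have "(k + 1) div 2 = n + 1" using False unfolding n_def by presburger
    then have "Y k = w n" "Y (k+1) = X (n+1)" using False by (auto simp: Y_def n_def)
    then show ?thesis using gw[of n] gX(1)[of "n+1"] w_btw[of n] c_pos unfolding w_eq by (simp add: abs_mult)
  qed
  have near: "\<bar>g y - h (X n)\<bar> \<le> X (n+1) - X n" "\<bar>g y - h (X (n+1))\<bar> \<le> X (n+1) - X n"
    if "X n \<le> y" "y < X (n+1)" for n y
  proof -
    have "c * \<bar>y - z\<bar> \<le> \<bar>y - z\<bar>" for z using c by (simp add: mult_left_le_one_le)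
    then show "\<bar>g y - h (X n)\<bar> \<le> X (n+1) - X n" "\<bar>g y - h (X (n+1))\<bar> \<le> X (n+1) - X n"
      using g(1)[of y "X n"] g(1)[of y "X (n+1)"] gX(1)[of n] gX(1)[of "n+1"] that by (smt (verit))+
  qed
  have ea: "\<exists>r>0. \<forall>y\<in>{a..b}. y < a + r \<longrightarrow> \<bar>g y - g a\<bar> \<le> e * (y - a)" if e: "e > 0" for e
  proof -
    obtain r where r: "r > 0" "\<And>n. X n < a + r \<Longrightarrow> X (n+1) - X n \<le> e * (X n - a)" using XD(7)[OF e] by blast
    have "\<bar>g y - g a\<bar> \<le> e * (y - a)" if y: "a < y" "y < a + min r (xl - a)" for y
    proof -
      have y': "y < xl" "y < a + r" using y by linarith+
      obtain n where n: "X n \<le> y" "y < X (n+1)" using XD(9)[of y] y(1) y' xlr by auto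
      \<comment> \<open>In the margin the tents stand on the constant value \<open>g a\<close>, so
        the deviation is at most the tile length, and that is small compared with the distance to
        a.\<close>
      have "h (X n) = g a" using h_left[of "X n"] h_left[of a] n y' xlr gX(2) by auto
      then have "\<bar>g y - g a\<bar> \<le> X (n+1) - X n" using near(1)[OF n] by simp
      also have "\<dots> \<le> e * (X n - a)" using r(2)[of n] n y' by simp
      also have "\<dots> \<le> e * (y - a)" using n e by simp
      finally show ?thesis .
    qed
    then have "\<bar>g y - g a\<bar> \<le> e * (y - a)" if "a \<le> y" "y < a + min r (xl - a)" for y
      using that by (cases "y = a") (simp, simp add: less_le)
    then show ?thesis using r(1) xlr by (intro exI[of _ "min r (xl - a)"]) (simp del: min_less_iff_conj)
  qed
  have eb: "\<exists>r>0. \<forall>y\<in>{a..b}. b - r < y \<longrightarrow> \<bar>g y - g b\<bar> \<le> e * (b - y)" if e: "e > 0" for e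
  proof -
    obtain r where r: "r > 0" "\<And>n. b - r < X (n+1) \<Longrightarrow> X (n+1) - X n \<le> e * (b - X (n+1))" using XD(8)[OF e] by blast
    have "\<bar>g y - g b\<bar> \<le> e * (b - y)" if y: "y < b" "b - min r (b - xr) < y" for y
    proof -
      have y': "xr < y" "b - r < y" using y by linarith+
      obtain n where n: "X n \<le> y" "y < X (n+1)" using XD(9)[of y] y y' xlr by auto
      have "h (X (n+1)) = g b" using h_right[of "X (n+1)"] h_right[of b] n y' xlr gX(3) by auto
      then have "\<bar>g y - g b\<bar> \<le> X (n+1) - X n" using near(2)[OF n] by simp
      also have "\<dots> \<le> e * (b - X (n+1))" using r(2)[of n] n y' by simp
      also have "\<dots> \<le> e * (b - y)" using n e by simp
      finally show ?thesis .
    qed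
    then have "\<bar>g y - g b\<bar> \<le> e * (b - y)" if "y \<le> b" "b - min r (b - xr) < y" for y
      using that by (cases "y = b") (simp, simp add: less_le)
    then show ?thesis using r(1) xlr by (intro exI[of _ "min r (b - xr)"]) (simp del: min_less_iff_conj)
  qed
  note st = stage_chain[OF Y ab \<eta>(1) g(1) slope ea eb]
  have zero: "\<bar>g y - \<alpha>\<bar> \<le> \<eta> * (y - a) \<and> \<bar>g y - \<alpha>\<bar> \<le> \<eta> * (b - y)" if \<rho>0: "\<rho> = 0" and y: "y \<in> {a..b}" for y
  proof -
    have h0: "h z = \<alpha>" for z using \<rho>0 by (simp add: h_def \<sigma>_def)
    show ?thesis
    proof (cases "y = a \<or> y = b")
      case True
      then show ?thesis using gX h0 ab \<eta> by auto
    next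
      case False
      then obtain n where n: "X n \<le> y" "y < X (n+1)" using XD(9)[of y] y by auto
      have "\<eta> * (X n - a) \<le> \<eta> * (y - a)" "\<eta> * (b - X (n+1)) \<le> \<eta> * (b - y)" using n \<eta> by auto
      then show ?thesis using near(1)[OF n] XD(5,6)[of n] h0 by auto
    qed
  qed
  show thesis
    by (rule that[OF st]) (use gX h_left[of a] h_right[of b] xlr zero in auto)
qed

section \<open>Gluing\<close>

text \<open>The neighbourhood clause of \<open>stage\<close> ranges over all reals near x, not only
  those in the carrier, so neither end of the carrier can be covered.\<close>

lemma stage_cover_interior:
  assumes st: "stage {p..q} E c \<delta> \<eta> f A B"
  shows "cover A \<subseteq> {p<..<q}"
proof
  fix x assume "x \<in> cover A"
  then obtain r where r: "r > 0" "\<And>y. \<bar>y - x\<bar> < r \<Longrightarrow> \<exists>(u,v)\<in>A. x \<in> {u..v} \<and> y \<in> {u..v}"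
    using stageD(7)[OF st] by blast
  have "y \<in> {p..q}" if "\<bar>y - x\<bar> < r" for y
    using r(2)[OF that] fine_partitionD(2)[OF stageD(1)[OF st]] by blast
  from this[of "x - r/2"] this[of "x + r/2"] show "x \<in> {p<..<q}" using r(1) by auto
qed

lemma cover_iff: "x \<in> cover A \<longleftrightarrow> (\<exists>u v. (u,v) \<in> A \<and> u \<le> x \<and> x \<le> v)"
  unfolding cover_def by fastforce

lemma cover_UN: "cover (\<Union>J\<in>P. A J) = (\<Union>J\<in>P. cover (A J))"
  by (auto simp: cover_def)

lemma fine_partition_common_point:
  assumes "fine_partition S P" "(u,v) \<in> P" "(u',v') \<in> P" "x \<in> {u..v}" "x \<in> {u'..v'}"
  shows "(u,v) = (u',v') \<or> (x = v \<and> x = u') \<or> (x = u \<and> x = v')"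
  using fine_partitionD(3)[OF assms(1-3)] assms(4,5) by force

text \<open>At an uncovered point, pieces that touch it contribute the derivative 0 of their own
  functions. All other nearby pieces are short relative to their distance, so that replacing f on
  them perturbs it negligibly. Assumption \<open>H\<close> says that either the touching pieces fill
  a neighbourhood or f itself is flat there.\<close>

lemma stage_glue:
  assumes P: "fine_partition S P" and c: "c \<ge> 0" and \<eta>: "\<eta> \<ge> 0"
    and f: "\<And>x y. x \<in> S \<Longrightarrow> y \<in> S \<Longrightarrow> \<bar>f x - f y\<bar> \<le> c * \<bar>x - y\<bar>"
    and H: "\<And>x. x \<in> S \<Longrightarrow> (\<exists>r>0. \<forall>y\<in>S. \<bar>y - x\<bar> < r \<longrightarrow> (\<exists>(u,v)\<in>P. x \<in> {u..v} \<and> y \<in> {u..v})) \<or>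
      (\<forall>e>0. \<exists>r>0. \<forall>y\<in>S. \<bar>y - x\<bar> < r \<longrightarrow> \<bar>f y - f x\<bar> \<le> e * \<bar>y - x\<bar>)"
    and st: "\<And>u v. (u,v) \<in> P \<Longrightarrow> stage {u..v} E c \<delta> \<eta> (g (u,v)) (A (u,v)) (B (u,v))"
    and gu: "\<And>u v. (u,v) \<in> P \<Longrightarrow> g (u,v) u = f u" and gv: "\<And>u v. (u,v) \<in> P \<Longrightarrow> g (u,v) v = f v"
  obtains F where "stage S E c \<delta> \<eta> F (\<Union>J\<in>P. A J) (\<Union>J\<in>P. B J)"
    "\<And>u v y. (u,v) \<in> P \<Longrightarrow> y \<in> {u..v} \<Longrightarrow> F y = g (u,v) y" "\<And>y. y \<notin> cover P \<Longrightarrow> F y = f y"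
proof -
  note PD = fine_partitionD[OF P]
  \<comment> \<open>A point shared by two pieces is an endpoint of both, where both functions agree
    with f, so the choice of the piece is immaterial.\<close>
  define F where "F y = (if y \<in> cover P then g (SOME J. J \<in> P \<and> y \<in> {fst J..snd J}) y else f y)" for y
  have Fg: "F y = g (u,v) y" if uv: "(u,v) \<in> P" "y \<in> {u..v}" for u v y
  proof -
    have cov: "y \<in> cover P" using uv by (auto simp: cover_iff)
    define J where "J = (SOME J. J \<in> P \<and> y \<in> {fst J..snd J})"
    have J: "J \<in> P \<and> y \<in> {fst J..snd J}" unfolding J_def by (rule someI[of _ "(u,v)"]) (use uv in auto)
    obtain u' v' where J': "J = (u',v')" by (cases J)
    have "g J y = g (u,v) y"
      using fine_partition_common_point[OF P uv(1), of u' v' y] uv J gu gv unfolding J' by auto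
    then show ?thesis using cov by (simp add: F_def J_def)
  qed
  have Ff: "F y = f y" if "y \<notin> cover P" for y using that by (simp add: F_def)
  have Fu: "F u = f u" "F v = f v" if "(u,v) \<in> P" for u v
    using Fg[OF that, of u] Fg[OF that, of v] gu[OF that] gv[OF that] PD(1)[OF that] by auto
  have Flip: "\<bar>F x - F y\<bar> \<le> c * \<bar>x - y\<bar>" if uv: "(u,v) \<in> P" "x \<in> {u..v}" "y \<in> {u..v}" for u v x y
    using stageD(2)[OF st[OF uv(1)] uv(2,3)] Fg[OF uv(1,2)] Fg[OF uv(1,3)] by simp
  have covE: "\<exists>u v. (u,v) \<in> P \<and> x \<in> {u..v}" if "x \<in> cover P" for x using that by (auto simp: cover_iff)
  have lip: "\<bar>F x - F y\<bar> \<le> c * (y - x)" if xy: "x \<in> S" "y \<in> S" "x \<le> y" for x y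
  proof (cases "\<exists>(u,v)\<in>P. x \<in> {u..v} \<and> y \<in> {u..v}")
    case True
    then show ?thesis using Flip xy by fastforce
  next
    case False
    \<comment> \<open>x is linked to the right end q of its piece and y to the left end p of its
      piece (or to themselves if uncovered); F equals f at q and p, and the Lipschitz bound of f
      bridges the rest.\<close>
    have r: "\<exists>q\<in>S. x \<le> q \<and> \<bar>F x - f q\<bar> \<le> c * (q - x) \<and> q \<le> y \<and> (q = x \<or> (\<exists>u. (u,q) \<in> P \<and> x \<in> {u..q}))"
    proof (cases "x \<in> cover P")
      case True
      then obtain u v where uv: "(u,v) \<in> P" "x \<in> {u..v}" using covE by blast
      then have "v < y" using False xy by force
      then show ?thesis using uv Flip[OF uv(1) uv(2), of v] Fu[OF uv(1)] PD(1,2)[OF uv(1)]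
        by (intro bexI[of _ v]) auto
    next
      case False
      then show ?thesis using Ff xy by (intro bexI[of _ x]) auto
    qed
    have l: "\<exists>p\<in>S. p \<le> y \<and> \<bar>F y - f p\<bar> \<le> c * (y - p) \<and> x \<le> p \<and> (p = y \<or> (\<exists>v. (p,v) \<in> P \<and> y \<in> {p..v}))"
    proof (cases "y \<in> cover P")
      case True
      then obtain u v where uv: "(u,v) \<in> P" "y \<in> {u..v}" using covE by blast
      then have "x < u" using False xy by force
      then show ?thesis using uv Flip[OF uv(1) uv(2), of u] Fu[OF uv(1)] PD(1,2)[OF uv(1)]
        by (intro bexI[of _ u]) auto
    next
      case False
      then show ?thesis using Ff xy by (intro bexI[of _ y]) auto
    qed
    obtain q where q: "q \<in> S" "x \<le> q" "\<bar>F x - f q\<bar> \<le> c * (q - x)" "q \<le> y" "q = x \<or> (\<exists>u. (u,q) \<in> P \<and> x \<in> {u..q})"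
      using r by blast
    obtain p where p: "p \<in> S" "p \<le> y" "\<bar>F y - f p\<bar> \<le> c * (y - p)" "x \<le> p" "p = y \<or> (\<exists>v. (p,v) \<in> P \<and> y \<in> {p..v})"
      using l by blast
    \<comment> \<open>Otherwise the two pieces overlap and so coincide, contrary to the assumption
      that no piece contains both points.\<close>
    have "q \<le> p"
    proof (rule ccontr)
      assume "\<not> q \<le> p"
      then obtain u v where uv: "(u,q) \<in> P" "x \<in> {u..q}" "(p,v) \<in> P" "y \<in> {p..v}" using q p by auto
      have "(u,q) \<noteq> (p,v)" using False uv q p by auto
      then show False using PD(3)[OF uv(1,3)] uv q p \<open>\<not> q \<le> p\<close> False PD(1)[OF uv(1)] by force
    qed
    have "\<bar>f q - f p\<bar> \<le> c * (p - q)" using f[OF q(1) p(1)] \<open>q \<le> p\<close> by simp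
    then have "\<bar>F x - F y\<bar> \<le> c * (q - x) + c * (p - q) + c * (y - p)" using q(3) p(3) by linarith
    then show ?thesis by (simp add: algebra_simps)
  qed
  have sideR: "\<exists>r>0. \<forall>u v y. (u,v) \<in> P \<and> x \<in> {u..v} \<and> y \<in> {u..v} \<and> x < y \<and> y < x + r \<longrightarrow> \<bar>F y - F x\<bar> \<le> e * (y - x)"
    if x: "x \<notin> cover (\<Union>J\<in>P. A J)" and e: "e > 0" for x e
  proof (cases "\<exists>u v. (u,v) \<in> P \<and> u \<le> x \<and> x < v")
    case True
    then obtain u v where uv: "(u,v) \<in> P" "u \<le> x" "x < v" by blast
    have "x \<notin> cover (A (u,v))" using x uv(1) by (auto simp: cover_UN)
    then obtain r where r: "r > 0" "\<And>y. y \<in> {u..v} \<Longrightarrow> \<bar>y - x\<bar> < r \<Longrightarrow> \<bar>g (u,v) y - g (u,v) x\<bar> \<le> e * \<bar>y - x\<bar>"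
      using stageD(8)[OF st[OF uv(1)], of x e] uv e by auto
    have "\<bar>F y - F x\<bar> \<le> e * (y - x)" if uv': "(u',v') \<in> P" "x \<in> {u'..v'}" "y \<in> {u'..v'}" "x < y" "y < x + r" for u' v' y
    proof -
      have "(u',v') = (u,v)" using PD(3)[OF uv'(1) uv(1)] uv uv' by force
      then show ?thesis using r(2)[of y] uv' Fg[OF uv(1), of y] Fg[OF uv(1), of x] by auto
    qed
    then show ?thesis using r(1) by blast
  next
    case False
    then show ?thesis by (intro exI[of _ 1]) force
  qed
  have sideL: "\<exists>r>0. \<forall>u v y. (u,v) \<in> P \<and> x \<in> {u..v} \<and> y \<in> {u..v} \<and> y < x \<and> x - r < y \<longrightarrow> \<bar>F y - F x\<bar> \<le> e * (x - y)"
    if x: "x \<notin> cover (\<Union>J\<in>P. A J)" and e: "e > 0" for x e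
  proof (cases "\<exists>u v. (u,v) \<in> P \<and> u < x \<and> x \<le> v")
    case True
    then obtain u v where uv: "(u,v) \<in> P" "u < x" "x \<le> v" by blast
    have "x \<notin> cover (A (u,v))" using x uv(1) by (auto simp: cover_UN)
    then obtain r where r: "r > 0" "\<And>y. y \<in> {u..v} \<Longrightarrow> \<bar>y - x\<bar> < r \<Longrightarrow> \<bar>g (u,v) y - g (u,v) x\<bar> \<le> e * \<bar>y - x\<bar>"
      using stageD(8)[OF st[OF uv(1)], of x e] uv e by auto
    have "\<bar>F y - F x\<bar> \<le> e * (x - y)" if uv': "(u',v') \<in> P" "x \<in> {u'..v'}" "y \<in> {u'..v'}" "y < x" "x - r < y" for u' v' y
    proof -
      have "(u',v') = (u,v)" using PD(3)[OF uv'(1) uv(1)] uv uv' by force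
      then show ?thesis using r(2)[of y] uv' Fg[OF uv(1), of y] Fg[OF uv(1), of x] by auto
    qed
    then show ?thesis using r(1) by blast
  next
    case False
    then have "\<not> (y < x)" if "(u,v) \<in> P" "x \<in> {u..v}" "y \<in> {u..v}" for u v y
      using that by (meson atLeastAtMost_iff le_less_trans)
    then show ?thesis by (intro exI[of _ 1]) (metis zero_less_one)
  qed
  have deriv: "\<exists>r>0. \<forall>y\<in>S. \<bar>y - x\<bar> < r \<longrightarrow> \<bar>F y - F x\<bar> \<le> e * \<bar>y - x\<bar>"
    if xS: "x \<in> S" and x: "x \<notin> cover (\<Union>J\<in>P. A J)" and e: "e > 0" for x e
  proof -
    obtain r1 where r1: "r1 > 0" "\<And>u v y. (u,v) \<in> P \<Longrightarrow> x \<in> {u..v} \<Longrightarrow> y \<in> {u..v} \<Longrightarrow> x < y \<Longrightarrow> y < x + r1 \<Longrightarrow> \<bar>F y - F x\<bar> \<le> e * (y - x)"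
      using sideR[OF x e] by blast
    obtain r2 where r2: "r2 > 0" "\<And>u v y. (u,v) \<in> P \<Longrightarrow> x \<in> {u..v} \<Longrightarrow> y \<in> {u..v} \<Longrightarrow> y < x \<Longrightarrow> x - r2 < y \<Longrightarrow> \<bar>F y - F x\<bar> \<le> e * (x - y)"
      using sideL[OF x e] by blast
    have same: "\<bar>F y - F x\<bar> \<le> e * \<bar>y - x\<bar>" if uv: "(u,v) \<in> P" "x \<in> {u..v}" "y \<in> {u..v}" "\<bar>y - x\<bar> < min r1 r2" for u v y
      using r1(2)[OF uv(1-3)] r2(2)[OF uv(1-3)] uv(4) by (cases x y rule: linorder_cases) auto
    \<comment> \<open>A point interior to a piece has a covered neighbourhood. Any other point is an
      endpoint of its pieces or lies in none, so F equals f there and \<open>H\<close>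
      decides.\<close>
    consider (covered) "\<exists>r>0. \<forall>y\<in>S. \<bar>y - x\<bar> < r \<longrightarrow> (\<exists>(u,v)\<in>P. x \<in> {u..v} \<and> y \<in> {u..v})"
      | (flat) "F x = f x" "\<forall>e>0. \<exists>r>0. \<forall>y\<in>S. \<bar>y - x\<bar> < r \<longrightarrow> \<bar>f y - f x\<bar> \<le> e * \<bar>y - x\<bar>"
    proof (cases "\<exists>u v. (u,v) \<in> P \<and> u < x \<and> x < v")
      case True
      then obtain u v where uv: "(u,v) \<in> P" "u < x" "x < v" by blast
      have "\<exists>(u,v)\<in>P. x \<in> {u..v} \<and> y \<in> {u..v}" if "\<bar>y - x\<bar> < min (x - u) (v - x)" for y
        using that uv by (intro bexI[OF _ uv(1)]) auto
      then show thesis using uv by (intro covered exI[of _ "min (x - u) (v - x)"]) auto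
    next
      case False
      have "F x = f x"
      proof (cases "x \<in> cover P")
        case True
        then obtain u v where uv: "(u,v) \<in> P" "x \<in> {u..v}" using covE by blast
        then have "x = u \<or> x = v" using False by force
        then show ?thesis using Fu[OF uv(1)] by auto
      qed (use Ff in auto)
      then show thesis using H[OF xS] covered flat by blast
    qed
    then show ?thesis
    proof cases
      case covered
      then obtain r where r: "r > 0" "\<And>y. y \<in> S \<Longrightarrow> \<bar>y - x\<bar> < r \<Longrightarrow> \<exists>(u,v)\<in>P. x \<in> {u..v} \<and> y \<in> {u..v}" by blast
      have "\<bar>F y - F x\<bar> \<le> e * \<bar>y - x\<bar>" if "y \<in> S" "\<bar>y - x\<bar> < min r (min r1 r2)" for y
        using r(2)[of y] same[of _ _ y] that by fastforce
      then show ?thesis using r(1) r1(1) r2(1) by (intro exI[of _ "min r (min r1 r2)"]) auto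
    next
      case flat
      \<comment> \<open>Replacing f on a piece of length at most
        \<open>e' * \<bar>y - x\<bar>\<close> costs at most 2 c times that length, hence half of the
        allowance e; f takes the other half. The summand 1 guards against c = 0.\<close>
      define e' where "e' = e / (4 * (c + 1))"
      have e': "e' > 0" using e c by (simp add: e'_def)
      have ce': "2 * c * e' \<le> e / 2" using e c by (simp add: e'_def field_simps)
      obtain r where r: "r > 0" "\<And>u v. (u,v) \<in> P \<Longrightarrow> x < u \<Longrightarrow> u < x + r \<Longrightarrow> v - u \<le> e' * (u - x)"
        "\<And>u v. (u,v) \<in> P \<Longrightarrow> v < x \<Longrightarrow> x - r < v \<Longrightarrow> v - u \<le> e' * (x - v)"
        using fine_partition_near[OF P e', of x] by blast
      obtain r3 where r3: "r3 > 0" "\<And>y. y \<in> S \<Longrightarrow> \<bar>y - x\<bar> < r3 \<Longrightarrow> \<bar>f y - f x\<bar> \<le> e / 2 * \<bar>y - x\<bar>"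
        using flat(2) e by (metis half_gt_zero)
      define R where "R = min (min r r3) (min r1 r2)"
      have "\<bar>F y - F x\<bar> \<le> e * \<bar>y - x\<bar>" if y: "y \<in> S" "\<bar>y - x\<bar> < R" for y
      proof (cases "\<exists>(u,v)\<in>P. x \<in> {u..v} \<and> y \<in> {u..v}")
        case True
        then show ?thesis using same[of _ _ y] y by (fastforce simp: R_def)
      next
        case False
        have yr: "\<bar>y - x\<bar> < r" "\<bar>y - x\<bar> < r3" using y by (auto simp: R_def)
        have "\<bar>F y - f y\<bar> \<le> e / 2 * \<bar>y - x\<bar>"
        proof (cases "y \<in> cover P")
          case True
          then obtain u v where uv: "(u,v) \<in> P" "y \<in> {u..v}" using covE by blast
          have "\<bar>F y - F u\<bar> \<le> c * (y - u)" using Flip[OF uv, of u] uv PD(1)[OF uv(1)] by auto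
          moreover have "\<bar>f y - f u\<bar> \<le> c * (y - u)" 
            using f[of y u] uv(2) PD(1)[OF uv(1)] subsetD[OF PD(2)[OF uv(1)]] by auto
          ultimately have "\<bar>F y - f y\<bar> \<le> 2 * (c * (y - u))" using Fu[OF uv(1)] by linarith
          also have "c * (y - u) \<le> c * (v - u)" using uv c by (intro mult_left_mono) auto
          also have "v - u \<le> e' * \<bar>y - x\<bar>"
          proof -
            consider "x < u" | "v < x" using False uv by force
            then show ?thesis
            proof cases
              case 1
              then have "v - u \<le> e' * (u - x)" using r(2)[OF uv(1)] uv yr by auto
              also have "\<dots> \<le> e' * \<bar>y - x\<bar>" using uv e' 1 by (intro mult_left_mono) auto
              finally show ?thesis .
            next
              case 2
              then have "v - u \<le> e' * (x - v)" using r(3)[OF uv(1)] uv yr by auto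
              also have "\<dots> \<le> e' * \<bar>y - x\<bar>" using uv e' 2 by (intro mult_left_mono) auto
              finally show ?thesis .
            qed
          qed
          finally have "\<bar>F y - f y\<bar> \<le> 2 * (c * (e' * \<bar>y - x\<bar>))" using c by (simp add: mult_left_mono)
          also have "\<dots> = 2 * c * e' * \<bar>y - x\<bar>" by simp
          also have "\<dots> \<le> e / 2 * \<bar>y - x\<bar>" using ce' by (intro mult_right_mono) auto
          finally show ?thesis .
        qed (use Ff e in auto)
        then show ?thesis using r3(2)[OF y(1) yr(2)] flat(1) by linarith
      qed
      then show ?thesis using r(1) r3(1) r1(1) r2(1) by (intro exI[of _ R]) (auto simp: R_def)
    qed
  qed
  \<comment> \<open>Since p and q are uncovered, the bounds at p and q transfer to uncovered points
    x outside the piece, which are still farther from its tiles.\<close>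
  have memE: "\<exists>p q. (p,q) \<in> P \<and> (u,v) \<in> A (p,q) \<and> p < u \<and> u < v \<and> v < q \<and> p \<notin> cover (A (p,q)) \<and> q \<notin> cover (A (p,q))"
    if uv: "(u,v) \<in> (\<Union>J\<in>P. A J)" for u v
  proof -
    obtain p q where pq: "(p,q) \<in> P" "(u,v) \<in> A (p,q)" using uv by auto
    have "u < v" using fine_partitionD(1)[OF stageD(1)[OF st[OF pq(1)]], of u v] pq by auto
    moreover have "u \<in> cover (A (p,q))" "v \<in> cover (A (p,q))" 
      unfolding cover_iff using pq(2) \<open>u < v\<close> less_imp_le by blast+
    ultimately show ?thesis using stage_cover_interior[OF st[OF pq(1)]] pq by fastforce
  qed
  have "stage S E c \<delta> \<eta> F (\<Union>J\<in>P. A J) (\<Union>J\<in>P. B J)"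
  proof (rule stageI)
    have "fine_partition S (\<Union>J\<in>P. A J \<union> B J)"
      by (rule fine_partition_refine[OF P]) (use stageD(1)[OF st] in auto)
    then show "fine_partition S ((\<Union>J\<in>P. A J) \<union> (\<Union>J\<in>P. B J))" by (simp add: UN_Un_distrib)
    show "\<bar>F x - F y\<bar> \<le> c * \<bar>x - y\<bar>" if "x \<in> S" "y \<in> S" for x y
      using lip[OF that] lip[OF that(2,1)] by (cases "x \<le> y") (auto simp: abs_minus_commute)
    show "F y = F u" if uv: "(u,v) \<in> (\<Union>J\<in>P. B J)" "y \<in> {u..v}" for u v y
    proof -
      obtain p q where pq: "(p,q) \<in> P" "(u,v) \<in> B (p,q)" using uv by auto
      have sub: "{u..v} \<subseteq> {p..q}" using fine_partitionD(2)[OF stageD(1)[OF st[OF pq(1)]], of u v] pq by auto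
      have "y \<in> {p..q}" "u \<in> {p..q}" using sub uv by auto
      then show ?thesis using Fg[OF pq(1)] stageD(3)[OF st[OF pq(1)] pq(2) uv(2)] by simp
    qed
    show "\<exists>r>0. \<forall>y. \<bar>y - x\<bar> < r \<longrightarrow> (\<exists>(u,v)\<in>(\<Union>J\<in>P. A J). x \<in> {u..v} \<and> y \<in> {u..v})"
      if x: "x \<in> cover (\<Union>J\<in>P. A J)" for x
    proof -
      obtain p q where pq: "(p,q) \<in> P" "x \<in> cover (A (p,q))" using x by (auto simp: cover_UN)
      obtain r where r: "r > 0" "\<And>y. \<bar>y - x\<bar> < r \<Longrightarrow> (\<exists>(u,v)\<in>A (p,q). x \<in> {u..v} \<and> y \<in> {u..v})"
        using stageD(7)[OF st[OF pq(1)] pq(2)] by blast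
      then show ?thesis using pq(1) by (intro exI[of _ r]) blast
    qed
    fix u v assume uv: "(u,v) \<in> (\<Union>J\<in>P. A J)"
    obtain p q where pq: "(p,q) \<in> P" "(u,v) \<in> A (p,q)" "p < u" "u < v" "v < q"
      "p \<notin> cover (A (p,q))" "q \<notin> cover (A (p,q))" using memE[OF uv] by blast
    note S = stageD[OF st[OF pq(1)]]
    show "\<bar>F v - F u\<bar> = c * (v - u)" using S(4)[OF pq(2)] Fg[OF pq(1), of u] Fg[OF pq(1), of v] pq by simp
    show "measure lebesgue ({u..v} - E) \<le> \<delta> * (v - u)" "v - u \<le> \<eta>" using S(5,6)[OF pq(2)] .
    fix x assume x: "x \<notin> cover (\<Union>J\<in>P. A J)"
    have x': "x \<notin> cover (A (p,q))" using x pq(1) by (auto simp: cover_UN)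
    show "v - u \<le> \<eta> * (u - x)" if "x < u"
    proof (cases "p \<le> x")
      case True
      then show ?thesis using S(9)[OF _ x' pq(2) that] that pq by simp
    next
      case False
      have "v - u \<le> \<eta> * (u - p)" using S(9)[OF _ pq(6,2,3)] pq by simp
      also have "\<dots> \<le> \<eta> * (u - x)" using False \<eta> by (intro mult_left_mono) auto
      finally show ?thesis .
    qed
    show "v - u \<le> \<eta> * (x - v)" if "v < x"
    proof (cases "x \<le> q")
      case True
      then show ?thesis using S(10)[OF _ x' pq(2) that] that pq by simp
    next
      case False
      have "v - u \<le> \<eta> * (q - v)" using S(10)[OF _ pq(7,2,5)] pq by simp
      also have "\<dots> \<le> \<eta> * (x - v)" using False \<eta> by (intro mult_left_mono) auto
      finally show ?thesis .
    qed
  qed (use deriv in blast)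
  then show thesis using that Fg Ff by blast
qed

section \<open>Refining one interval\<close>

lemma cover_Un: "cover (P \<union> Q) = cover P \<union> cover Q"
  by (auto simp: cover_def)

lemma cover_lmeasurable: "finite P \<Longrightarrow> cover P \<in> lmeasurable"
  unfolding cover_def by (rule fmeasurable.finite_UN) auto

lemma closed_cover: "finite P \<Longrightarrow> closed (cover P)"
  unfolding cover_def by (rule closed_UN) auto

text \<open>The union of the finitely many pieces that avoid x is closed, so it misses a
  neighbourhood of x.\<close>

lemma finite_local_cover:
  assumes "finite P" "S \<subseteq> cover P"
  shows "\<exists>r>0. \<forall>y\<in>S. \<bar>y - x\<bar> < r \<longrightarrow> (\<exists>(u,v)\<in>P. x \<in> {u..v} \<and> y \<in> {u..v})"
proof -
  define Z where "Z = cover {(u,v)\<in>P. x \<notin> {u..v}}"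
  have "closed Z" unfolding Z_def
    by (rule closed_cover) (rule finite_subset[OF _ assms(1)], auto)
  moreover have "x \<notin> Z" by (auto simp: Z_def cover_iff)
  ultimately obtain r where r: "r > 0" "\<And>y. dist y x < r \<Longrightarrow> y \<notin> Z"
    by (metis ComplD ComplI open_Compl open_dist)
  have "\<exists>(u,v)\<in>P. x \<in> {u..v} \<and> y \<in> {u..v}" if y: "y \<in> S" "\<bar>y - x\<bar> < r" for y
  proof -
    obtain u v where uv: "(u,v) \<in> P" "u \<le> y" "y \<le> v" using y assms(2) by (meson cover_iff subsetD)
    have "y \<notin> Z" using r(2) y by (simp add: dist_real_def)
    then have "x \<in> {u..v}" using uv unfolding Z_def cover_iff by blast
    then show ?thesis using uv by (intro bexI[OF _ uv(1)]) auto
  qed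
  then show ?thesis using r(1) by blast
qed

text \<open>
  Only intervals with both endpoints in \<open>C\<close> (which will consist of density points of \<open>E\<close>) become active.
\<close>

definition blocks :: "real \<Rightarrow> real \<Rightarrow> real set \<Rightarrow> real \<Rightarrow> (real \<times> real) set \<Rightarrow> (real \<times> real) set \<Rightarrow> bool" where
  "blocks p q C h W B \<longleftrightarrow>
     finite W \<and> finite B \<and>
     (\<forall>(u,v)\<in>W \<union> B. u < v \<and> {u..v} \<subseteq> {p..q}) \<and>
     (\<forall>(u,v)\<in>W \<union> B. \<forall>(u',v')\<in>W \<union> B. (u,v) \<noteq> (u',v') \<longrightarrow> v \<le> u' \<or> v' \<le> u) \<and>
     {p..q} \<subseteq> cover (W \<union> B) \<and>
     (\<forall>(a,b)\<in>W. a \<in> C \<and> b \<in> C \<and> b - a \<le> h) \<and> finite (C \<inter> {p..q} - cover W)"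

text \<open>The block is spanned by the least and the greatest point of C in the interval, which
  exist by compactness; the flanks are inactive. A lone point of C spans nothing and is the reason
  for the finite leftover in \<open>blocks\<close>.\<close>

lemma blocks_single:
  assumes C: "compact C" and pq: "p < q" "q - p \<le> h"
  shows "\<exists>W B. blocks p q C h W B"
proof -
  define D where "D = C \<inter> {p..q}"
  have D: "compact D" unfolding D_def using C by (intro compact_Int) auto
  show ?thesis
  proof (cases "\<exists>x\<in>D. \<exists>y\<in>D. x \<noteq> y")
    case False
    have "finite D"
    proof (cases "D = {}")
      case nonempty: False
      then obtain x where "x \<in> D" by blast
      then have "D \<subseteq> {x}" using False by blast
      then show ?thesis by (rule finite_subset) simp
    qed simp
    then show ?thesis using pq by (intro exI[of _ "{}"] exI[of _ "{(p,q)}"]) (auto simp: blocks_def cover_iff D_def)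
  next
    case True
    then have ne: "D \<noteq> {}" by blast
    define a b where "a = Inf D" and "b = Sup D"
    have bdd: "bdd_below D" "bdd_above D" 
      using D by (auto intro!: bounded_imp_bdd_below bounded_imp_bdd_above compact_imp_bounded)
    have mem: "a \<in> D" "b \<in> D"
      unfolding a_def b_def using closed_contains_Inf[OF ne bdd(1)] closed_contains_Sup[OF ne bdd(2)] D compact_imp_closed by blast+
    have bds: "a \<le> x" "x \<le> b" if "x \<in> D" for x
      unfolding a_def b_def using cInf_lower[OF that bdd(1)] cSup_upper[OF that bdd(2)] .
    have "a < b"
    proof -
      obtain x y where "x \<in> D" "y \<in> D" "x < y" using True by (metis linorder_neqE_linordered_idom)
      then show ?thesis using bds(1)[of x] bds(2)[of y] by linarith
    qed
    have ab: "p \<le> a" "b \<le> q" "a \<in> C" "b \<in> C" using mem by (auto simp: D_def)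
    define B where "B = (if p < a then {(p,a)} else {}) \<union> (if b < q then {(b,q)} else {})"
    have "finite (C \<inter> {p..q} - cover {(a,b)})"
      using bds by (auto simp: cover_iff D_def intro!: finite_subset[of _ "{}"])
    moreover have "{p..q} \<subseteq> cover ({(a,b)} \<union> B)" using ab by (auto simp: cover_Un B_def) (auto simp: cover_def)
    ultimately have "blocks p q C h {(a,b)} B" unfolding blocks_def
      using \<open>a < b\<close> ab pq by (auto simp: B_def)
    then show ?thesis by blast
  qed
qed

lemma blocksD:
  assumes "blocks p q C h W B"
  shows "finite W" "finite B"
    "\<And>u v. (u,v) \<in> W \<union> B \<Longrightarrow> u < v" "\<And>u v. (u,v) \<in> W \<union> B \<Longrightarrow> p \<le> u" "\<And>u v. (u,v) \<in> W \<union> B \<Longrightarrow> v \<le> q"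
    "\<And>u v u' v'. (u,v) \<in> W \<union> B \<Longrightarrow> (u',v') \<in> W \<union> B \<Longrightarrow> (u,v) \<noteq> (u',v') \<Longrightarrow> v \<le> u' \<or> v' \<le> u"
    "{p..q} \<subseteq> cover (W \<union> B)"
    "\<And>a b. (a,b) \<in> W \<Longrightarrow> a \<in> C" "\<And>a b. (a,b) \<in> W \<Longrightarrow> b \<in> C" "\<And>a b. (a,b) \<in> W \<Longrightarrow> b - a \<le> h"
    "finite (C \<inter> {p..q} - cover W)"
proof -
  show lt: "u < v" if "(u,v) \<in> W \<union> B" for u v using assms that unfolding blocks_def by blast
  have sub: "{u..v} \<subseteq> {p..q}" if "(u,v) \<in> W \<union> B" for u v using assms that unfolding blocks_def by blast
  show "p \<le> u" "v \<le> q" if "(u,v) \<in> W \<union> B" for u v using sub[OF that] lt[OF that] by auto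
qed (use assms in \<open>unfold blocks_def, blast+\<close>)

lemma blocks_join:
  assumes 1: "blocks p m C h W B" and 2: "blocks m q C h W' B'" and pmq: "p \<le> m" "m \<le> q"
  shows "blocks p q C h (W \<union> W') (B \<union> B')"
proof -
  note D1 = blocksD[OF 1] and D2 = blocksD[OF 2]
  have s: "((u,v) \<in> W \<union> B \<and> p \<le> u \<and> u < v \<and> v \<le> m) \<or> ((u,v) \<in> W' \<union> B' \<and> m \<le> u \<and> u < v \<and> v \<le> q)"
    if "(u,v) \<in> (W \<union> W') \<union> (B \<union> B')" for u v
    using that D1(3-5)[of u v] D2(3-5)[of u v] by blast
  have q1: "v \<le> u' \<or> v' \<le> u"
    if "(u,v) \<in> (W \<union> W') \<union> (B \<union> B')" "(u',v') \<in> (W \<union> W') \<union> (B \<union> B')" "(u,v) \<noteq> (u',v')" for u v u' v'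
    using s[OF that(1)] s[OF that(2)] D1(6)[of u v u' v'] D2(6)[of u v u' v'] that(3) by linarith
  have q2: "u < v \<and> {u..v} \<subseteq> {p..q}" if "(u,v) \<in> (W \<union> W') \<union> (B \<union> B')" for u v
    using s[OF that] pmq by auto
  have q3: "{p..q} \<subseteq> cover ((W \<union> W') \<union> (B \<union> B'))"
  proof -
    have "{p..q} \<subseteq> {p..m} \<union> {m..q}" by auto
    then show ?thesis using D1(7) D2(7) by (auto simp: cover_Un)
  qed
  have q4: "finite (C \<inter> {p..q} - cover (W \<union> W'))"
    by (rule finite_subset[OF _ finite_UnI[OF D1(11) D2(11)]]) (auto simp: cover_Un)
  have q5: "a \<in> C \<and> b \<in> C \<and> b - a \<le> h" if "(a,b) \<in> W \<union> W'" for a b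
    using that D1(8-10)[of a b] D2(8-10)[of a b] by blast
  show ?thesis unfolding blocks_def
  proof (intro conjI)
    show "\<forall>(u,v)\<in>W \<union> W' \<union> (B \<union> B'). u < v \<and> {u..v} \<subseteq> {p..q}" using q2 by blast
    show "\<forall>(u,v)\<in>W \<union> W' \<union> (B \<union> B'). \<forall>(u',v')\<in>W \<union> W' \<union> (B \<union> B'). (u,v) \<noteq> (u',v') \<longrightarrow> v \<le> u' \<or> v' \<le> u"
      using q1 by fast
    show "\<forall>(a,b)\<in>W \<union> W'. a \<in> C \<and> b \<in> C \<and> b - a \<le> h" using q5 by blast
  qed (use D1(1,2) D2(1,2) q3 q4 in auto)
qed

lemma blocks_exists:
  assumes C: "compact C" and "p < q" "h > 0"
  shows "\<exists>W B. blocks p q C h W B"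
proof -
  have "\<exists>W B. blocks p q C h W B" if "p < q" "q - p \<le> real n * h" for n p
    using that
  proof (induction n arbitrary: p q)
    case (Suc n)
    show ?case
    proof (cases "q - p \<le> h")
      case False
      define m where "m = q - h"
      have "p < m" "m - p \<le> real n * h" "m < q" "q - m \<le> h"
        using False Suc.prems \<open>h > 0\<close> by (auto simp: m_def algebra_simps)
      then show ?thesis using Suc.IH[of p m] blocks_single[OF C, of m q h] blocks_join[of p m C h _ _ q] by (meson less_imp_le)
    qed (use blocks_single[OF C Suc.prems(1)] in blast)
  qed auto
  moreover obtain n :: nat where "(q - p) / h < n" using reals_Archimedean2 by blast
  ultimately show ?thesis using assms by (simp add: field_simps) (meson less_imp_le)
qed

lemma stage_const:
  assumes "p < q" "c \<ge> 0"
  shows "stage {p..q} E c \<delta> \<eta> (\<lambda>_. \<alpha>) {} {(p,q)}"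
proof (rule stageI)
  show "fine_partition {p..q} ({} \<union> {(p,q)})"
    by (rule fine_partition_finite) (use assms in auto)
qed (use assms in \<open>auto simp: cover_def intro: exI[of _ 1]\<close>)

text \<open>Closed blocks may share endpoints, so lengths are added over the disjoint open blocks
  instead.\<close>

lemma blocks_measure:
  fixes E :: "real set"
  assumes bl: "blocks p q C h W B" and pq: "p \<le> q" and E: "E \<in> sets lebesgue" and \<theta>: "\<theta> \<ge> 0"
    and K: "\<And>a b. (a,b) \<in> W \<Longrightarrow> measure lebesgue ({a..b} - E) \<le> \<theta> * (b - a)"
  shows "measure lebesgue (cover W - E) \<le> \<theta> * (q - p)"
proof -
  note D = blocksD[OF bl]
  have "cover W - E = (\<Union>J\<in>W. {fst J..snd J} - E)" by (auto simp: cover_def)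
  moreover have "{u..v} - E \<in> sets lebesgue" for u v using E by (intro sets.Diff) auto
  ultimately have "measure lebesgue (cover W - E) \<le> (\<Sum>J\<in>W. measure lebesgue ({fst J..snd J} - E))"
    using measure_UNION_le[OF D(1), of "\<lambda>J. {fst J..snd J} - E" lebesgue] by presburger
  also have "\<dots> \<le> (\<Sum>J\<in>W. \<theta> * measure lebesgue {fst J<..<snd J})"
  proof (rule sum_mono)
    fix J assume J: "J \<in> W"
    then show "measure lebesgue ({fst J..snd J} - E) \<le> \<theta> * measure lebesgue {fst J<..<snd J}"
      using K[of "fst J" "snd J"] D(3)[of "fst J" "snd J"] by simp
  qed
  also have "\<dots> = \<theta> * (\<Sum>J\<in>W. measure lebesgue {fst J<..<snd J})" by (simp add: sum_distrib_left)
  also have "(\<Sum>J\<in>W. measure lebesgue {fst J<..<snd J}) = measure lebesgue (\<Union>J\<in>W. {fst J<..<snd J})"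
  proof (rule measure_UNION'[symmetric])
    show "pairwise (\<lambda>i j. disjnt {fst i<..<snd i} {fst j<..<snd j}) W"
    proof (rule pairwiseI)
      fix i j assume "i \<in> W" "j \<in> W" "i \<noteq> j"
      then have "snd i \<le> fst j \<or> snd j \<le> fst i" using D(6)[of "fst i" "snd i" "fst j" "snd j"] by simp
      then show "disjnt {fst i<..<snd i} {fst j<..<snd j}" by (auto simp: disjnt_def)
    qed
  qed (use D in auto)
  also have "\<dots> \<le> measure lebesgue {p..q}"
  proof (rule measure_mono_fmeasurable)
    show "(\<Union>J\<in>W. {fst J<..<snd J}) \<subseteq> {p..q}"
    proof
      fix y assume "y \<in> (\<Union>J\<in>W. {fst J<..<snd J})"
      then obtain J where J: "J \<in> W" "fst J < y" "y < snd J" by auto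
      then show "y \<in> {p..q}" using D(4)[of "fst J" "snd J"] D(5)[of "fst J" "snd J"] by auto
    qed
  qed (use D(1) in auto)
  also have "\<dots> = q - p" using pq by simp
  finally show ?thesis using \<theta> by (simp add: mult_left_mono)
qed

text \<open>Used with s = c or s = -c on an active piece, where E must be dense enough for its
  blocks to carry the rise, and with s = 0 on an inactive one, where E is arbitrary and the new
  zigzag merely captures the part of E in it. The two height estimates bound the disturbance in the
  second case.\<close>

lemma stage_refine_interval:
  fixes E :: "real set"
  assumes E: "E \<in> sets lebesgue" and pq: "p < q" and c: "0 < c" "c < c'" "c' \<le> 1"
    and s: "\<bar>s\<bar> \<le> c" and dens: "s \<noteq> 0 \<Longrightarrow> measure lebesgue ({p..q} - E) \<le> (1 - c / c') / 4 * (q - p)"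
    and \<delta>: "\<delta> > 0" and \<eta>: "0 < \<eta>" "\<eta> \<le> 1" and \<epsilon>: "\<epsilon> > 0"
  obtains g A B where "stage {p..q} E c' \<delta> \<eta> g A B" "g p = \<alpha>" "g q = \<alpha> + s * (q - p)"
    "\<And>x y. s = 0 \<Longrightarrow> x \<in> {p..q} \<Longrightarrow> x \<notin> cover A \<Longrightarrow> y \<in> {p..q} \<Longrightarrow> \<bar>g y - \<alpha>\<bar> \<le> \<eta> * \<bar>y - x\<bar>"
    "\<And>y. s = 0 \<Longrightarrow> y \<in> {p..q} \<Longrightarrow> \<bar>g y - \<alpha>\<bar> \<le> \<eta>"
    "measure lebesgue ({p..q} \<inter> ((E - cover A) \<union> (cover A - E))) \<le> \<epsilon>"
proof -
  \<comment> \<open>At most the fraction d0 of the interval lies outside E, and another d0 is lost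
    by passing from E to C. The blocks thus carry the slope \<open>c0 = c / (1 - 2 * d0)\<close>,
    and this choice of d0 makes c0 the harmonic mean of c and c', below c'.\<close>
  define d0 where "d0 = (1 - c / c') / 4"
  have d0: "0 < d0" using c by (simp add: d0_def)
  define c0 where "c0 = c / (1 - 2 * d0)"
  have d0': "1 - 2 * d0 = (c' + c) / (2 * c')" using c by (simp add: d0_def field_simps)
  have c0: "0 \<le> c0" "c0 < c'" "c0 * (1 - 2 * d0) = c"
  proof -
    show "0 \<le> c0" unfolding c0_def d0' using c by simp
    have "2 * c * c' < c' * (c' + c)" using c by (simp add: algebra_simps)
    then show "c0 < c'" unfolding c0_def d0' using c by (simp add: field_simps)
    show "c0 * (1 - 2 * d0) = c" unfolding c0_def d0' using c by simp
  qed
  define \<theta>b where "\<theta>b = \<delta> * ((c' - c0) / (4 * c')) * \<eta> / 2"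
  have \<theta>b: "\<theta>b > 0" using \<delta> \<eta> c c0 by (simp add: \<theta>b_def)
  \<comment> \<open>The first bound is what \<open>stage_block\<close> requires; the second limits
    the excess of the blocks over E to half of \<epsilon>.\<close>
  define \<theta> where "\<theta> = min \<theta>b (\<epsilon> / (2 * (q - p)))"
  have \<theta>: "\<theta> > 0" "\<theta> \<le> \<theta>b" "\<theta> * (q - p) \<le> \<epsilon> / 2"
  proof -
    show "\<theta> > 0" "\<theta> \<le> \<theta>b" using \<theta>b \<epsilon> pq by (auto simp: \<theta>_def)
    have "\<theta> \<le> \<epsilon> / (2 * (q - p))" by (simp add: \<theta>_def)
    then show "\<theta> * (q - p) \<le> \<epsilon> / 2" using pq by (simp add: field_simps)
  qed
  \<comment> \<open>The other half of \<epsilon> is for the part of E missed by C; the second bound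
    protects the slope.\<close>
  define \<epsilon>1 where "\<epsilon>1 = min (\<epsilon> / 2) (d0 * (q - p))"
  have \<epsilon>1: "\<epsilon>1 > 0" "\<epsilon>1 \<le> \<epsilon> / 2" "\<epsilon>1 \<le> d0 * (q - p)" using \<epsilon> d0 pq by (auto simp: \<epsilon>1_def)
  obtain C r where C: "compact C" "C \<subseteq> E \<inter> {p..q}" "r > 0"
    "\<And>x t. x \<in> C \<Longrightarrow> 0 < t \<Longrightarrow> t \<le> r \<Longrightarrow> measure lebesgue ({x-t..x+t} - E) \<le> \<theta> * t"
    "\<And>x e. x \<in> C \<Longrightarrow> 0 < e \<Longrightarrow> \<exists>r>0. \<forall>t. 0 < t \<and> t \<le> r \<longrightarrow> measure lebesgue ({x-t..x+t} - E) \<le> e * t"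
    "measure lebesgue (E \<inter> {p..q} - C) \<le> \<epsilon>1"
    using uniform_density_compact[OF E \<theta>(1) \<epsilon>1(1), of p q] by blast
  have lm: "{u..v} - E \<in> lmeasurable" for u v using E by (simp add: fmeasurable_Diff)
  have right: "measure lebesgue ({x..x+t} - E) \<le> measure lebesgue ({x-t..x+t} - E)"
    and left: "measure lebesgue ({x-t..x} - E) \<le> measure lebesgue ({x-t..x+t} - E)" if "0 < t" for x t
    using that by (auto intro!: measure_mono_fmeasurable lm fmeasurableD)
  \<comment> \<open>Blocks no longer than r have the density bounds at their full length;
    \<open>stage_block\<close> wants length at most 1.\<close>
  define h where "h = min r 1"
  have h: "h > 0" "h \<le> r" "h \<le> 1" using C(3) by (auto simp: h_def)
  obtain W B where bl: "blocks p q C h W B" using blocks_exists[OF C(1) pq h(1)] by blast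
  note D = blocksD[OF bl]
  have fp: "fine_partition {p..q} (W \<union> B)"
    by (rule fine_partition_finite) (use D(1-7) in \<open>auto simp: cover_def\<close>)
  have mW: "cover W \<in> lmeasurable" by (rule cover_lmeasurable[OF D(1)])
  have Wpq: "cover W \<subseteq> {p..q}"
  proof
    fix y assume "y \<in> cover W"
    then obtain u v where uv: "(u,v) \<in> W" "u \<le> y" "y \<le> v" by (auto simp: cover_iff)
    then show "y \<in> {p..q}" using D(4,5)[of u v] by auto
  qed
  have mWE: "measure lebesgue (cover W - E) \<le> \<theta> * (q - p)"
  proof (rule blocks_measure[OF bl _ E])
    fix a b assume ab: "(a,b) \<in> W"
    have "0 < b - a" "b - a \<le> r" using D(3)[of a b] D(10)[OF ab] ab h by auto
    then have "measure lebesgue ({a..a+(b-a)} - E) \<le> \<theta> * (b - a)"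
      using right[of "b - a" a] C(4)[OF D(8)[OF ab], of "b - a"] by linarith
    then show "measure lebesgue ({a..b} - E) \<le> \<theta> * (b - a)" by simp
  qed (use pq \<theta> in auto)
  define m where "m = measure lebesgue (cover W)"
  \<comment> \<open>m may vanish when s = 0, but then the numerator is 0 and so is \<rho>.\<close>
  define \<rho> where "\<rho> = s * (q - p) / m"
  \<comment> \<open>The interval is exhausted by its part outside E, the part of E outside C, the
    blocks, and a finite remainder.\<close>
  have m_pos: "(1 - 2 * d0) * (q - p) \<le> m" if "s \<noteq> 0"
  proof -
    have Epq: "E \<inter> {p..q} \<in> lmeasurable"
      using fmeasurable_Int_fmeasurable[OF lmeasurable_interval(1)[of p q] E] by (simp add: Int_commute)
    have F0: "C \<inter> {p..q} - cover W \<in> null_sets lebesgue"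
      using D(11) by (simp add: negligible_finite flip: negligible_iff_null_sets)
    have EC: "E \<inter> {p..q} - C \<in> lmeasurable" using Epq C(1) by (auto intro!: fmeasurable_Diff simp: compact_imp_closed)
    have "q - p = measure lebesgue (({p..q} - E) \<union> (E \<inter> {p..q}))"
    proof -
      have "({p..q} - E) \<union> (E \<inter> {p..q}) = {p..q}" by auto
      then show ?thesis using pq by simp
    qed
    also have "\<dots> \<le> measure lebesgue ({p..q} - E) + measure lebesgue (E \<inter> {p..q})"
      by (rule measure_Un_le) (use lm Epq in \<open>auto simp: fmeasurableD\<close>)
    also have "measure lebesgue (E \<inter> {p..q}) \<le> measure lebesgue ((cover W \<union> (E \<inter> {p..q} - C)) \<union> (C \<inter> {p..q} - cover W))"
    proof (rule measure_mono_fmeasurable)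
      show "(cover W \<union> (E \<inter> {p..q} - C)) \<union> (C \<inter> {p..q} - cover W) \<in> lmeasurable"
        by (intro fmeasurable.Un mW EC fmeasurableI_null_sets[OF F0])
    qed (use Epq in \<open>auto simp: fmeasurableD\<close>)
    also have "\<dots> = measure lebesgue (cover W \<union> (E \<inter> {p..q} - C))"
      by (rule measure_Un_null_set[OF _ F0]) (intro sets.Un fmeasurableD mW EC)
    also have "\<dots> \<le> m + measure lebesgue (E \<inter> {p..q} - C)"
      unfolding m_def by (rule measure_Un_le) (intro fmeasurableD mW EC)+
    finally have "q - p \<le> d0 * (q - p) + (m + d0 * (q - p))"
      using dens[OF that] C(6) \<epsilon>1(3) unfolding d0_def by linarith
    then show ?thesis by (simp add: algebra_simps)
  qed
  have \<rho>m: "\<rho> * m = s * (q - p)"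
  proof (cases "s = 0")
    case False
    have "0 < (1 - 2 * d0) * (q - p)" using pq c unfolding d0' by simp
    then show ?thesis using m_pos[OF False] by (simp add: \<rho>_def)
  qed (simp add: \<rho>_def)
  have \<rho>: "\<bar>\<rho>\<bar> \<le> c0"
  proof (cases "s = 0")
    case True
    then show ?thesis using c0 by (simp add: \<rho>_def)
  next
    case False
    have p0: "0 < (1 - 2 * d0) * (q - p)" using pq c unfolding d0' by simp
    have "\<bar>\<rho> * m\<bar> = \<bar>s * (q - p)\<bar>" by (simp add: \<rho>m)
    then have "\<bar>\<rho>\<bar> * m = \<bar>s\<bar> * (q - p)" using m_pos[OF False] p0 pq by (simp add: abs_mult)
    also have "\<dots> \<le> c * (q - p)" using s pq by simp
    also have "\<dots> = c0 * ((1 - 2 * d0) * (q - p))" using c0(3) by (simp add: mult.assoc[symmetric])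
    also have "\<dots> \<le> c0 * m" using m_pos[OF False] c0 by (intro mult_left_mono) auto
    finally show ?thesis using m_pos[OF False] p0 by simp
  qed
  define M where "M y = measure lebesgue (cover W \<inter> {p..y})" for y
  have Mlm: "cover W \<inter> {p..y} \<in> lmeasurable" for y using mW by (auto intro: fmeasurable_Int_fmeasurable)
  \<comment> \<open>The rise over \<open>{p..q}\<close> is carried by the blocks alone, at the slightly larger slope \<open>\<rho>\<close>.\<close>
  define h0 where "h0 y = \<alpha> + \<rho> * M y" for y
  have M_mono: "M x \<le> M y" and M_lip: "M y \<le> M x + (y - x)" if "x \<le> y" for x y
  proof -
    show "M x \<le> M y" unfolding M_def using that Mlm
      by (intro measure_mono_fmeasurable) (auto simp: fmeasurableD)
    have "M y \<le> measure lebesgue ((cover W \<inter> {p..x}) \<union> {x..y})" unfolding M_def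
      by (rule measure_mono_fmeasurable) (use Mlm in \<open>auto simp: fmeasurableD intro!: fmeasurable.Un\<close>)
    also have "\<dots> \<le> M x + measure lebesgue {x..y}" unfolding M_def
      by (rule measure_Un_le) (use Mlm in \<open>auto simp: fmeasurableD\<close>)
    finally show "M y \<le> M x + (y - x)" using that by simp
  qed
  have h0_lip: "\<bar>h0 x - h0 y\<bar> \<le> c' * \<bar>x - y\<bar>" for x y
  proof -
    have "\<bar>M x - M y\<bar> \<le> \<bar>x - y\<bar>" using M_mono[of x y] M_mono[of y x] M_lip[of x y] M_lip[of y x] by linarith
    then have "\<bar>\<rho>\<bar> * \<bar>M x - M y\<bar> \<le> c' * \<bar>x - y\<bar>" using \<rho> c0 by (intro mult_mono) auto
    moreover have "h0 x - h0 y = \<rho> * (M x - M y)" by (simp add: h0_def algebra_simps)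
    ultimately show ?thesis by (simp add: abs_mult)
  qed
  have h0_p: "h0 p = \<alpha>"
  proof -
    have "negligible (cover W \<inter> {p..p})" by (rule negligible_subset[of "{p}"]) auto
    then have "M p = 0" unfolding M_def by (rule negligible_imp_measure0)
    then show ?thesis by (simp add: h0_def)
  qed
  have h0_q: "h0 q = \<alpha> + s * (q - p)"
    using Wpq \<rho>m by (simp add: h0_def M_def m_def Int_absorb2)
  have h0_W: "h0 b = h0 a + \<rho> * (b - a)" if ab: "(a,b) \<in> W" for a b
  proof -
    have ab': "a < b" "p \<le> a" using D(3,4)[of a b] ab by auto
    have "cover W \<inter> {p..b} = (cover W \<inter> {p..a}) \<union> {a<..b}"
    proof -
      have "{a..b} \<subseteq> cover W" using ab unfolding cover_def by blast
      then show ?thesis using ab' by auto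
    qed
    then have "M b = measure lebesgue ((cover W \<inter> {p..a}) \<union> {a<..b})" by (simp add: M_def)
    also have "\<dots> = M a + measure lebesgue ({a<..b} - cover W \<inter> {p..a})" unfolding M_def
      by (rule measure_Un2[OF Mlm]) (rule bounded_set_imp_lmeasurable, auto)
    also have "{a<..b} - cover W \<inter> {p..a} = {a<..b}" by auto
    finally have "M b = M a + (b - a)" using ab' by simp
    then show ?thesis unfolding h0_def by (simp add: distrib_left)
  qed
  have h0_B: "h0 v = h0 u" if uv: "(u,v) \<in> W \<union> B" "(u,v) \<notin> W" for u v
  proof -
    have uv': "u < v" "p \<le> u" using D(3,4)[OF uv(1)] by auto
    have "cover W \<inter> {p..v} \<subseteq> (cover W \<inter> {p..u}) \<union> {v}"
    proof
      fix y assume y: "y \<in> cover W \<inter> {p..v}"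
      then obtain a b where ab: "(a,b) \<in> W" "a \<le> y" "y \<le> b" by (auto simp: cover_iff)
      then have "b \<le> u \<or> v \<le> a" using D(6)[of a b u v] uv by auto
      then show "y \<in> (cover W \<inter> {p..u}) \<union> {v}" using y ab by auto
    qed
    then have "M v \<le> measure lebesgue ((cover W \<inter> {p..u}) \<union> {v})" unfolding M_def
      by (intro measure_mono_fmeasurable fmeasurable.Un Mlm fmeasurableD[OF Mlm] fmeasurableI_null_sets[of "{v}"])
        (auto simp flip: negligible_iff_null_sets)
    also have "\<dots> \<le> M u + measure lebesgue {v}" unfolding M_def
      by (rule measure_Un_le) (use Mlm in \<open>auto simp: fmeasurableD\<close>)
    finally have "M v = M u" using M_mono[of u v] uv' by simp
    then show ?thesis by (simp add: h0_def)
  qed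
  \<comment> \<open>The data chosen on one piece. For s = 0 the height is bounded by the distance to
    either end, because the reference point x of the later estimate may lie on either side.\<close>
  define Q where "Q J X \<longleftrightarrow> (case (J, X) of ((u,v),(g,A,B)) \<Rightarrow>
      stage {u..v} E c' \<delta> \<eta> g A B \<and> g u = h0 u \<and> g v = h0 v \<and>
      cover A = (if (u,v) \<in> W then {u<..<v} else {}) \<and>
      (s = 0 \<longrightarrow> (\<forall>y\<in>{u..v}. \<bar>g y - \<alpha>\<bar> \<le> \<eta> * (y - u) \<and> \<bar>g y - \<alpha>\<bar> \<le> \<eta> * (v - y))) \<and>
      (s = 0 \<and> (u,v) \<notin> W \<longrightarrow> (\<forall>y\<in>{u..v}. g y = \<alpha>)))" for J X
  have ex: "\<exists>X. Q J X" if J: "J \<in> W \<union> B" for J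
  proof -
    obtain u v where [simp]: "J = (u,v)" by (cases J)
    have uv: "(u,v) \<in> W \<union> B" using J by simp
    have h0s: "h0 y = \<alpha>" if "s = 0" for y using that by (simp add: h0_def \<rho>_def)
    show ?thesis
    proof (cases "(u,v) \<in> W")
      case True
      note ab = D(8,9,10)[OF True] D(3)[OF uv]
      obtain g A where g: "stage {u..v} E c' \<delta> \<eta> g A {}" "cover A = {u<..<v}"
        "g u = h0 u" "g v = h0 u + \<rho> * (v - u)"
        "\<And>y. \<rho> = 0 \<Longrightarrow> y \<in> {u..v} \<Longrightarrow> \<bar>g y - h0 u\<bar> \<le> \<eta> * (y - u)"
        "\<And>y. \<rho> = 0 \<Longrightarrow> y \<in> {u..v} \<Longrightarrow> \<bar>g y - h0 u\<bar> \<le> \<eta> * (v - y)"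
      proof (rule stage_block[OF E _ _ c0(1,2) c(3) \<rho> \<delta> \<eta> \<theta>b_def])
        show "u < v" "v - u \<le> 1" using ab h by auto
        show "measure lebesgue ({u..u+t} - E) \<le> \<theta>b * t" "measure lebesgue ({v-t..v} - E) \<le> \<theta>b * t"
          if "0 < t" "t \<le> v - u" for t
        proof -
          have "\<theta> * t \<le> \<theta>b * t" using \<theta> that by (intro mult_right_mono) auto
          then show "measure lebesgue ({u..u+t} - E) \<le> \<theta>b * t" "measure lebesgue ({v-t..v} - E) \<le> \<theta>b * t"
            using C(4)[OF ab(1), of t] C(4)[OF ab(2), of t] right[of t u] left[of t v] that ab(3) h(2) by linarith+
        qed
        show "\<exists>r>0. \<forall>t. 0 < t \<and> t \<le> r \<longrightarrow> measure lebesgue ({u..u+t} - E) \<le> e * t" if e: "e > 0" for e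
        proof -
          obtain r where r: "r > 0" "\<And>t. 0 < t \<Longrightarrow> t \<le> r \<Longrightarrow> measure lebesgue ({u-t..u+t} - E) \<le> e * t"
            using C(5)[OF ab(1) e] by blast
          then show ?thesis using order_trans[OF right] by (intro exI[of _ r]) auto
        qed
        show "\<exists>r>0. \<forall>t. 0 < t \<and> t \<le> r \<longrightarrow> measure lebesgue ({v-t..v} - E) \<le> e * t" if e: "e > 0" for e
        proof -
          obtain r where r: "r > 0" "\<And>t. 0 < t \<Longrightarrow> t \<le> r \<Longrightarrow> measure lebesgue ({v-t..v+t} - E) \<le> e * t"
            using C(5)[OF ab(2) e] by blast
          then show ?thesis using order_trans[OF left] by (intro exI[of _ r]) auto
        qed
      qed blast
      have "Q J (g, A, {})" unfolding Q_def using g True h0_W[OF True] h0s by (auto simp: \<rho>_def)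
      then show ?thesis by blast
    next
      case False
      have "Q J (\<lambda>_. h0 u, {}, {(u,v)})" unfolding Q_def
        using stage_const[OF D(3)[OF uv], of c' E \<delta> \<eta> "h0 u"] False h0_B[OF uv False] h0s c \<eta> by (auto simp: cover_def)
      then show ?thesis by blast
    qed
  qed
  then obtain X where X: "\<And>J. J \<in> W \<union> B \<Longrightarrow> Q J (X J)" by metis
  define g A' B' where "g J = fst (X J)" and "A' J = fst (snd (X J))" and "B' J = snd (snd (X J))" for J
  have QX: "stage {u..v} E c' \<delta> \<eta> (g (u,v)) (A' (u,v)) (B' (u,v))" "g (u,v) u = h0 u" "g (u,v) v = h0 v"
      "cover (A' (u,v)) = (if (u,v) \<in> W then {u<..<v} else {})"
      "\<And>y. s = 0 \<Longrightarrow> y \<in> {u..v} \<Longrightarrow> \<bar>g (u,v) y - \<alpha>\<bar> \<le> \<eta> * (y - u)"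
      "\<And>y. s = 0 \<Longrightarrow> y \<in> {u..v} \<Longrightarrow> \<bar>g (u,v) y - \<alpha>\<bar> \<le> \<eta> * (v - y)"
      "\<And>y. s = 0 \<Longrightarrow> (u,v) \<notin> W \<Longrightarrow> y \<in> {u..v} \<Longrightarrow> g (u,v) y = \<alpha>"
    if "(u,v) \<in> W \<union> B" for u v
    using X[OF that] unfolding Q_def g_def A'_def B'_def by (auto simp: case_prod_beta)
  \<comment> \<open>With finitely many pieces the first alternative in \<open>stage_glue\<close>
    holds everywhere, so no flatness of \<open>h0\<close> is needed.\<close>
  have loc: "\<exists>r>0. \<forall>y\<in>{p..q}. \<bar>y - x\<bar> < r \<longrightarrow> (\<exists>(u,v)\<in>W \<union> B. x \<in> {u..v} \<and> y \<in> {u..v})" for x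
    by (rule finite_local_cover) (use D(1,2,7) in auto)
  obtain F where F: "stage {p..q} E c' \<delta> \<eta> F (\<Union>J\<in>W \<union> B. A' J) (\<Union>J\<in>W \<union> B. B' J)"
    "\<And>u v y. (u,v) \<in> W \<union> B \<Longrightarrow> y \<in> {u..v} \<Longrightarrow> F y = g (u,v) y" "\<And>y. y \<notin> cover (W \<union> B) \<Longrightarrow> F y = h0 y"
  proof (rule stage_glue[OF fp _ _ h0_lip _ QX(1,2,3)])
    show "0 \<le> c'" "0 \<le> \<eta>" using c \<eta> by auto
  qed (use loc in blast)+
  define A where "A = (\<Union>J\<in>W \<union> B. A' J)"
  have covA: "x \<in> cover A \<longleftrightarrow> (\<exists>u v. (u,v) \<in> W \<and> u < x \<and> x < v)" for x
  proof -
    have "x \<in> cover A \<longleftrightarrow> (\<exists>u v. (u,v) \<in> W \<union> B \<and> x \<in> cover (A' (u,v)))"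
      unfolding A_def cover_UN by auto
    also have "\<dots> \<longleftrightarrow> (\<exists>u v. (u,v) \<in> W \<and> u < x \<and> x < v)"
    proof (intro iff_exI)
      fix u v
      show "(u,v) \<in> W \<union> B \<and> x \<in> cover (A' (u,v)) \<longleftrightarrow> (u,v) \<in> W \<and> u < x \<and> x < v"
      proof (cases "(u,v) \<in> W \<union> B")
        case True
        then show ?thesis using QX(4)[OF True] by simp
      qed auto
    qed
    finally show ?thesis .
  qed
  have endF: "F p = h0 p" "F q = h0 q"
  proof -
    obtain u v where uv: "(u,v) \<in> W \<union> B" "u \<le> p" "p \<le> v" 
      using subsetD[OF D(7), of p] pq unfolding cover_iff by (metis atLeastAtMost_iff less_imp_le order_refl)
    then have "u = p" using D(4)[of u v] by auto
    then show "F p = h0 p" using F(2)[OF uv(1), of p] uv QX(2)[OF uv(1)] by simp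
    obtain u v where uv: "(u,v) \<in> W \<union> B" "u \<le> q" "q \<le> v" 
      using subsetD[OF D(7), of q] pq unfolding cover_iff by (metis atLeastAtMost_iff less_imp_le order_refl)
    then have "v = q" using D(5)[of u v] by auto
    then show "F q = h0 q" using F(2)[OF uv(1), of q] uv QX(3)[OF uv(1)] by simp
  qed
  show thesis
  proof (rule that[OF F(1)[folded A_def]])
    show "F p = \<alpha>" "F q = \<alpha> + s * (q - p)" using endF h0_p h0_q by auto
    show "\<bar>F y - \<alpha>\<bar> \<le> \<eta> * \<bar>y - x\<bar>" if s0: "s = 0" and x: "x \<in> {p..q}" "x \<notin> cover A" and y: "y \<in> {p..q}" for x y
    proof -
      obtain u v where uv: "(u,v) \<in> W \<union> B" "y \<in> {u..v}" using D(7) y cover_iff[of y "W \<union> B"] by auto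
      show ?thesis
      proof (cases "(u,v) \<in> W")
        case True
        \<comment> \<open>An uncovered x is in no open block, so on the way from y to x an end of
          the block of y is reached.\<close>
        then have "x \<le> u \<or> v \<le> x" using x covA by force
        then have "\<eta> * (y - u) \<le> \<eta> * \<bar>y - x\<bar> \<or> \<eta> * (v - y) \<le> \<eta> * \<bar>y - x\<bar>"
          using uv \<eta> by (auto intro!: mult_left_mono)
        then show ?thesis using QX(5,6)[OF uv(1) s0 uv(2)] F(2)[OF uv] by linarith
      next
        case False
        then show ?thesis using QX(7)[OF uv(1) s0 False uv(2)] F(2)[OF uv] \<eta> by simp
      qed
    qed
    show "\<bar>F y - \<alpha>\<bar> \<le> \<eta>" if s0: "s = 0" and y: "y \<in> {p..q}" for y
    proof -
      obtain u v where uv: "(u,v) \<in> W \<union> B" "y \<in> {u..v}" using D(7) y cover_iff[of y "W \<union> B"] by auto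
      show ?thesis
      proof (cases "(u,v) \<in> W")
        case True
        then have "\<eta> * (y - u) \<le> \<eta> * 1" using D(10)[OF True] h uv \<eta> by (intro mult_left_mono) auto
        then show ?thesis using QX(5)[OF uv(1) s0 uv(2)] F(2)[OF uv] by simp
      next
        case False
        then show ?thesis using QX(7)[OF uv(1) s0 False uv(2)] F(2)[OF uv] \<eta> by simp
      qed
    qed
    \<comment> \<open>Null set absorbing the leftover points of C and the block endpoints, which lie
      in \<open>cover W\<close> but may be missing from \<open>cover A\<close>.\<close>
    define Z where "Z = (C \<inter> {p..q} - cover W) \<union> (fst ` W \<union> snd ` W)"
    have Z: "Z \<in> null_sets lebesgue"
      using D(1,11) by (simp add: Z_def negligible_finite flip: negligible_iff_null_sets)
    have EC: "E \<inter> {p..q} - C \<in> lmeasurable"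
    proof -
      have "E \<inter> {p..q} \<in> lmeasurable"
        using fmeasurable_Int_fmeasurable[OF lmeasurable_interval(1)[of p q] E] by (simp add: Int_commute)
      then show ?thesis using C(1) by (auto intro!: fmeasurable_Diff simp: compact_imp_closed)
    qed
    have WE: "cover W - E \<in> lmeasurable" using mW E by (simp add: fmeasurable_Diff)
    have cA: "cover A = (\<Union>J\<in>W. {fst J<..<snd J})" using covA by force
    have mA: "cover A \<in> sets lebesgue" unfolding cA using D(1) by (intro sets.finite_UN) auto
    have "measure lebesgue ({p..q} \<inter> ((E - cover A) \<union> (cover A - E))) \<le> measure lebesgue (((E \<inter> {p..q} - C) \<union> (cover W - E)) \<union> Z)"
    proof (rule measure_mono_fmeasurable)
      show "{p..q} \<inter> ((E - cover A) \<union> (cover A - E)) \<subseteq> ((E \<inter> {p..q} - C) \<union> (cover W - E)) \<union> Z"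
      proof
        fix x assume x: "x \<in> {p..q} \<inter> ((E - cover A) \<union> (cover A - E))"
        show "x \<in> ((E \<inter> {p..q} - C) \<union> (cover W - E)) \<union> Z"
        proof (cases "x \<in> E")
          case True
          then have "x \<notin> cover A" using x by auto
          show ?thesis
          proof (cases "x \<in> cover W")
            case True
            then obtain u v where uv: "(u,v) \<in> W" "u \<le> x" "x \<le> v" by (auto simp: cover_iff)
            then have "x = u \<or> x = v" using \<open>x \<notin> cover A\<close> covA by force
            then show ?thesis using uv(1) unfolding Z_def by force
          qed (use x True in \<open>auto simp: Z_def\<close>)
        next
          case False
          then obtain u v where "(u,v) \<in> W" "u < x" "x < v" using x covA by auto
          then show ?thesis using False by (auto simp: cover_iff intro: less_imp_le)
        qed
      qed
      show "{p..q} \<inter> ((E - cover A) \<union> (cover A - E)) \<in> sets lebesgue" using E mA by auto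
      show "((E \<inter> {p..q} - C) \<union> (cover W - E)) \<union> Z \<in> lmeasurable"
        by (intro fmeasurable.Un EC WE fmeasurableI_null_sets[OF Z])
    qed
    also have "\<dots> = measure lebesgue ((E \<inter> {p..q} - C) \<union> (cover W - E))"
      by (rule measure_Un_null_set[OF _ Z]) (intro sets.Un fmeasurableD EC WE)
    also have "\<dots> \<le> measure lebesgue (E \<inter> {p..q} - C) + measure lebesgue (cover W - E)"
      by (rule measure_Un_le) (intro fmeasurableD EC WE)+
    finally show "measure lebesgue ({p..q} \<inter> ((E - cover A) \<union> (cover A - E))) \<le> \<epsilon>"
      using C(6) mWE \<epsilon>1(2) \<theta>(3) by linarith
  qed
qed

section \<open>Passing to the next stage\<close>

lemma open_stage_cover:
  assumes "stage S E c \<delta> \<eta> f A B"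
  shows "open (cover A)"
  unfolding open_dist
proof
  fix x assume "x \<in> cover A"
  then obtain r where r: "r > 0" "\<And>y. \<bar>y - x\<bar> < r \<Longrightarrow> \<exists>(u,v)\<in>A. x \<in> {u..v} \<and> y \<in> {u..v}"
    using stageD(7)[OF assms] by blast
  then show "\<exists>e>0. \<forall>y. dist y x < e \<longrightarrow> y \<in> cover A"
    by (intro exI[of _ r]) (force simp: cover_def dist_real_def)
qed

lemma sum_half_powers_le:
  assumes "finite F" "inj_on i F"
  shows "(\<Sum>J\<in>F. (1/2::real) ^ Suc (i J)) \<le> 1"
proof -
  have "(\<Sum>J\<in>F. (1/2::real) ^ Suc (i J)) = (\<Sum>n\<in>i ` F. (1/2) ^ Suc n)"
    by (simp add: sum.reindex[OF assms(2)])
  also have "\<dots> \<le> (\<Sum>n. (1/2) ^ Suc n)"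
    by (rule sum_le_suminf) (use assms power_half_series in \<open>auto simp: sums_iff\<close>)
  also have "\<dots> = 1" using power_half_series by (simp add: sums_iff)
  finally show ?thesis .
qed

text \<open>Every piece is refined with the mean slope of f on it, and the results are glued along
  f. The defect ratio \<open>(1 - c / c') / 4\<close> is the one that
  \<open>stage_refine_interval\<close> needs to raise the slope from c to c'. In the error estimate
  an active piece costs at most twice its length, which is at most 2 \<eta> times its distance from
  x; an inactive one costs the height of its new zigzag.\<close>

lemma stage_step:
  fixes E :: "real set"
  assumes E: "E \<in> sets lebesgue" and st: "stage UNIV E c ((1 - c / c') / 4) \<eta> f A B"
    and c: "0 < c" "c < c'" "c' \<le> 1" and \<eta>: "0 < \<eta>" and \<delta>': "\<delta>' > 0" and \<eta>': "0 < \<eta>'" "\<eta>' \<le> 1" and \<epsilon>: "\<epsilon> > 0"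
  obtains f' A' B' where "stage UNIV E c' \<delta>' \<eta>' f' A' B'"
    "\<And>x. x \<notin> (\<Union>(u,v)\<in>A \<union> B. {u<..<v}) \<Longrightarrow> f' x = f x"
    "\<And>u v. (u,v) \<in> A' \<union> B' \<Longrightarrow> \<exists>(p,q)\<in>A \<union> B. p \<le> u \<and> v \<le> q"
    "\<And>x y. x \<notin> cover A \<Longrightarrow> x \<notin> cover A' \<Longrightarrow> \<bar>f' y - f y\<bar> \<le> (2 * \<eta> + \<eta>') * \<bar>y - x\<bar>"
    "\<And>y. \<bar>f' y - f y\<bar> \<le> 2 * \<eta> + \<eta>'"
    "(E - cover A') \<union> (cover A' - E) \<in> lmeasurable"
    "measure lebesgue ((E - cover A') \<union> (cover A' - E)) \<le> \<epsilon>"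
proof -
  define P where "P = A \<union> B"
  note S = stageD[OF st]
  have fp: "fine_partition UNIV P" using S(1) by (simp add: P_def)
  note PD = fine_partitionD[OF fp]
  have cP: "countable P" by (rule fine_partition_countable[OF fp])
  define Q where "Q J X \<longleftrightarrow> (case (J, X) of ((u,v),(g,A',B')) \<Rightarrow>
      stage {u..v} E c' \<delta>' \<eta>' g A' B' \<and> g u = f u \<and> g v = f v \<and>
      ((u,v) \<notin> A \<longrightarrow> (\<forall>x\<in>{u..v}. \<forall>y\<in>{u..v}. x \<notin> cover A' \<longrightarrow> \<bar>g y - f u\<bar> \<le> \<eta>' * \<bar>y - x\<bar>)) \<and>
      ((u,v) \<notin> A \<longrightarrow> (\<forall>y\<in>{u..v}. \<bar>g y - f u\<bar> \<le> \<eta>')) \<and>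
      measure lebesgue ({u..v} \<inter> ((E - cover A') \<union> (cover A' - E))) \<le> \<epsilon> * (1/2) ^ Suc (to_nat_on P (u,v)))" for J X
  have ex: "\<exists>X. Q J X" if J: "J \<in> P" for J
  proof -
    obtain u v where [simp]: "J = (u,v)" by (cases J)
    have uv: "(u,v) \<in> P" using J by simp
    have lt: "u < v" by (rule PD(1)[OF uv])
    \<comment> \<open>The mean slope of f on the piece: c or -c if it is active, 0 if it is
      not.\<close>
    define s where "s = (f v - f u) / (v - u)"
    have sv: "s * (v - u) = f v - f u" using lt by (simp add: s_def)
    have sA: "\<bar>s\<bar> = c" if "(u,v) \<in> A" using S(4)[OF that] lt by (simp add: s_def abs_divide)
    have sB: "s = 0" if "(u,v) \<notin> A"
      using S(3)[of u v v] that uv lt by (simp add: s_def P_def)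
    have "\<bar>s\<bar> \<le> c" using sA sB c by (cases "(u,v) \<in> A") auto
    moreover have "measure lebesgue ({u..v} - E) \<le> (1 - c / c') / 4 * (v - u)" if "s \<noteq> 0"
      using S(5)[of u v] sB that by blast
    ultimately obtain g A' B' where g: "stage {u..v} E c' \<delta>' \<eta>' g A' B'" "g u = f u" "g v = f u + s * (v - u)"
      "\<And>x y. s = 0 \<Longrightarrow> x \<in> {u..v} \<Longrightarrow> x \<notin> cover A' \<Longrightarrow> y \<in> {u..v} \<Longrightarrow> \<bar>g y - f u\<bar> \<le> \<eta>' * \<bar>y - x\<bar>"
      "\<And>y. s = 0 \<Longrightarrow> y \<in> {u..v} \<Longrightarrow> \<bar>g y - f u\<bar> \<le> \<eta>'"
      "measure lebesgue ({u..v} \<inter> ((E - cover A') \<union> (cover A' - E))) \<le> \<epsilon> * (1/2) ^ Suc (to_nat_on P (u,v))"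
      using stage_refine_interval[OF E lt c _ _ \<delta>' \<eta>', of s "\<epsilon> * (1/2) ^ Suc (to_nat_on P (u,v))" "f u"] \<epsilon>
      by (metis half_gt_zero mult_pos_pos zero_less_one zero_less_power)
    have "Q J (g, A', B')" unfolding Q_def using g sB sv by auto
    then show ?thesis by blast
  qed
  then obtain X where X: "\<And>J. J \<in> P \<Longrightarrow> Q J (X J)" by metis
  define g A1 B1 where "g J = fst (X J)" and "A1 J = fst (snd (X J))" and "B1 J = snd (snd (X J))" for J
  have QX: "stage {u..v} E c' \<delta>' \<eta>' (g (u,v)) (A1 (u,v)) (B1 (u,v))" "g (u,v) u = f u" "g (u,v) v = f v"
      "\<And>x y. (u,v) \<notin> A \<Longrightarrow> x \<in> {u..v} \<Longrightarrow> y \<in> {u..v} \<Longrightarrow> x \<notin> cover (A1 (u,v)) \<Longrightarrow> \<bar>g (u,v) y - f u\<bar> \<le> \<eta>' * \<bar>y - x\<bar>"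
      "\<And>y. (u,v) \<notin> A \<Longrightarrow> y \<in> {u..v} \<Longrightarrow> \<bar>g (u,v) y - f u\<bar> \<le> \<eta>'"
      "measure lebesgue ({u..v} \<inter> ((E - cover (A1 (u,v))) \<union> (cover (A1 (u,v)) - E))) \<le> \<epsilon> * (1/2) ^ Suc (to_nat_on P (u,v))"
    if "(u,v) \<in> P" for u v
    using X[OF that] unfolding Q_def g_def A1_def B1_def by (auto simp: case_prod_beta)
  \<comment> \<open>Where f is not flat, namely on \<open>cover A\<close>, the active pieces
    containing the point fill a neighbourhood.\<close>
  have H: "(\<exists>r>0. \<forall>y\<in>UNIV. \<bar>y - x\<bar> < r \<longrightarrow> (\<exists>(u,v)\<in>P. x \<in> {u..v} \<and> y \<in> {u..v})) \<or>
      (\<forall>e>0. \<exists>r>0. \<forall>y\<in>UNIV. \<bar>y - x\<bar> < r \<longrightarrow> \<bar>f y - f x\<bar> \<le> e * \<bar>y - x\<bar>)" for x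
  proof (cases "x \<in> cover A")
    case True
    then obtain r where r: "r > 0" "\<And>y. \<bar>y - x\<bar> < r \<Longrightarrow> \<exists>(u,v)\<in>A. x \<in> {u..v} \<and> y \<in> {u..v}"
      using S(7) by blast
    then have "\<exists>(u,v)\<in>P. x \<in> {u..v} \<and> y \<in> {u..v}" if "\<bar>y - x\<bar> < r" for y
      using r(2)[OF that] unfolding P_def by blast
    then show ?thesis using r(1) by blast
  next
    case False
    then show ?thesis using S(8)[of x] by blast
  qed
  have f_lip: "\<bar>f x - f y\<bar> \<le> c * \<bar>x - y\<bar>" for x y using S(2) by simp
  have f_lip': "\<bar>f x - f y\<bar> \<le> c' * \<bar>x - y\<bar>" for x y
    using f_lip[of x y] c mult_right_mono[of c c' "\<bar>x - y\<bar>"] by linarith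
  obtain F where F: "stage UNIV E c' \<delta>' \<eta>' F (\<Union>J\<in>P. A1 J) (\<Union>J\<in>P. B1 J)"
    "\<And>u v y. (u,v) \<in> P \<Longrightarrow> y \<in> {u..v} \<Longrightarrow> F y = g (u,v) y" "\<And>y. y \<notin> cover P \<Longrightarrow> F y = f y"
  proof (rule stage_glue[OF fp _ _ f_lip' H QX(1,2,3)])
    show "0 \<le> c'" "0 \<le> \<eta>'" using c \<eta>' by auto
  qed blast+
  define A' B' where "A' = (\<Union>J\<in>P. A1 J)" and "B' = (\<Union>J\<in>P. B1 J)"
  have inner: "cover (A1 (u,v)) \<subseteq> {u<..<v}" if "(u,v) \<in> P" for u v
    by (rule stage_cover_interior[OF QX(1)[OF that]])
  have covA': "cover A' = (\<Union>J\<in>P. cover (A1 J))" by (simp add: A'_def cover_UN)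
  have covE: "\<exists>u v. (u,v) \<in> P \<and> u \<le> x \<and> x \<le> v" if "x \<in> cover P" for x using that by (simp add: cover_iff)
  have bigA: "\<bar>F y - f y\<bar> \<le> 2 * (v - u)" if uv: "(u,v) \<in> P" "y \<in> {u..v}" for u v y
  proof -
    have "\<bar>g (u,v) y - g (u,v) u\<bar> \<le> c' * (y - u)" using stageD(2)[OF QX(1)[OF uv(1)], of y u] uv by simp
    moreover have "\<bar>f y - f u\<bar> \<le> c' * (y - u)" using f_lip'[of y u] uv by simp
    moreover have "c' * (y - u) \<le> 1 * (v - u)" using c uv by (intro mult_mono) auto
    ultimately show ?thesis using F(2)[OF uv] QX(2)[OF uv(1)] by linarith
  qed
  have fB: "f y = f u" if uv: "(u,v) \<in> P" "(u,v) \<notin> A" "y \<in> {u..v}" for u v y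
    using S(3)[of u v y] uv by (simp add: P_def)
  show thesis
  proof (rule that[OF F(1)[folded A'_def B'_def]])
    show "F x = f x" if x: "x \<notin> (\<Union>(u,v)\<in>A \<union> B. {u<..<v})" for x
    proof (cases "x \<in> cover P")
      case True
      then obtain u v where uv: "(u,v) \<in> P" "u \<le> x" "x \<le> v" using covE by blast
      have "x \<notin> {u<..<v}" using x uv(1) unfolding P_def by blast
      then have "x = u \<or> x = v" using uv by auto
      then show ?thesis using F(2)[OF uv(1), of x] QX(2,3)[OF uv(1)] uv by auto
    qed (use F(3) in auto)
    show "\<exists>(p,q)\<in>A \<union> B. p \<le> u \<and> v \<le> q" if uv: "(u,v) \<in> A' \<union> B'" for u v
    proof -
      obtain p q where pq: "(p,q) \<in> P" "(u,v) \<in> A1 (p,q) \<union> B1 (p,q)" using uv unfolding A'_def B'_def by auto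
      have "u < v \<and> {u..v} \<subseteq> {p..q}" using fine_partitionD(1,2)[OF stageD(1)[OF QX(1)[OF pq(1)]] pq(2)] by blast
      then show ?thesis using pq(1) unfolding P_def by (intro bexI[of _ "(p,q)"]) auto
    qed
    show "\<bar>F y - f y\<bar> \<le> (2 * \<eta> + \<eta>') * \<bar>y - x\<bar>" if x: "x \<notin> cover A" "x \<notin> cover A'" for x y
    proof (cases "y \<in> cover P")
      case True
      then obtain u v where uv: "(u,v) \<in> P" "y \<in> {u..v}" using covE by force
      have "\<bar>F y - f y\<bar> \<le> 2 * \<eta> * \<bar>y - x\<bar> \<or> \<bar>F y - f y\<bar> \<le> \<eta>' * \<bar>y - x\<bar>"
      proof (cases "(u,v) \<in> A")
        case True
        then have "x \<notin> {u..v}" using x(1) by (auto simp: cover_iff)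
        then consider "x < u" | "v < x" by force
        then have "v - u \<le> \<eta> * \<bar>y - x\<bar>"
        proof cases
          case 1
          then have "v - u \<le> \<eta> * (u - x)" using S(9)[of x u v] x True by simp
          also have "\<dots> \<le> \<eta> * \<bar>y - x\<bar>" using 1 uv \<eta> by (intro mult_left_mono) auto
          finally show ?thesis .
        next
          case 2
          then have "v - u \<le> \<eta> * (x - v)" using S(10)[of x u v] x True by simp
          also have "\<dots> \<le> \<eta> * \<bar>y - x\<bar>" using 2 uv \<eta> by (intro mult_left_mono) auto
          finally show ?thesis .
        qed
        then show ?thesis using bigA[OF uv] by simp
      next
        case False
        have ends: "u \<notin> cover (A1 (u,v))" "v \<notin> cover (A1 (u,v))" using inner[OF uv(1)] by auto
        have xA: "x \<notin> cover (A1 (u,v))" using x(2) uv(1) by (auto simp: covA')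
        \<comment> \<open>The estimate on the piece needs an uncovered reference point inside it. If
          x is outside, the end facing x serves and is closer to y.\<close>
        have "\<exists>z\<in>{u..v}. z \<notin> cover (A1 (u,v)) \<and> \<bar>y - z\<bar> \<le> \<bar>y - x\<bar>"
        proof -
          consider "x < u" | "v < x" | "x \<in> {u..v}" by force
          then show ?thesis
          proof cases
            case 1
            then show ?thesis using ends uv by (intro bexI[of _ u]) auto
          next
            case 2
            then show ?thesis using ends uv by (intro bexI[of _ v]) auto
          next
            case 3
            then show ?thesis using xA by blast
          qed
        qed
        then obtain z where z: "z \<in> {u..v}" "z \<notin> cover (A1 (u,v))" "\<bar>y - z\<bar> \<le> \<bar>y - x\<bar>" by blast
        have "\<bar>F y - f y\<bar> \<le> \<eta>' * \<bar>y - z\<bar>"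
          using QX(4)[OF uv(1) False z(1) uv(2) z(2)] F(2)[OF uv] fB[OF uv(1) False uv(2)] by simp
        also have "\<dots> \<le> \<eta>' * \<bar>y - x\<bar>" using z(3) \<eta>' by (intro mult_left_mono) auto
        finally show ?thesis by simp
      qed
      moreover have "0 \<le> 2 * \<eta> * \<bar>y - x\<bar>" "0 \<le> \<eta>' * \<bar>y - x\<bar>" using \<eta> \<eta>' by auto
      ultimately show ?thesis by (auto simp: distrib_right)
    qed (use F(3) \<eta> \<eta>' in auto)
    show "\<bar>F y - f y\<bar> \<le> 2 * \<eta> + \<eta>'" for y
    proof (cases "y \<in> cover P")
      case True
      then obtain u v where uv: "(u,v) \<in> P" "y \<in> {u..v}" using covE by force
      show ?thesis
      proof (cases "(u,v) \<in> A")
        case True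
        have "\<bar>F y - f y\<bar> \<le> 2 * (v - u)" by (rule bigA[OF uv])
        also have "\<dots> \<le> 2 * \<eta>" using S(6)[OF True] by simp
        finally show ?thesis using \<eta>' by simp
      next
        case False
        then show ?thesis using QX(5)[OF uv(1) False uv(2)] F(2)[OF uv] fB[OF uv(1) False uv(2)] \<eta> by simp
      qed
    qed (use F(3) \<eta> \<eta>' in auto)
    \<comment> \<open>The pieces are countably many; halving weights along an enumeration keep the
      total error below \<epsilon>.\<close>
    define T where "T J = {fst J..snd J} \<inter> ((E - cover (A1 J)) \<union> (cover (A1 J) - E))" for J
    have T: "T J \<in> lmeasurable" "measure lebesgue (T J) \<le> \<epsilon> * (1/2) ^ Suc (to_nat_on P J)" if J: "J \<in> P" for J
    proof -
      have J': "(fst J, snd J) \<in> P" using J by simp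
      have "cover (A1 J) \<in> sets lebesgue" using open_stage_cover[OF QX(1)[OF J']] by simp
      then show "T J \<in> lmeasurable" unfolding T_def using E
        by (intro fmeasurable_Int_fmeasurable) auto
      show "measure lebesgue (T J) \<le> \<epsilon> * (1/2) ^ Suc (to_nat_on P J)" using QX(6)[OF J'] by (simp add: T_def)
    qed
    have fin: "measure lebesgue (\<Union>J\<in>G. T J) \<le> \<epsilon>" if G: "G \<subseteq> P" "finite G" for G
    proof -
      have "measure lebesgue (\<Union>J\<in>G. T J) \<le> (\<Sum>J\<in>G. measure lebesgue (T J))"
        by (rule measure_UNION_le) (use G T in \<open>auto simp: fmeasurableD\<close>)
      also have "\<dots> \<le> (\<Sum>J\<in>G. \<epsilon> * (1/2) ^ Suc (to_nat_on P J))" by (rule sum_mono) (use G T in auto)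
      also have "\<dots> = \<epsilon> * (\<Sum>J\<in>G. (1/2) ^ Suc (to_nat_on P J))" by (simp add: sum_distrib_left)
      also have "\<dots> \<le> \<epsilon> * 1"
        using \<epsilon> sum_half_powers_le[OF G(2) inj_on_subset[OF inj_on_to_nat_on[OF cP] G(1)]] by (intro mult_left_mono) auto
      finally show ?thesis by simp
    qed
    have U: "(\<Union>J\<in>P. T J) \<in> lmeasurable" "measure lebesgue (\<Union>J\<in>P. T J) \<le> \<epsilon>"
      using fmeasurable_UN_bound[OF cP T(1) fin] measure_UN_bound[OF cP T(1) fin] by auto
    define N where "N = UNIV - (\<Union>(u,v)\<in>P. {u<..<v})"
    have N: "N \<in> null_sets lebesgue"
      unfolding N_def by (rule null_sets_completionI[OF countable_imp_null_set_lborel[OF PD(4)]])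
    have sub: "(E - cover A') \<union> (cover A' - E) \<subseteq> (\<Union>J\<in>P. T J) \<union> N"
    proof
      fix x assume x: "x \<in> (E - cover A') \<union> (cover A' - E)"
      show "x \<in> (\<Union>J\<in>P. T J) \<union> N"
      proof (cases "x \<in> N")
        case False
        then obtain u v where uv: "(u,v) \<in> P" "u < x" "x < v" by (auto simp: N_def)
        \<comment> \<open>The cover of each piece stays strictly inside it, so only the piece around
          x can contribute.\<close>
        have "x \<in> cover A' \<longleftrightarrow> x \<in> cover (A1 (u,v))"
        proof
          assume "x \<in> cover A'"
          then obtain u' v' where uv': "(u',v') \<in> P" "x \<in> cover (A1 (u',v'))" by (auto simp: covA')
          then have "u' < x" "x < v'" using inner[OF uv'(1)] by auto
          then have "(u',v') = (u,v)" using PD(3)[OF uv'(1) uv(1)] uv by force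
          then show "x \<in> cover (A1 (u,v))" using uv' by simp
        qed (use uv in \<open>auto simp: covA'\<close>)
        then have "x \<in> T (u,v)" using x uv by (auto simp: T_def)
        then show ?thesis using uv(1) by blast
      qed simp
    qed
    have mA': "cover A' \<in> sets lebesgue" using open_stage_cover[OF F(1)[folded A'_def B'_def]] by simp
    have ms: "(E - cover A') \<union> (cover A' - E) \<in> sets lebesgue" using E mA' by auto
    have UN: "(\<Union>J\<in>P. T J) \<union> N \<in> lmeasurable" by (intro fmeasurable.Un U fmeasurableI_null_sets[OF N])
    show "(E - cover A') \<union> (cover A' - E) \<in> lmeasurable" by (rule fmeasurableI2[OF UN sub ms])
    have "measure lebesgue ((E - cover A') \<union> (cover A' - E)) \<le> measure lebesgue ((\<Union>J\<in>P. T J) \<union> N)"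
      by (rule measure_mono_fmeasurable[OF sub ms UN])
    also have "\<dots> = measure lebesgue (\<Union>J\<in>P. T J)" by (rule measure_Un_null_set[OF fmeasurableD[OF U(1)] N])
    finally show "measure lebesgue ((E - cover A') \<union> (cover A' - E)) \<le> \<epsilon>" using U(2) by linarith
  qed
qed

text \<open>Without active pieces all clauses involving E, \<delta> and \<eta> are vacuous.\<close>

lemma stage_initial:
  assumes "c \<ge> 0"
  shows "stage UNIV E c \<delta> \<eta> (\<lambda>_. 0) {} (range (\<lambda>n::int. (real_of_int n, real_of_int n + 1)))"
proof (rule stageI)
  let ?P = "range (\<lambda>n::int. (real_of_int n, real_of_int n + 1))"
  have "fine_partition UNIV ?P"
  proof (rule fine_partitionI)
    have "UNIV - (\<Union>(u,v)\<in>?P. {u<..<v}) \<subseteq> range real_of_int"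
    proof
      fix x assume x: "x \<in> UNIV - (\<Union>(u,v)\<in>?P. {u<..<v})"
      show "x \<in> range real_of_int"
      proof (rule ccontr)
        assume "x \<notin> range real_of_int"
        then have "of_int \<lfloor>x\<rfloor> \<noteq> x" by (metis rangeI)
        then have "of_int \<lfloor>x\<rfloor> < x" "x < of_int \<lfloor>x\<rfloor> + 1" by linarith+
        then show False using x by auto
      qed
    qed
    then show "countable (UNIV - (\<Union>(u,v)\<in>?P. {u<..<v}))" by (rule countable_subset) auto
    fix x e :: real
    have "\<not> (x < real_of_int n \<and> real_of_int n < x + (of_int \<lfloor>x\<rfloor> + 1 - x))" for n
      using floor_less_iff[of x n] by linarith
    then show "\<exists>r>0. \<forall>u v. (u,v) \<in> ?P \<longrightarrow> x < u \<longrightarrow> u < x + r \<longrightarrow> v - u \<le> e * (u - x)"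
      by (intro exI[of _ "of_int \<lfloor>x\<rfloor> + 1 - x"]) force
    have "\<not> (real_of_int n + 1 < x \<and> x - (x - (of_int \<lceil>x\<rceil> - 1)) < real_of_int n + 1)" for n
      using less_ceiling_iff[of "n + 1" x] by auto
    then show "\<exists>r>0. \<forall>u v. (u,v) \<in> ?P \<longrightarrow> v < x \<longrightarrow> x - r < v \<longrightarrow> v - u \<le> e * (x - v)"
      by (intro exI[of _ "x - (of_int \<lceil>x\<rceil> - 1)"]) (auto, linarith)
  qed auto
  then show "fine_partition UNIV ({} \<union> ?P)" by simp
qed (use assms in \<open>auto simp: cover_def intro: exI[of _ 1]\<close>)

section \<open>The limit function\<close>

lemma Lip_le_1:
  assumes "\<And>x y. \<bar>f x - f y\<bar> \<le> \<bar>x - y\<bar>"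
  shows "Lip f x \<le> 1"
  unfolding Lip_def
proof (rule Limsup_bounded)
  have "Mf f x r \<le> 1" if r: "r > 0" for r
  proof -
    have "(SUP y\<in>{y. \<bar>x - y\<bar> \<le> r}. ereal \<bar>f x - f y\<bar>) \<le> ereal r"
    proof (rule SUP_least)
      fix y assume "y \<in> {y. \<bar>x - y\<bar> \<le> r}"
      then show "ereal \<bar>f x - f y\<bar> \<le> ereal r" using assms[of x y] by simp
    qed
    then show ?thesis unfolding Mf_def using r by (simp add: ereal_divide_le_pos)
  qed
  then show "\<forall>\<^sub>F r in at_right 0. Mf f x r \<le> 1"
    by (simp add: eventually_at_right_less eventually_mono[OF eventually_at_right_less])
qed

lemma Mf_ge:
  assumes "\<bar>x - y\<bar> \<le> r" "r > 0"
  shows "ereal (\<bar>f x - f y\<bar> / r) \<le> Mf f x r"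
proof -
  have "ereal \<bar>f x - f y\<bar> \<le> (SUP y\<in>{y. \<bar>x - y\<bar> \<le> r}. ereal \<bar>f x - f y\<bar>)"
    by (rule SUP_upper) (use assms in auto)
  then have "ereal \<bar>f x - f y\<bar> / ereal r \<le> Mf f x r"
    unfolding Mf_def using assms by (intro ereal_divide_right_mono) auto
  then show ?thesis using assms by simp
qed

text \<open>A steep chord from x to y bounds \<open>Mf f x r\<close> from below at the radius r =
  \<open>\<bar>y - x\<bar>\<close>. Since such radii occur arbitrarily close to 0, the limsup is at
  least \<open>1 - e\<close> for every e.\<close>

lemma Lip_ge_1:
  assumes "\<And>e d. e > 0 \<Longrightarrow> d > 0 \<Longrightarrow> \<exists>y. y \<noteq> x \<and> \<bar>y - x\<bar> < d \<and> (1 - e) * \<bar>y - x\<bar> \<le> \<bar>f y - f x\<bar>"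
  shows "1 \<le> Lip f x"
proof -
  have "ereal (1 - e) \<le> Lip f x" if e: "e > 0" for e
    unfolding Lip_def Limsup_def
  proof (rule INF_greatest)
    fix P :: "real \<Rightarrow> bool" assume "P \<in> {P. eventually P (at_right 0)}"
    then obtain d where d: "d > 0" "\<And>r. 0 < r \<Longrightarrow> r < d \<Longrightarrow> P r"
      by (auto simp: eventually_at_right_field)
    obtain y where y: "y \<noteq> x" "\<bar>y - x\<bar> < d" "(1 - e) * \<bar>y - x\<bar> \<le> \<bar>f y - f x\<bar>" using assms[OF e d(1)] by blast
    define r where "r = \<bar>y - x\<bar>"
    have r: "0 < r" "P r" using y d by (auto simp: r_def)
    have "1 - e \<le> \<bar>f x - f y\<bar> / r"
      using y r by (simp add: r_def pos_le_divide_eq abs_minus_commute)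
    then have "ereal (1 - e) \<le> ereal (\<bar>f x - f y\<bar> / r)" by simp
    also have "\<dots> \<le> Mf f x r" by (rule Mf_ge) (use r in \<open>auto simp: r_def\<close>)
    also have "\<dots> \<le> Sup (Mf f x ` {x. P x})" by (rule SUP_upper) (use r in auto)
    finally show "ereal (1 - e) \<le> Sup (Mf f x ` {x. P x})" .
  qed
  then have "1 \<le> Lip f x + ereal e" if "e > 0" for e
    using add_right_mono[of "ereal (1 - e)" "Lip f x" "ereal e"] that by (simp add: one_ereal_def)
  then show ?thesis by (rule ereal_le_epsilon2)
qed

lemma Lip_eq_0:
  assumes "\<And>e. e > 0 \<Longrightarrow> \<exists>d>0. \<forall>y. \<bar>y - x\<bar> < d \<longrightarrow> \<bar>f y - f x\<bar> \<le> e * \<bar>y - x\<bar>"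
  shows "Lip f x = 0"
proof (rule antisym)
  show "Lip f x \<le> 0"
  proof (rule ereal_le_epsilon2)
    fix e :: real assume e: "e > 0"
    obtain d where d: "d > 0" "\<And>y. \<bar>y - x\<bar> < d \<Longrightarrow> \<bar>f y - f x\<bar> \<le> e * \<bar>y - x\<bar>" using assms[OF e] by blast
    have M: "Mf f x r \<le> ereal e" if r: "0 < r" "r < d" for r
    proof -
      have "(SUP y\<in>{y. \<bar>x - y\<bar> \<le> r}. ereal \<bar>f x - f y\<bar>) \<le> ereal (e * r)"
      proof (rule SUP_least)
        fix y assume "y \<in> {y. \<bar>x - y\<bar> \<le> r}"
        then have y: "\<bar>y - x\<bar> \<le> r" by (simp add: abs_minus_commute)
        then have "\<bar>f y - f x\<bar> \<le> e * \<bar>y - x\<bar>" using d(2) r by simp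
        also have "\<dots> \<le> e * r" using y e by (intro mult_left_mono) auto
        finally show "ereal \<bar>f x - f y\<bar> \<le> ereal (e * r)" by (simp add: abs_minus_commute)
      qed
      then have "Mf f x r \<le> ereal (e * r) / ereal r"
        unfolding Mf_def using r by (intro ereal_divide_right_mono) auto
      then show ?thesis using r by simp
    qed
    have "Lip f x \<le> ereal e" unfolding Lip_def
    proof (rule Limsup_bounded)
      show "\<forall>\<^sub>F r in at_right 0. Mf f x r \<le> ereal e"
        unfolding eventually_at_right_field using M d(1) by blast
    qed
    then show "Lip f x \<le> 0 + ereal e" by simp
  qed
  have "\<forall>\<^sub>F r in at_right 0. 0 \<le> Mf f x r"
    unfolding eventually_at_right_field using Mf_ge[of x x _ f] by (intro exI[of _ 1]) (auto simp: zero_ereal_def)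
  then show "0 \<le> Lip f x" unfolding Lip_def by (intro le_Limsup) auto
qed

text \<open>Keeping the difference of powers makes the induction exact: the bound grows by precisely
  \<open>K * (1/2) ^ n\<close> at each step.\<close>

lemma geometric_steps_bound:
  fixes a :: "nat \<Rightarrow> real"
  assumes "\<And>k. m \<le> k \<Longrightarrow> \<bar>a (Suc k) - a k\<bar> \<le> K * (1/2) ^ k" "m \<le> k"
  shows "\<bar>a k - a m\<bar> \<le> 2 * K * ((1/2) ^ m - (1/2) ^ k)"
  using assms(2)
proof (induction k rule: dec_induct)
  case (step n)
  have "2 * K * ((1/2) ^ m - (1/2) ^ Suc n) = 2 * K * ((1/2) ^ m - (1/2) ^ n) + K * (1/2) ^ n"
    by (simp add: algebra_simps)
  then show ?case using assms(1)[OF step.hyps(1)] step.IH by linarith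
qed simp

lemma geometric_steps_convergent:
  fixes a :: "nat \<Rightarrow> real"
  assumes "\<And>k. \<bar>a (Suc k) - a k\<bar> \<le> K * (1/2) ^ k"
  shows "convergent a"
proof -
  have "summable (\<lambda>k. a (Suc k) - a k)"
    by (rule summable_comparison_test'[of "\<lambda>k. K * (1/2) ^ k" 0])
      (use assms in \<open>auto intro!: summable_mult summable_geometric\<close>)
  then have "convergent (\<lambda>n. (\<Sum>k<n. a (Suc k) - a k) + a 0)"
    unfolding summable_iff_convergent by (intro convergent_add convergent_const)
  then show ?thesis by (simp add: sum_lessThan_telescope)
qed

theorem theorem1p3:
  fixes E :: "real set"
  assumes "E \<in> sets lebesgue"
  shows "\<exists>E'. gdelta_in euclideanreal E' \<and> Lip1_set E' \<and>
              (E - E') \<union> (E' - E) \<in> null_sets lebesgue"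
proof -
  \<comment> \<open>The shifted exponent makes \<open>c 0\<close> positive.\<close>
  define c :: "nat \<Rightarrow> real" where "c k = 1 - (1/2) ^ Suc k" for k
  \<comment> \<open>The density of E in the tiles of stage k that allows slope
    \<open>c (Suc k)\<close> at the next stage.\<close>
  define \<delta> where "\<delta> k = (1 - c k / c (Suc k)) / 4" for k
  define \<eta> :: "nat \<Rightarrow> real" where "\<eta> k = (1/2) ^ k" for k
  have c: "0 < c k" "c k < c (Suc k)" "c k < 1" for k
  proof -
    have "(1/2::real) ^ k \<le> 1" "0 < (1/2::real) ^ k" by (simp_all add: power_le_one)
    then show "0 < c k" "c k < c (Suc k)" "c k < 1" by (simp_all add: c_def)
  qed
  have \<delta>: "0 < \<delta> k" for k using c(1,2)[of k] c(1)[of "Suc k"] by (simp add: \<delta>_def)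
  have \<eta>: "0 < \<eta> k" "\<eta> k \<le> 1" "\<eta> (Suc k) \<le> \<eta> k" for k by (auto simp: \<eta>_def power_le_one)
  define st where "st k X \<longleftrightarrow> (case X of (f,A,B) \<Rightarrow> stage UNIV E (c k) (\<delta> k) (\<eta> k) f A B)" for k X
  define nx where "nx k X Y \<longleftrightarrow> (case (X,Y) of ((f,A,B),(f',A',B')) \<Rightarrow>
    (\<forall>x. x \<notin> (\<Union>(u,v)\<in>A \<union> B. {u<..<v}) \<longrightarrow> f' x = f x) \<and>
    (\<forall>u v. (u,v) \<in> A' \<union> B' \<longrightarrow> (\<exists>(p,q)\<in>A \<union> B. p \<le> u \<and> v \<le> q)) \<and>
    (\<forall>x y. x \<notin> cover A \<longrightarrow> x \<notin> cover A' \<longrightarrow> \<bar>f' y - f y\<bar> \<le> (2 * \<eta> k + \<eta> (Suc k)) * \<bar>y - x\<bar>) \<and>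
    (\<forall>y. \<bar>f' y - f y\<bar> \<le> 2 * \<eta> k + \<eta> (Suc k)) \<and>
    (E - cover A') \<union> (cover A' - E) \<in> lmeasurable \<and>
    measure lebesgue ((E - cover A') \<union> (cover A' - E)) \<le> (1/2) ^ k)" for k X Y
  have "\<exists>X. \<forall>k. st k (X k) \<and> nx k (X k) (X (Suc k))"
  proof (rule dependent_nat_choice)
    have "st 0 (\<lambda>_. 0, {}, range (\<lambda>n::int. (real_of_int n, real_of_int n + 1)))"
      unfolding st_def prod.case by (rule stage_initial[OF less_imp_le[OF c(1)]])
    then show "\<exists>X. st 0 X" by (rule exI)
    fix X k assume X: "st k X"
    obtain f A B where [simp]: "X = (f,A,B)" by (cases X)
    have "stage UNIV E (c k) ((1 - c k / c (Suc k)) / 4) (\<eta> k) f A B" using X by (simp add: st_def \<delta>_def)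
    note stk = this
    have "(1/2::real) ^ k > 0" by simp
    from stage_step[OF assms stk c(1,2) less_imp_le[OF c(3)] \<eta>(1) \<delta>[of "Suc k"] \<eta>(1,2)[of "Suc k"] this]
    obtain f' A' B' where Y: "stage UNIV E (c (Suc k)) (\<delta> (Suc k)) (\<eta> (Suc k)) f' A' B'"
      "\<And>x. x \<notin> (\<Union>(u,v)\<in>A \<union> B. {u<..<v}) \<Longrightarrow> f' x = f x"
      "\<And>u v. (u,v) \<in> A' \<union> B' \<Longrightarrow> \<exists>(p,q)\<in>A \<union> B. p \<le> u \<and> v \<le> q"
      "\<And>x y. x \<notin> cover A \<Longrightarrow> x \<notin> cover A' \<Longrightarrow> \<bar>f' y - f y\<bar> \<le> (2 * \<eta> k + \<eta> (Suc k)) * \<bar>y - x\<bar>"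
      "\<And>y. \<bar>f' y - f y\<bar> \<le> 2 * \<eta> k + \<eta> (Suc k)"
      "(E - cover A') \<union> (cover A' - E) \<in> lmeasurable"
      "measure lebesgue ((E - cover A') \<union> (cover A' - E)) \<le> (1/2) ^ k" by blast
    have "nx k X (f',A',B')" unfolding nx_def using Y(2-7) by simp
    then show "\<exists>Y. st (Suc k) Y \<and> nx k X Y" unfolding st_def using Y(1) by (intro exI[of _ "(f',A',B')"]) simp
  qed
  then obtain X where X: "\<And>k. st k (X k)" "\<And>k. nx k (X k) (X (Suc k))" by blast
  define f A B where "f k = fst (X k)" and "A k = fst (snd (X k))" and "B k = snd (snd (X k))" for k
  define U where "U k = cover (A k)" for k
  \<comment> \<open>Nodes of stage k: points interior to no piece. As partitions are refined these
    sets grow, so values at nodes are frozen from stage k on.\<close>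
  define N where "N k = - (\<Union>(u,v)\<in>A k \<union> B k. {u<..<v})" for k
  have stg: "stage UNIV E (c k) (\<delta> k) (\<eta> k) (f k) (A k) (B k)" for k
    using X(1)[of k] by (simp add: st_def f_def A_def B_def case_prod_beta)
  note S = stageD[OF stg]
  have "nx k (f k, A k, B k) (f (Suc k), A (Suc k), B (Suc k))" for k
    using X(2)[of k] by (simp add: f_def A_def B_def)
  note nxt = this[unfolded nx_def prod.case]
  have nodes: "f (Suc k) x = f k x" if "x \<in> N k" for k x
    using nxt[THEN conjunct1] that unfolding N_def by blast
  have nested: "\<exists>(p,q)\<in>A k \<union> B k. p \<le> u \<and> v \<le> q" if "(u,v) \<in> A (Suc k) \<union> B (Suc k)" for k u v
    using nxt[THEN conjunct2, THEN conjunct1] that by blast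
  have step1: "\<bar>f (Suc k) y - f k y\<bar> \<le> (2 * \<eta> k + \<eta> (Suc k)) * \<bar>y - x\<bar>" if "x \<notin> U k" "x \<notin> U (Suc k)" for k x y
    using nxt[THEN conjunct2, THEN conjunct2, THEN conjunct1] that unfolding U_def by blast
  have step2: "\<bar>f (Suc k) y - f k y\<bar> \<le> 2 * \<eta> k + \<eta> (Suc k)" for k y
    using nxt[THEN conjunct2, THEN conjunct2, THEN conjunct2, THEN conjunct1] by blast
  \<comment> \<open>The index is shifted because the measure estimate is available only for stages
    produced by a step.\<close>
  define D where "D k = (E - U (Suc k)) \<union> (U (Suc k) - E)" for k
  have D: "D k \<in> lmeasurable" "measure lebesgue (D k) \<le> (1/2) ^ k" for k
    using nxt[THEN conjunct2, THEN conjunct2, THEN conjunct2, THEN conjunct2] unfolding D_def U_def by blast+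
  have three: "2 * \<eta> k + \<eta> (Suc k) \<le> 3 * (1/2) ^ k" for k by (simp add: \<eta>_def)
  define L where "L y = lim (\<lambda>k. f k y)" for y
  have L: "(\<lambda>k. f k y) \<longlonglongrightarrow> L y" for y
    unfolding L_def convergent_LIMSEQ_iff[symmetric]
    by (rule geometric_steps_convergent[of _ 3]) (rule order_trans[OF step2 three])
  have L_lip: "\<bar>L x - L y\<bar> \<le> \<bar>x - y\<bar>" for x y
  proof (rule LIMSEQ_le_const2)
    show "(\<lambda>k. \<bar>f k x - f k y\<bar>) \<longlonglongrightarrow> \<bar>L x - L y\<bar>" by (intro tendsto_intros L)
    have "\<bar>f k x - f k y\<bar> \<le> \<bar>x - y\<bar>" for k
      using S(2)[of x y k] c(1,3)[of k] mult_right_mono[of "c k" 1 "\<bar>x - y\<bar>"] by simp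
    then show "\<exists>N. \<forall>k\<ge>N. \<bar>f k x - f k y\<bar> \<le> \<bar>x - y\<bar>" by blast
  qed
  have N_mono: "N k \<subseteq> N (Suc k)" for k
  proof -
    have "(\<Union>(u,v)\<in>A (Suc k) \<union> B (Suc k). {u<..<v}) \<subseteq> (\<Union>(u,v)\<in>A k \<union> B k. {u<..<v})"
    proof
      fix x assume "x \<in> (\<Union>(u,v)\<in>A (Suc k) \<union> B (Suc k). {u<..<v})"
      then obtain u v where uv: "(u,v) \<in> A (Suc k) \<union> B (Suc k)" "x \<in> {u<..<v}" by blast
      obtain p q where pq: "(p,q) \<in> A k \<union> B k" "p \<le> u" "v \<le> q" using nested[OF uv(1)] by blast
      have "x \<in> {p<..<q}" using uv(2) pq by auto
      then show "x \<in> (\<Union>(u,v)\<in>A k \<union> B k. {u<..<v})" using pq(1) by blast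
    qed
    then show ?thesis unfolding N_def by blast
  qed
  have L_node: "L x = f k x" if x: "x \<in> N k" for k x
  proof -
    have mem: "x \<in> N j" if "j \<ge> k" for j
      using subsetD[OF lift_Suc_mono_le[of N, OF N_mono that] x] .
    have "f j x = f k x" if "j \<ge> k" for j
      using that
    proof (induction j rule: dec_induct)
      case (step j)
      then show ?case using nodes[OF mem[OF step.hyps(1)]] by simp
    qed simp
    then have "\<forall>\<^sub>F j in sequentially. f j x = f k x" unfolding eventually_sequentially by blast
    then have "(\<lambda>j. f j x) \<longlonglongrightarrow> f k x" by (rule tendsto_eventually)
    then show ?thesis using L[of x] LIMSEQ_unique by blast
  qed
  have ends: "u \<in> N k" "v \<in> N k" if uv: "(u,v) \<in> A k" for k u v
  proof -
    note P = fine_partitionD[OF S(1)[of k]]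
    have "u < v" using P(1)[of u v] uv by blast
    have "u \<notin> {p<..<q} \<and> v \<notin> {p<..<q}" if "(p,q) \<in> A k \<union> B k" for p q
    proof (cases "(u,v) = (p,q)")
      case False
      then show ?thesis using P(3)[of u v p q] that uv \<open>u < v\<close> by auto
    qed auto
    then show "u \<in> N k" "v \<in> N k" unfolding N_def by blast+
  qed
  \<comment> \<open>The limsup of the open sets \<open>U k\<close>, written as a countable
    intersection of open sets.\<close>
  define E' where "E' = (\<Inter>n. \<Union>k\<in>{n..}. U k)"
  have inE': "x \<in> E' \<longleftrightarrow> (\<forall>n. \<exists>k\<ge>n. x \<in> U k)" for x by (auto simp: E'_def)
  have "gdelta_in euclideanreal E'"
    unfolding E'_def
  proof (rule gdelta_in_Inter)
    show "gdelta_in euclideanreal S" if "S \<in> range (\<lambda>n. \<Union>k\<in>{n..}. U k)" for S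
      using that open_stage_cover[OF stg] by (auto intro!: open_imp_gdelta_in open_UN simp: U_def)
  qed auto
  moreover have "Lip1_set E'"
    unfolding Lip1_set_def
  proof (intro exI[of _ L] conjI allI)
    show "continuous_on UNIV L"
      by (rule lipschitz_on_continuous_on[of 1]) (rule lipschitz_onI, use L_lip in \<open>auto simp: dist_real_def\<close>)
    fix x
    show "Lip L x = ereal (indicator E' x)"
    proof (cases "x \<in> E'")
      case True
      have "1 \<le> Lip L x"
      proof (rule Lip_ge_1)
        fix e d :: real assume ed: "e > 0" "d > 0"
        \<comment> \<open>One power controls both quantities: tiles of stage k have length at most
          \<open>(1/2) ^ k\<close>, and \<open>1 - c k\<close> is half of it.\<close>
        obtain n where n: "(1/2::real) ^ n < min e d" using ed real_arch_pow_inv[of "min e d" "1/2"] by auto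
        obtain k where k: "k \<ge> n" "x \<in> U k" using True unfolding inE' by blast
        have "(1/2::real) ^ k \<le> (1/2) ^ n" using k by (intro power_decreasing) auto
        moreover have "(1/2::real) ^ Suc k \<le> (1/2) ^ k" by simp
        ultimately have k2: "\<eta> k < d" "1 - e \<le> c k" using n unfolding \<eta>_def c_def by linarith+
        obtain u v where uv: "(u,v) \<in> A k" "u \<le> x" "x \<le> v" using k(2) by (auto simp: U_def cover_iff)
        have lt: "u < v" using fine_partitionD(1)[OF S(1)[of k], of u v] uv by blast
        have "\<bar>L v - L u\<bar> = c k * (v - u)" using S(4)[OF uv(1)] L_node ends[OF uv(1)] by simp
        moreover have "(1 - e) * (v - u) \<le> c k * (v - u)" using k2 lt by (intro mult_right_mono) auto
        ultimately have slope: "(1 - e) * (v - u) \<le> \<bar>L v - L u\<bar>" by simp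
        have small: "v - u < d" using S(6)[OF uv(1)] k2 by simp
        \<comment> \<open>The steep chord joins u and v, not x and another point. If the chords from
          x to both ends were less steep, adding them would contradict its slope; x may coincide
          with one end but not with both, which keeps the inequality strict.\<close>
        show "\<exists>y. y \<noteq> x \<and> \<bar>y - x\<bar> < d \<and> (1 - e) * \<bar>y - x\<bar> \<le> \<bar>L y - L x\<bar>"
        proof (rule ccontr)
          assume "\<not> ?thesis"
          then have no: "\<bar>L y - L x\<bar> < (1 - e) * \<bar>y - x\<bar>" if "y \<noteq> x" "\<bar>y - x\<bar> < d" for y
            using that not_le by blast
          have lu: "\<bar>L u - L x\<bar> \<le> (1 - e) * (x - u) \<and> (u < x \<longrightarrow> \<bar>L u - L x\<bar> < (1 - e) * (x - u))"
          proof (cases "u = x")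
            case False
            then have "\<bar>u - x\<bar> = x - u" "\<bar>u - x\<bar> < d" using uv small by auto
            then have "\<bar>L u - L x\<bar> < (1 - e) * (x - u)" using no[OF False] by simp
            then show ?thesis by simp
          qed simp
          have lv: "\<bar>L v - L x\<bar> \<le> (1 - e) * (v - x) \<and> (x < v \<longrightarrow> \<bar>L v - L x\<bar> < (1 - e) * (v - x))"
          proof (cases "v = x")
            case False
            then have "\<bar>v - x\<bar> = v - x" "\<bar>v - x\<bar> < d" using uv small by auto
            then have "\<bar>L v - L x\<bar> < (1 - e) * (v - x)" using no[OF False] by simp
            then show ?thesis by simp
          qed simp
          have "\<bar>L v - L u\<bar> < (1 - e) * (x - u) + (1 - e) * (v - x)" using lu lv lt uv by linarith
          also have "\<dots> = (1 - e) * (v - u)" by (simp add: algebra_simps)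
          finally show False using slope by simp
        qed
      qed
      then show ?thesis using Lip_le_1[OF L_lip, of x] True by (simp add: one_ereal_def)
    next
      case False
      then obtain n where n: "\<And>k. k \<ge> n \<Longrightarrow> x \<notin> U k" unfolding inE' by blast
      \<comment> \<open>Steps of size at most \<open>3 * (1/2) ^ k\<close> relative to
        \<open>\<bar>y - x\<bar>\<close> add up to twice the first. As the bound is relative, it
        forces \<open>L x = f m x\<close> at y = x.\<close>
      have approx: "\<bar>L y - f m y\<bar> \<le> 6 * (1/2) ^ m * \<bar>y - x\<bar>" if m: "m \<ge> n" for m y
      proof (rule LIMSEQ_le_const2)
        show "(\<lambda>k. \<bar>f k y - f m y\<bar>) \<longlonglongrightarrow> \<bar>L y - f m y\<bar>" by (intro tendsto_intros L)
        have bd: "\<bar>f (Suc k) y - f k y\<bar> \<le> 3 * \<bar>y - x\<bar> * (1/2) ^ k" if k: "m \<le> k" for k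
        proof -
          have "\<bar>f (Suc k) y - f k y\<bar> \<le> (2 * \<eta> k + \<eta> (Suc k)) * \<bar>y - x\<bar>"
            using step1 n m k by simp
          also have "\<dots> \<le> 3 * (1/2) ^ k * \<bar>y - x\<bar>" by (rule mult_right_mono[OF three]) simp
          finally show ?thesis by (simp add: mult_ac)
        qed
        have b: "\<bar>f k y - f m y\<bar> \<le> 2 * (3 * \<bar>y - x\<bar>) * ((1/2) ^ m - (1/2) ^ k)" if "m \<le> k" for k
          by (rule geometric_steps_bound[OF bd that])
        have "\<bar>f k y - f m y\<bar> \<le> 6 * (1/2) ^ m * \<bar>y - x\<bar>" if "m \<le> k" for k
        proof -
          have "6 * \<bar>y - x\<bar> * ((1/2) ^ m - (1/2) ^ k) \<le> 6 * \<bar>y - x\<bar> * (1/2) ^ m"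
            by (intro mult_left_mono) auto
          then show ?thesis using b[OF that] by (simp add: mult_ac)
        qed
        then show "\<exists>N. \<forall>k\<ge>N. \<bar>f k y - f m y\<bar> \<le> 6 * (1/2) ^ m * \<bar>y - x\<bar>" by blast
      qed
      have "Lip L x = 0"
      proof (rule Lip_eq_0)
        fix e :: real assume e: "e > 0"
        \<comment> \<open>With 12 = 6 * 2 the approximation error takes half of e, and the
          derivative of \<open>f m\<close> at x the other half.\<close>
        obtain m0 where m0: "(1/2::real) ^ m0 < e / 12" using e real_arch_pow_inv[of "e / 12" "1/2"] by auto
        define m where "m = max n m0"
        have "(1/2::real) ^ m \<le> (1/2) ^ m0" by (rule power_decreasing) (auto simp: m_def)
        then have m: "m \<ge> n" "6 * (1/2::real) ^ m \<le> e / 2" using m0 by (simp add: m_def, linarith)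
        have "x \<notin> cover (A m)" using n[OF m(1)] by (simp add: U_def)
        then obtain d where d: "d > 0" "\<And>y. \<bar>y - x\<bar> < d \<Longrightarrow> \<bar>f m y - f m x\<bar> \<le> e / 2 * \<bar>y - x\<bar>"
          using S(8)[of x m "e/2"] e by auto
        have "\<bar>L y - L x\<bar> \<le> e * \<bar>y - x\<bar>" if "\<bar>y - x\<bar> < d" for y
        proof -
          have "\<bar>L x - f m x\<bar> \<le> 0" using approx[OF m(1), of x] by simp
          moreover have "6 * (1/2) ^ m * \<bar>y - x\<bar> \<le> e / 2 * \<bar>y - x\<bar>" by (rule mult_right_mono[OF m(2)]) simp
          ultimately show ?thesis using approx[OF m(1), of y] d(2)[OF that] by linarith
        qed
        then show "\<exists>d>0. \<forall>y. \<bar>y - x\<bar> < d \<longrightarrow> \<bar>L y - L x\<bar> \<le> e * \<bar>y - x\<bar>" using d(1) by blast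
      qed
      then show ?thesis using False by (simp add: zero_ereal_def)
    qed
  qed
  moreover have "(E - E') \<union> (E' - E) \<in> null_sets lebesgue"
  proof -
    have "limsup D \<in> null_sets lebesgue"
    proof (rule borel_cantelli_limsup1)
      show "D n \<in> sets lebesgue" for n using D by (simp add: fmeasurableD)
      show "emeasure lebesgue (D n) < \<infinity>" for n
        using fmeasurableD2[OF D(1)[of n]] unfolding infinity_ennreal_def less_top .
      show "summable (\<lambda>n. measure lebesgue (D n))"
        by (rule summable_comparison_test'[of "\<lambda>n. (1/2) ^ n" 0]) (use D in \<open>auto intro!: summable_geometric\<close>)
    qed
    moreover have "(E - E') \<union> (E' - E) \<subseteq> limsup D"
    proof
      fix x assume x: "x \<in> (E - E') \<union> (E' - E)"
      have "\<exists>k\<ge>n. x \<in> D k" for n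
      proof (cases "x \<in> E")
        case True
        then have "x \<notin> E'" using x by blast
        then obtain m where m: "\<And>k. k \<ge> m \<Longrightarrow> x \<notin> U k" unfolding inE' by blast
        then show ?thesis using True by (intro exI[of _ "max n m"]) (auto simp: D_def)
      next
        case False
        then have "x \<in> E'" using x by blast
        \<comment> \<open>Starting from \<open>Suc n\<close> makes up for the index shift in
          \<open>D\<close>.\<close>
        then obtain k where k: "k \<ge> Suc n" "x \<in> U k" unfolding inE' by blast
        then show ?thesis using False by (intro exI[of _ "k - 1"]) (auto simp: D_def)
      qed
      then show "x \<in> limsup D" by (auto simp: limsup_INF_SUP)
    qed
    ultimately show ?thesis unfolding negligible_iff_null_sets[symmetric] by (rule negligible_subset)
  qed
  ultimately show ?thesis by blast
qed

end
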